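(* Let $k\ge1$ be an integer, let $K\subset\mathbb{R}^3$ be a tetrahedron, and let $$\Sigma_K=\{T\in\mathcal{P}_{k+3}(K;\mathbb{S}) : \operatorname{div}T\in\mathcal{P}_k(K;\mathbb{R}^3)\},\qquad V_K=\mathcal{P}_k(K;\mathbb{R}^3).$$ Then $\dim\Sigma_K=k^3+12k^2+56k+93$, and the following is a unisolvent set of degrees of freedom for $\Sigma_K$ (i.e. their number equals $\dim\Sigma_K$ and they determine $T\in\Sigma_K$ uniquely): (1) the values of $T$ at the vertices of $K$ ($24$ degrees of freedom); (2) for each edge $e$ of $K$, with unit tangent vector $s$ and linearly independent normal vectors $n_-$ and $n_+$, the moments of degree at most $k+1$ over $e$ of $s'Tn_-$, $s'Tn_+$, $n_-'Tn_-$, $n_+'Tn_+$, $n_-'Tn_+$ ($30k+60$ degrees of freedom); (3) for each face $f$ of $K$ with normal vector $n$, the moments of degree at most $k$ over $f$ of $Tn$ ($6k^2+18k+12$ degrees of freedom); (4) $\int_K T:U\,dx$ for $U\in\epsilon(V_K)$ ($(k+3)(k+2)(k+1)/2-6$ degrees of freedom); (5) $\int_K T:U\,dx$ for $U\in\mathcal{M}_{k+3}(K)$ ($(k+5)(k+1)k/2$ degrees of freedom).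
   Context: $\mathbb{S}$ is the space of real symmetric $3\times3$ matrices; a prime denotes transpose; $S:T$ is the Frobenius product. $\mathcal{P}_j(K;X)$ denotes polynomials of degree at most $j$ on $K$ with values in $X$. The divergence of a matrix field is taken row by row. For a vector field $v$, $\epsilon(v)=\frac12[\operatorname{grad}v+(\operatorname{grad}v)']$. For $j\ge 0$, $$\mathcal{M}_j(K)=\{T\in\mathcal{P}_j(K;\mathbb{S}) : \operatorname{div}T=0 \text{ on } K,\ Tn=0\text{ on }\partial K\},$$ where $n$ is the outward unit normal on $\partial K$. *)

theory Defs
  imports "HOL-Analysis.Analysis" "HOL-Library.Function_Algebras"
begin

text \<open>Pointwise scalar multiplication makes every space of functions into a real vector space, so
  that the library's \<open>span\<close>, \<open>independent\<close> and \<open>dim\<close> apply to spaces of polynomial fields.\<close>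

instantiation "fun" :: (type, real_vector) real_vector
begin

definition "c *\<^sub>R f = (\<lambda>x. c *\<^sub>R f x)"

instance
  by standard (auto simp: scaleR_fun_def fun_eq_iff scaleR_add_right scaleR_add_left)

end

definition is_basis :: "'v::real_vector set \<Rightarrow> 'v set \<Rightarrow> bool" where
  "is_basis B V \<longleftrightarrow> B \<subseteq> V \<and> independent B \<and> V \<subseteq> span B"


subsection \<open>Polynomial fields\<close>

text \<open>The multi-index \<open>\<alpha>\<close> ranges over all exponents of total degree at most \<open>j\<close>.\<close>

definition poly_fun :: "nat \<Rightarrow> (real^3 \<Rightarrow> 'v::real_vector) \<Rightarrow> bool" where
  "poly_fun j p \<longleftrightarrow>
     (\<exists>c :: nat^3 \<Rightarrow> 'v. p = (\<lambda>x. \<Sum>\<alpha> | (\<Sum>i\<in>UNIV. \<alpha> $ i) \<le> j. (\<Prod>i\<in>UNIV. x $ i ^ (\<alpha> $ i)) *\<^sub>R c \<alpha>))"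

text \<open>The space \<open>\<P>\<^sub>j(D; X)\<close> for a region, triangle or segment \<open>D\<close>. A function on \<open>D\<close> is represented by
  its extension by zero to the whole space, so that two polynomials that agree on \<open>D\<close> are the same
  element. This matters when \<open>D\<close> is a face or an edge.\<close>

definition zero_ext :: "(real^3) set \<Rightarrow> (real^3 \<Rightarrow> 'v::zero) \<Rightarrow> real^3 \<Rightarrow> 'v" where
  "zero_ext D p = (\<lambda>x. if x \<in> D then p x else 0)"

definition polys :: "nat \<Rightarrow> (real^3) set \<Rightarrow> 'v::real_vector set \<Rightarrow> (real^3 \<Rightarrow> 'v) set" where
  "polys j D X = {zero_ext D p | p. poly_fun j p \<and> (\<forall>x\<in>D. p x \<in> X)}"

definition symmetric_matrices :: "(real^3^3) set" where
  "symmetric_matrices = {A. transpose A = A}"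

text \<open>Derivatives are taken within \<open>K\<close>. They are unique there at every point of \<open>K\<close>, including its
  boundary points, whenever \<open>K\<close> is convex with nonempty interior.\<close>

definition div_on :: "(real^3) set \<Rightarrow> (real^3 \<Rightarrow> real^3^3) \<Rightarrow> real^3 \<Rightarrow> real^3" where
  "div_on K T = zero_ext K (\<lambda>x. \<chi> i. trace (matrix (frechet_derivative (\<lambda>y. T y $ i) (at x within K))))"

definition grad_on :: "(real^3) set \<Rightarrow> (real^3 \<Rightarrow> real^3) \<Rightarrow> real^3 \<Rightarrow> real^3^3" where
  "grad_on K v = zero_ext K (\<lambda>x. matrix (frechet_derivative v (at x within K)))"

definition sym_grad_on :: "(real^3) set \<Rightarrow> (real^3 \<Rightarrow> real^3) \<Rightarrow> real^3 \<Rightarrow> real^3^3" where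
  "sym_grad_on K v = (\<lambda>x. (1/2) *\<^sub>R (grad_on K v x + transpose (grad_on K v x)))"

definition outward_unit_normal :: "(real^3) set \<Rightarrow> (real^3) set \<Rightarrow> real^3 \<Rightarrow> bool" where
  "outward_unit_normal K f n \<longleftrightarrow> norm n = 1 \<and> (\<forall>x\<in>f. \<forall>y\<in>K. n \<bullet> (y - x) \<le> 0)"

definition M_space :: "nat \<Rightarrow> (real^3) set \<Rightarrow> (real^3 \<Rightarrow> real^3^3) set" where
  "M_space j K = {T \<in> polys j K symmetric_matrices.
     (\<forall>x\<in>K. div_on K T x = 0) \<and>
     (\<forall>f n. f facet_of K \<longrightarrow> outward_unit_normal K f n \<longrightarrow> (\<forall>x\<in>f. T x *v n = 0))}"

definition Sigma_space :: "nat \<Rightarrow> (real^3) set \<Rightarrow> (real^3 \<Rightarrow> real^3^3) set" where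
  "Sigma_space k K = {T \<in> polys (k + 3) K symmetric_matrices. div_on K T \<in> polys k K UNIV}"

definition V_space :: "nat \<Rightarrow> (real^3) set \<Rightarrow> (real^3 \<Rightarrow> real^3) set" where
  "V_space k K = polys k K UNIV"


subsection \<open>Edges and integrals over edges and faces\<close>

definition edges :: "(real^3) set \<Rightarrow> (real^3) set set" where
  "edges K = {e. e face_of K \<and> aff_dim e = 1}"

definition tangent_to :: "(real^3) set \<Rightarrow> real^3 \<Rightarrow> bool" where
  "tangent_to e s \<longleftrightarrow> (\<exists>c. \<exists>x\<in>e. \<exists>y\<in>e. s = c *\<^sub>R (y - x))"

definition normal_to :: "(real^3) set \<Rightarrow> real^3 \<Rightarrow> bool" where
  "normal_to f n \<longleftrightarrow> (\<forall>x\<in>f. \<forall>y\<in>f. n \<bullet> (y - x) = 0)"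

text \<open>Arc length and surface area integrals, through an affine parametrization. The pair \<open>(a, b)\<close>
  (triple \<open>(a, b, c)\<close>) of vertices is determined by \<open>e\<close> (\<open>f\<close>) up to the order, on which the value
  of the integral does not depend.\<close>

definition edge_integral :: "(real^3) set \<Rightarrow> (real^3 \<Rightarrow> real) \<Rightarrow> real" where
  "edge_integral e g =
     (let (a, b) = (SOME p. e = convex hull {fst p, snd p})
      in norm (b - a) * integral {0..1} (\<lambda>t. g (a + t *\<^sub>R (b - a))))"

definition face_integral :: "(real^3) set \<Rightarrow> (real^3 \<Rightarrow> real) \<Rightarrow> real" where
  "face_integral f g =
     (let (a, b, c) = (SOME p. f = convex hull {fst p, fst (snd p), snd (snd p)})
      in norm (cross3 (b - a) (c - a)) *
         integral {(t, u). 0 \<le> t \<and> 0 \<le> u \<and> t + u \<le> 1}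
           (\<lambda>(t, u). g (a + t *\<^sub>R (b - a) + u *\<^sub>R (c - a))))"


subsection \<open>Degrees of freedom\<close>

text \<open>Degrees of freedom are functionals on a given space \<open>X\<close> of fields: all of them are restricted
  to \<open>X\<close>, so that functionals which agree on \<open>X\<close> count as one. For instance, the \<open>(i, j)\<close> and
  \<open>(j, i)\<close> entries at a vertex are the same functional on symmetric matrix fields. The moments
  against a space of test functions are given by an arbitrary basis of that space.\<close>

type_synonym dof = "(real^3 \<Rightarrow> real^3^3) \<Rightarrow> real"

definition vertex_dofs ::
    "(real^3 \<Rightarrow> real^3^3) set \<Rightarrow> (real^3) set \<Rightarrow> dof set" where
  "vertex_dofs X K = {(\<lambda>T\<in>X. T v $ i $ j) | v i j. v extreme_point_of K}"

definition edge_dofs ::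
    "(real^3 \<Rightarrow> real^3^3) set \<Rightarrow> (real^3) set \<Rightarrow> ((real^3) set \<Rightarrow> real^3) \<Rightarrow> ((real^3) set \<Rightarrow> real^3) \<Rightarrow>
     ((real^3) set \<Rightarrow> real^3) \<Rightarrow> ((real^3) set \<Rightarrow> (real^3 \<Rightarrow> real) set) \<Rightarrow> dof set" where
  "edge_dofs X K s nm np B =
     {(\<lambda>T\<in>X. edge_integral e (\<lambda>x. (a \<bullet> (T x *v b)) * q x)) | e a b q.
        e \<in> edges K \<and> q \<in> B e \<and>
        (a, b) \<in> {(s e, nm e), (s e, np e), (nm e, nm e), (np e, np e), (nm e, np e)}}"

definition face_dofs ::
    "(real^3 \<Rightarrow> real^3^3) set \<Rightarrow> (real^3) set \<Rightarrow> ((real^3) set \<Rightarrow> real^3) \<Rightarrow>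
     ((real^3) set \<Rightarrow> (real^3 \<Rightarrow> real) set) \<Rightarrow> dof set" where
  "face_dofs X K n B =
     {(\<lambda>T\<in>X. face_integral f (\<lambda>x. (T x *v n f) $ i * q x)) | f i q. f facet_of K \<and> q \<in> B f}"

text \<open>The inner product of \<^typ>\<open>real^3^3\<close> is the Frobenius product.\<close>

definition interior_dofs ::
    "(real^3 \<Rightarrow> real^3^3) set \<Rightarrow> (real^3) set \<Rightarrow> (real^3 \<Rightarrow> real^3^3) set \<Rightarrow> dof set" where
  "interior_dofs X K B = {(\<lambda>T\<in>X. integral K (\<lambda>x. T x \<bullet> U x)) | U. U \<in> B}"

definition unisolvent :: "(real^3 \<Rightarrow> real^3^3) set \<Rightarrow> dof set \<Rightarrow> bool" where
  "unisolvent X L \<longleftrightarrow>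
     finite L \<and> card L = dim X \<and> (\<forall>T\<in>X. \<forall>T'\<in>X. (\<forall>l\<in>L. l T = l T') \<longrightarrow> T = T')"

end

theory Submission
  imports Defs "HOL-Computational_Algebra.Polynomial"
begin

text \<open>With barycentric coordinates \<open>\<phi>\<^sub>a\<close> and their gradients \<open>g\<^sub>a\<close>, every symmetric matrix is
  \<open>T = -1/2 \<Sum>\<^sub>a\<^sub>b (g\<^sub>a \<bullet> T g\<^sub>b) (a - b)(a - b)'\<close>, the sum over pairs of vertices. A symmetric polynomial
  field has \<open>Tn = 0\<close> on the boundary iff each coefficient with \<open>a \<noteq> b\<close> is a multiple of \<open>\<phi>\<^sub>a \<phi>\<^sub>b\<close>. For these fields
  integration by parts reduces to \<open>\<integral> \<partial>\<^sub>a\<^sub>-\<^sub>b (\<phi>\<^sub>a \<phi>\<^sub>b q) = 0\<close>, and testing with edge bubbles shows that a vector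
  field orthogonal to their divergences has \<open>\<epsilon>(v) = 0\<close>. Hence the divergence maps them onto a space of
  codimension at most six, which bounds \<open>dim \<M>\<close>, while \<open>dim \<Sigma>\<close> is bounded below because the divergence is
  onto.

  A field in \<open>\<Sigma>\<^sub>K\<close> with vanishing degrees of freedom vanishes at the vertices, then its normal components
  vanish on the edges and on the faces, since each of them is a bubble times a polynomial of the tested
  degree. The moments against \<open>\<epsilon>(V\<^sub>K)\<close> give \<open>div T = 0\<close>, and those against \<open>\<M>\<close> give \<open>T = 0\<close>. The
  bounds on the numbers of functionals of each kind add up to the lower bound for \<open>dim \<Sigma>\<^sub>K\<close>, so all of them
  are equalities.\<close>

section \<open>Linear algebra in function spaces\<close>

text \<open>The degrees fit together exactly. An edge bubble \<open>\<phi> a * \<phi> b\<close> uses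
  two of the k + 3 degrees, and \<epsilon>(v) has degree k + 1 when v runs through P_(k+2), the
  target of the divergence. Hence the edge component of \<epsilon>(v) is itself an admissible bubble
  factor, and the orthogonality argument loses nothing. The same balance governs the degrees of
  freedom: k + 3 less the two ends of an edge leaves k + 1, less the three sides of a face leaves k.

  The condition Tn = 0 does not make T vanish on the boundary, so boundary terms have to be
  controlled edge by edge. A line in direction a - b crosses only the facets opposite to a and b,
  and the coefficient of (a - b)(a - b)' vanishes on just these two; the other two facets are
  parallel to the edge. For this reason no surface integral ever appears.

  The number six is the dimension of the infinitesimal rigid motions x \<mapsto> c + w \<times> x,
  the kernel of \<epsilon>. It enters twice with the same origin: as the codimension of the
  divergences and as the loss in passing from V_K to \<epsilon>(V_K).\<close>

definition finite_dim :: "'v::real_vector set \<Rightarrow> bool" where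
  "finite_dim V \<longleftrightarrow> (\<exists>F. finite F \<and> V \<subseteq> span F)"

text \<open>\<open>div_on\<close>, \<open>sym_grad_on\<close> and the moments rest on derivatives
  and integrals with arbitrary default values, so they are linear only on spaces of sufficiently
  regular fields. Linearity is therefore relative to a set.\<close>

definition lin_on :: "'v::real_vector set \<Rightarrow> ('v \<Rightarrow> 'w::real_vector) \<Rightarrow> bool" where
  "lin_on V f \<longleftrightarrow> (\<forall>x\<in>V. \<forall>y\<in>V. f (x + y) = f x + f y) \<and> (\<forall>c. \<forall>x\<in>V. f (c *\<^sub>R x) = c *\<^sub>R f x)"

lemma lin_on_subset: "lin_on V f \<Longrightarrow> U \<subseteq> V \<Longrightarrow> lin_on U f"
  unfolding lin_on_def by blast

lemma linear_lin_on: "linear f \<Longrightarrow> lin_on V f"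
  by (simp add: lin_on_def linear_add linear_scale)

lemma lin_on_diff:
  assumes "subspace V" "lin_on V f" "x \<in> V" "y \<in> V"
  shows "f (x - y) = f x - f y"
proof -
  have "f (x + (-1) *\<^sub>R y) = f x + (-1) *\<^sub>R f y"
    using assms by (metis lin_on_def subspace_scale)
  then show ?thesis by simp
qed

lemma lin_on_zero: "subspace V \<Longrightarrow> lin_on V f \<Longrightarrow> f 0 = 0"
  using lin_on_diff[of V f 0 0] by (auto simp: subspace_0)

lemma lin_on_kernel_subspace:
  assumes "subspace V" "lin_on V f"
  shows "subspace {x \<in> V. f x = 0}"
  using assms lin_on_zero[OF assms]
  by (intro subspaceI) (auto simp: lin_on_def subspace_0 subspace_add subspace_scale)

text \<open>A globally linear extension makes facts on spans and images under linear maps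
  applicable. The induction carries \<open>x \<in> V\<close> along, because \<open>f\<close> is
  additive on V only.\<close>

lemma lin_on_extend:
  assumes "subspace V" "lin_on V f"
  obtains g where "linear g" "\<And>x. x \<in> V \<Longrightarrow> g x = f x"
proof -
  obtain B where B: "B \<subseteq> V" "independent B" "V \<subseteq> span B" by (rule basis_exists[of V]) blast
  obtain g where g: "linear g" "\<forall>x\<in>B. g x = f x" using linear_independent_extend[OF B(2)] by blast
  have "x \<in> V \<and> g x = f x" if "x \<in> span B" for x
    using that
  proof (induction rule: span_induct_alt)
    case base
    then show ?case using assms g lin_on_zero[OF assms] by (simp add: subspace_0 linear_0)
  next
    case (step c x y)
    then have x: "x \<in> V" and y: "y \<in> V" using B by auto
    then have cx: "c *\<^sub>R x \<in> V" using assms by (simp add: subspace_scale)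
    have "g (c *\<^sub>R x + y) = c *\<^sub>R f x + f y" using g step by (simp add: linear_add linear_scale)
    also have "\<dots> = f (c *\<^sub>R x + y)" using assms(2) x y cx by (simp add: lin_on_def)
    finally show ?case using cx y assms by (simp add: subspace_add)
  qed
  then show ?thesis using that g(1) B(3) by blast
qed

lemma finite_dim_subset: "finite_dim V \<Longrightarrow> U \<subseteq> V \<Longrightarrow> finite_dim U"
  unfolding finite_dim_def by blast

lemma finite_dim_euclidean: "finite_dim (V :: 'v::euclidean_space set)"
  unfolding finite_dim_def using finite_Basis span_Basis by blast

lemma finite_dim_independent:
  assumes "finite_dim V" "B \<subseteq> V" "independent B"
  shows "finite B"
  using assms independent_span_bound unfolding finite_dim_def by blast

lemma finite_dim_basis:
  assumes "finite_dim V"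
  obtains B where "B \<subseteq> V" "independent B" "V \<subseteq> span B" "finite B" "card B = dim V"
  using basis_exists[of V] finite_dim_independent[OF assms] by metis

lemma finite_dim_dim_mono:
  assumes "finite_dim V" "U \<subseteq> V"
  shows "dim U \<le> dim V"
proof -
  obtain B where B: "V \<subseteq> span B" "finite B" "card B = dim V" using finite_dim_basis[OF assms(1)] by metis
  then show ?thesis using dim_le_card[of U B] assms(2) by auto
qed

lemma finite_dim_lin_image:
  assumes "subspace V" "finite_dim V" "lin_on V f"
  shows "finite_dim (f ` V)"
proof -
  obtain g where g: "linear g" "\<And>x. x \<in> V \<Longrightarrow> g x = f x" using lin_on_extend assms by metis
  obtain F where "finite F" "V \<subseteq> span F" using assms unfolding finite_dim_def by blast
  then have "f ` V \<subseteq> span (g ` F)" "finite (g ` F)"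
  proof -
    have "f ` V = g ` V" using g by auto
    also have "\<dots> \<subseteq> g ` span F" using \<open>V \<subseteq> span F\<close> by (rule image_mono)
    finally show "f ` V \<subseteq> span (g ` F)" by (simp add: linear_span_image[OF g(1)])
  qed (use \<open>finite F\<close> in simp)
  then show ?thesis unfolding finite_dim_def by blast
qed

theorem rank_nullity:
  assumes V: "subspace V" "finite_dim V" and f: "lin_on V f"
  shows "dim V = dim {x \<in> V. f x = 0} + dim (f ` V)"
proof -
  let ?N = "{x \<in> V. f x = 0}"
  obtain g where g: "linear g" "\<And>x. x \<in> V \<Longrightarrow> g x = f x" by (rule lin_on_extend[OF V(1) f]) blast
  have N: "finite_dim ?N" using V(2) by (rule finite_dim_subset) auto
  obtain A where A: "A \<subseteq> ?N" "independent A" "?N \<subseteq> span A" "finite A" "card A = dim ?N"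
    by (rule finite_dim_basis[OF N])
  have "A \<subseteq> V" using A(1) by blast
  obtain B where B: "A \<subseteq> B" "B \<subseteq> V" "independent B" "V \<subseteq> span B"
    by (rule maximal_independent_subset_extend[OF \<open>A \<subseteq> V\<close> A(2)])
  have finB: "finite B" using finite_dim_independent[OF V(2)] B by blast
  have cardB: "card B = dim V" using basis_card_eq_dim B by blast
  \<comment> \<open>The spans of A and B - A meet only in 0: subtracting two representations of x
    gives a single relation \<open>?h\<close> on the independent set B, so the coefficients on A
    vanish.\<close>
  have zero: "x = 0" if x: "x \<in> span A" "x \<in> span (B - A)" for x
  proof -
    obtain u where u: "x = (\<Sum>a\<in>A. u a *\<^sub>R a)" using x(1) unfolding span_finite[OF A(4)] by (rule rangeE)
    obtain w where w: "x = (\<Sum>a\<in>B - A. w a *\<^sub>R a)"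
      using x(2) unfolding span_finite[OF finite_Diff[OF finB]] by (rule rangeE)
    let ?h = "\<lambda>b. if b \<in> A then u b else - w b"
    have "(\<Sum>b\<in>B. ?h b *\<^sub>R b) = (\<Sum>b\<in>B - A. ?h b *\<^sub>R b) + (\<Sum>b\<in>A. ?h b *\<^sub>R b)"
      by (rule sum.subset_diff[OF B(1) finB])
    also have "(\<Sum>b\<in>B - A. ?h b *\<^sub>R b) = - x" unfolding w sum_negf[symmetric]
      by (rule sum.cong) auto
    also have "(\<Sum>b\<in>A. ?h b *\<^sub>R b) = x" unfolding u by (rule sum.cong) auto
    finally have h0: "(\<Sum>b\<in>B. ?h b *\<^sub>R b) = 0" by simp
    have "u a = 0" if "a \<in> A" for a
    proof -
      have "?h a = 0" by (rule independentD[OF B(3) finB subset_refl h0]) (use that B(1) in blast)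
      then show ?thesis using that by simp
    qed
    then show "x = 0" unfolding u by simp
  qed
  have inj: "inj_on g (span (B - A))"
  proof (rule inj_onI)
    fix x y assume xy: "x \<in> span (B - A)" "y \<in> span (B - A)" "g x = g y"
    have d: "x - y \<in> span (B - A)" using xy span_diff by blast
    moreover have "span (B - A) \<subseteq> V" by (rule span_minimal[OF _ V(1)]) (use B(2) in blast)
    ultimately have "x - y \<in> V" by blast
    moreover have "g (x - y) = 0" using xy(3) linear_diff[OF g(1)] by simp
    ultimately have "x - y \<in> span A" using g(2)[of "x - y"] A(3) by auto
    then show "x = y" using zero d by fastforce
  qed
  have "independent (B - A)" using B(3) by (rule independent_mono) auto
  then have ind: "independent (g ` (B - A))"
    using linear_independent_injective_image[OF g(1)] inj by blast
  have sub: "f ` V \<subseteq> span (g ` (B - A))"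
  proof
    fix y assume "y \<in> f ` V"
    then obtain x where x: "x \<in> V" "y = g x" using g by auto
    then have "y \<in> g ` span B" using B(4) by blast
    then have "y \<in> span (g ` B)" by (simp add: linear_span_image[OF g(1)])
    moreover have "g x \<in> insert 0 (g ` (B - A))" if "x \<in> B" for x
    proof (cases "x \<in> A")
      case True
      then have "x \<in> V" "f x = 0" using A(1) by auto
      then show ?thesis using g(2)[of x] by simp
    qed (use that in blast)
    then have "g ` B \<subseteq> insert 0 (g ` (B - A))" by blast
    ultimately show "y \<in> span (g ` (B - A))" by (metis span_insert_0 span_mono subsetD)
  qed
  have "dim (f ` V) = card (g ` (B - A))"
  proof (rule dim_unique[OF _ sub ind refl])
    show "g ` (B - A) \<subseteq> f ` V" using g B by auto
  qed
  also have "\<dots> = card (B - A)"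
    by (rule card_image) (meson inj inj_on_subset span_superset)
  also have "\<dots> = card B - card A" using finB B by (simp add: card_Diff_subset finite_subset)
  finally show ?thesis using cardB A(5) card_mono[OF finB B(1)] by simp
qed

lemma dim_le_injective:
  assumes "subspace V" "finite_dim V" "lin_on V f" "finite_dim W" "f ` V \<subseteq> W"
    and "\<And>x. x \<in> V \<Longrightarrow> f x = 0 \<Longrightarrow> x = 0"
  shows "dim V \<le> dim W"
proof -
  have "dim {x \<in> V. f x = 0} \<le> card ({} :: 'a set)"
    by (rule dim_le_card) (use assms in auto)
  then show ?thesis
    using rank_nullity[OF assms(1-3)] finite_dim_dim_mono[OF assms(4,5)] by simp
qed

lemma dim_lin_image_eq:
  assumes "subspace V" "finite_dim V" "lin_on V f" 
    and "\<And>x. x \<in> V \<Longrightarrow> f x = 0 \<Longrightarrow> x = 0"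
  shows "dim (f ` V) = dim V"
proof -
  have "dim {x \<in> V. f x = 0} \<le> card ({} :: 'a set)"
    by (rule dim_le_card) (use assms in auto)
  then show ?thesis using rank_nullity[OF assms(1-3)] by simp
qed

lemma sum_fun_apply: "(\<Sum>i\<in>I. f i) x = (\<Sum>i\<in>I. f i x)"
  by (induction I rule: infinite_finite_induct) auto

lemma scaleR_fun_apply [simp]: "(c *\<^sub>R f) x = c *\<^sub>R f x"
  by (simp add: scaleR_fun_def)

text \<open>The functions vanishing off L stand in for Euclidean space of dimension
  \<open>card L\<close>, which would need a type depending on L. They receive the vector of values
  of the functionals in L.\<close>

lemma finite_dim_functions_supported:
  assumes "finite L"
  shows "finite_dim {f :: 'a \<Rightarrow> real. \<forall>l. l \<notin> L \<longrightarrow> f l = 0}"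
    and "dim {f :: 'a \<Rightarrow> real. \<forall>l. l \<notin> L \<longrightarrow> f l = 0} \<le> card L"
proof -
  let ?e = "\<lambda>l. (\<lambda>m. if m = l then 1 else 0 :: real)"
  have *: "{f :: 'a \<Rightarrow> real. \<forall>l. l \<notin> L \<longrightarrow> f l = 0} \<subseteq> span (?e ` L)"
  proof safe
    fix f :: "'a \<Rightarrow> real" assume f: "\<forall>l. l \<notin> L \<longrightarrow> f l = 0"
    have "f = (\<Sum>l\<in>L. f l *\<^sub>R ?e l)"
    proof
      fix m show "f m = (\<Sum>l\<in>L. f l *\<^sub>R ?e l) m"
        using f assms by (cases "m \<in> L") (auto simp: sum_fun_apply if_distrib cong: if_cong)
    qed
    also have "\<dots> \<in> span (?e ` L)" by (intro span_sum span_scale span_base) auto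
    finally show "f \<in> span (?e ` L)" .
  qed
  then show "finite_dim {f :: 'a \<Rightarrow> real. \<forall>l. l \<notin> L \<longrightarrow> f l = 0}"
    unfolding finite_dim_def using assms by blast
  have "dim {f :: 'a \<Rightarrow> real. \<forall>l. l \<notin> L \<longrightarrow> f l = 0} \<le> card (?e ` L)"
    by (rule dim_le_card[OF *]) (use assms in auto)
  also have "\<dots> \<le> card L" using assms by (rule card_image_le)
  finally show "dim {f :: 'a \<Rightarrow> real. \<forall>l. l \<notin> L \<longrightarrow> f l = 0} \<le> card L" .
qed

text \<open>Each functional lowers the dimension by at most one. This serves both for orthogonality
  to a basis of divergences and for the final count of degrees of freedom.\<close>

lemma dim_le_card_functionals:
  fixes V :: "'v::real_vector set"
  assumes V: "subspace V" "finite_dim V" and L: "finite L"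
    and lin: "\<And>l. l \<in> L \<Longrightarrow> lin_on V (F l :: 'v \<Rightarrow> real)"
  shows "dim V \<le> dim {x \<in> V. \<forall>l\<in>L. F l x = 0} + card L"
proof -
  let ?f = "\<lambda>x l. if l \<in> L then F l x else 0"
  have "lin_on V ?f" unfolding lin_on_def
  proof (intro conjI ballI allI ext)
    fix x y l assume "x \<in> V" "y \<in> V"
    then show "?f (x + y) l = (?f x + ?f y) l" using lin[of l] by (simp add: lin_on_def)
  next
    fix c x l assume "x \<in> V"
    then show "?f (c *\<^sub>R x) l = (c *\<^sub>R ?f x) l" using lin[of l] by (simp add: lin_on_def)
  qed
  from rank_nullity[OF V this]
  have "dim V = dim {x \<in> V. ?f x = 0} + dim (?f ` V)" .
  moreover have "{x \<in> V. ?f x = 0} = {x \<in> V. \<forall>l\<in>L. F l x = 0}" by (auto simp: fun_eq_iff)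
  moreover have "dim (?f ` V) \<le> card L"
    by (rule order_trans[OF finite_dim_dim_mono finite_dim_functions_supported(2)[OF L]])
      (use finite_dim_functions_supported(1)[OF L] in auto)
  ultimately show ?thesis by simp
qed

section \<open>Polynomial maps of bounded degree\<close>

text \<open>Degree is counted by affine factors instead of monomials, on any Euclidean domain and
  with constants from X. Affine substitution, restriction to a line and division by barycentric
  coordinates then need no expansion in coordinates, and for a subspace X all values stay in
  X.\<close>

inductive is_pol :: "'v::real_vector set \<Rightarrow> nat \<Rightarrow> ('a::euclidean_space \<Rightarrow> 'v) \<Rightarrow> bool" for X where
  const: "c \<in> X \<Longrightarrow> is_pol X j (\<lambda>x. c)"
| add: "is_pol X j p \<Longrightarrow> is_pol X j q \<Longrightarrow> is_pol X j (\<lambda>x. p x + q x)"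
| mult: "is_pol X j p \<Longrightarrow> is_pol X (Suc j) (\<lambda>x. (w \<bullet> x + d) *\<^sub>R p x)"

definition pol :: "'v::real_vector set \<Rightarrow> nat \<Rightarrow> ('a::euclidean_space \<Rightarrow> 'v) set" where
  "pol X j = {p. is_pol X j p}"

lemma pol_const: "c \<in> X \<Longrightarrow> (\<lambda>x. c) \<in> pol X j"
  and pol_add: "p \<in> pol X j \<Longrightarrow> q \<in> pol X j \<Longrightarrow> (\<lambda>x. p x + q x) \<in> pol X j"
  and pol_mult: "p \<in> pol X j \<Longrightarrow> (\<lambda>x. (w \<bullet> x + d) *\<^sub>R p x) \<in> pol X (Suc j)"
  by (auto simp: pol_def intro: is_pol.intros)

lemma pol_induct [consumes 1, case_names const add mult]:
  assumes "p \<in> pol X j"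
    and "\<And>c j. c \<in> X \<Longrightarrow> P j (\<lambda>x. c)"
    and "\<And>j p q. p \<in> pol X j \<Longrightarrow> P j p \<Longrightarrow> q \<in> pol X j \<Longrightarrow> P j q \<Longrightarrow> P j (\<lambda>x. p x + q x)"
    and "\<And>j p w d. p \<in> pol X j \<Longrightarrow> P j p \<Longrightarrow> P (Suc j) (\<lambda>x. (w \<bullet> x + d) *\<^sub>R p x)"
  shows "P j p"
  using assms(1) unfolding pol_def mem_Collect_eq
  by (induction rule: is_pol.induct) (use assms(2-4) in \<open>auto simp: pol_def\<close>)

lemma pol_Suc: "p \<in> pol X j \<Longrightarrow> p \<in> pol X (Suc j)"
  using pol_mult[of p X j 0 1] by simp

lemma pol_mono: "p \<in> pol X i \<Longrightarrow> i \<le> j \<Longrightarrow> p \<in> pol X j"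
  by (rule lift_Suc_mono_le[of "pol X" i j, THEN subsetD]) (auto intro: pol_Suc)

lemma pol_linear:
  assumes "p \<in> pol X j" "linear L" "L ` X \<subseteq> Y"
  shows "(\<lambda>x. L (p x)) \<in> pol Y j"
  using assms(1)
proof (induction rule: pol_induct)
  case (const c j)
  then show ?case using assms(3) by (auto intro: pol_const)
next
  case (add j p q)
  then show ?case using pol_add by (simp add: linear_add[OF assms(2)])
next
  case (mult j p w d)
  then show ?case using pol_mult by (simp add: linear_scale[OF assms(2)])
qed

lemma pol_subset: "p \<in> pol X j \<Longrightarrow> X \<subseteq> Y \<Longrightarrow> p \<in> pol Y j"
  using pol_linear[of p X j "\<lambda>x. x" Y] by (simp add: module_hom_ident)

lemma pol_value:
  assumes "subspace X" "p \<in> pol X j"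
  shows "p x \<in> X"
  using assms(2) by (induction rule: pol_induct) (use assms(1) in \<open>auto intro: subspace_add subspace_scale\<close>)

lemma pol_scale: "subspace X \<Longrightarrow> p \<in> pol X j \<Longrightarrow> (\<lambda>x. c *\<^sub>R p x) \<in> pol X j"
  by (rule pol_linear[of p X j "\<lambda>x. c *\<^sub>R x"]) (auto intro: subspace_scale)

lemma pol_0_const:
  assumes "subspace X" "p \<in> pol X 0"
  obtains c where "c \<in> X" "p = (\<lambda>x. c)"
proof -
  have "\<exists>c\<in>X. p = (\<lambda>x. c)" if "p \<in> pol X j" "j = 0" for j
    using that by (induction rule: pol_induct) (use assms(1) in \<open>auto intro: subspace_add\<close>)
  then show ?thesis using assms(2) that by blast
qed

lemma pol_sum:
  assumes "subspace X" "\<And>i. i \<in> I \<Longrightarrow> p i \<in> pol X j"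
  shows "(\<lambda>x. \<Sum>i\<in>I. p i x) \<in> pol X j"
  using assms(2)
  by (induction I rule: infinite_finite_induct) (auto intro: pol_add pol_const subspace_0[OF assms(1)])

lemma pol_subspace: "subspace X \<Longrightarrow> subspace (pol X j)"
  by (rule subspaceI)
    (auto simp: zero_fun_def plus_fun_def scaleR_fun_def intro: pol_add pol_const pol_scale subspace_0)

lemma pol_scaleR:
  assumes "p \<in> pol UNIV i" "q \<in> pol X j" "subspace X"
  shows "(\<lambda>x. p x *\<^sub>R q x) \<in> pol X (i + j)"
  using assms(1)
proof (induction rule: pol_induct)
  case (const c i)
  then show ?case using assms by (auto intro: pol_mono[of _ X j] pol_scale)
next
  case (add i p p')
  then show ?case using pol_add by (simp add: scaleR_add_left)
next
  case (mult i p w d)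
  then show ?case using pol_mult[OF mult.IH, of w d] by simp
qed

lemma pol_affine: "(\<lambda>x. w \<bullet> x + d) \<in> pol (UNIV :: real set) (Suc 0)"
  using pol_mult[of "\<lambda>x. 1" "UNIV :: real set" 0 w d] by (simp add: pol_const)

lemma pol_inner:
  fixes p q :: "'a::euclidean_space \<Rightarrow> 'v::euclidean_space"
  assumes "p \<in> pol UNIV i" "q \<in> pol UNIV j"
  shows "(\<lambda>x. p x \<bullet> q x) \<in> pol UNIV (i + j)"
  using assms(1)
proof (induction rule: pol_induct)
  case (const c i)
  have "(\<lambda>x. c \<bullet> q x) \<in> pol UNIV j"
    by (rule pol_linear[OF assms(2)]) (auto intro: bounded_linear.linear bounded_linear_inner_right)
  then show ?case by (rule pol_mono) simp
next
  case (add i p p')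
  then show ?case using pol_add by (simp add: inner_add_left)
next
  case (mult i p w d)
  then show ?case using pol_mult[OF mult.IH, of w d] by simp
qed

lemma pol_compose_affine:
  assumes "p \<in> pol X j" "linear A"
  shows "(\<lambda>x. p (A x + b)) \<in> pol X j"
  using assms(1)
proof (induction rule: pol_induct)
  case (mult j p w d)
  have "w \<bullet> (A x + b) + d = adjoint A w \<bullet> x + (w \<bullet> b + d)" for x
    by (simp add: inner_add_right adjoint_works[OF assms(2)] inner_commute)
  then show ?case using pol_mult[OF mult.IH, of "adjoint A w" "w \<bullet> b + d"] by presburger
qed (auto intro: pol_const pol_add pol_mult)

lemma pol_continuous_on:
  fixes p :: "'a::euclidean_space \<Rightarrow> 'v::real_normed_vector"
  shows "p \<in> pol X j \<Longrightarrow> continuous_on S p"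
  by (induction rule: pol_induct) (auto intro!: continuous_intros)

section \<open>Zeros of polynomials along lines and on convex sets\<close>

lemma pol_real_poly:
  assumes "(p :: real \<Rightarrow> real) \<in> pol X j"
  shows "\<exists>P. p = poly P"
  using assms
proof (induction rule: pol_induct)
  case (const c j)
  show ?case by (rule exI[of _ "[:c:]"]) auto
next
  case (add j p q)
  then obtain P Q where "p = poly P" "q = poly Q" by blast
  then show ?case by (intro exI[of _ "P + Q"]) auto
next
  case (mult j p w d)
  then obtain P where P: "p = poly P" by blast
  show ?case unfolding P by (rule exI[of _ "[:d, w:] * P"]) (auto simp: algebra_simps)
qed

text \<open>Every component is a univariate polynomial with infinitely many roots. Vanishing in
  several variables is reduced to this case along a line.\<close>

lemma pol_vanish_near_right:
  fixes p :: "real \<Rightarrow> 'v::euclidean_space"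
  assumes p: "p \<in> pol X j" and e: "e > 0" and 0: "\<And>t. 0 < t \<Longrightarrow> t < e \<Longrightarrow> p t = 0"
  shows "p t = 0"
proof (rule euclidean_eqI)
  fix b :: 'v assume "b \<in> Basis"
  have "(\<lambda>t. p t \<bullet> b) \<in> pol UNIV j"
    by (rule pol_linear[OF p]) (auto intro: bounded_linear.linear bounded_linear_inner_left)
  then obtain P where P: "(\<lambda>t. p t \<bullet> b) = poly P" using pol_real_poly by blast
  have "{0<..<e} \<subseteq> {t. poly P t = 0}" using 0 by (auto simp flip: P)
  moreover have "infinite {0<..<e}" using e by simp
  ultimately have "P = 0" using poly_roots_finite[of P] finite_subset by blast
  then show "p t \<bullet> b = 0 \<bullet> b" using P by (metis inner_zero_left poly_0)
qed

lemma pol_on_line: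
  assumes "p \<in> pol X j"
  shows "(\<lambda>t::real. p (x + t *\<^sub>R y)) \<in> pol X j"
proof -
  have "linear (\<lambda>t::real. t *\<^sub>R y)" by simp
  from pol_compose_affine[OF assms this, of x] show ?thesis by (simp add: add.commute)
qed

text \<open>From a relative interior point of S, every line inside the affine hull stays in S for a
  while, and vanishing on that piece forces vanishing at y.\<close>

lemma pol_vanish_affine_hull:
  fixes p :: "'a::euclidean_space \<Rightarrow> 'v::euclidean_space"
  assumes p: "p \<in> pol X j" and S: "convex S" and 0: "\<And>x. x \<in> S \<Longrightarrow> p x = 0"
    and y: "y \<in> affine hull S"
  shows "p y = 0"
proof -
  have "S \<noteq> {}" using y by auto
  then obtain x where x: "x \<in> rel_interior S" using rel_interior_eq_empty[OF S] by blast
  then obtain e where e: "e > 0" "ball x e \<inter> affine hull S \<subseteq> S" and xS: "x \<in> S"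
    using mem_rel_interior_ball by blast
  \<comment> \<open>The summand 1 keeps the quotient meaningful when y = x.\<close>
  let ?e = "e / (norm (y - x) + 1)"
  have pos: "norm (y - x) + 1 > 0" by (simp add: add_nonneg_pos)
  have "p (x + t *\<^sub>R (y - x)) = 0" if t: "0 < t" "t < ?e" for t
  proof (rule 0, rule subsetD[OF e(2)], rule IntI)
    have "t * norm (y - x) \<le> t * (norm (y - x) + 1)" using t by (simp add: mult_left_mono)
    also have "\<dots> < e" using t(2) pos by (simp add: pos_less_divide_eq)
    finally show "x + t *\<^sub>R (y - x) \<in> ball x e" using t by (simp add: dist_norm)
    have "(1 - t) *\<^sub>R x + t *\<^sub>R y \<in> affine hull S"
      by (rule mem_affine[OF affine_affine_hull]) (use y xS in \<open>auto simp: hull_inc\<close>)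
    then show "x + t *\<^sub>R (y - x) \<in> affine hull S" by (simp add: algebra_simps)
  qed
  moreover have "0 < ?e" using e pos by simp
  ultimately have "p (x + 1 *\<^sub>R (y - x)) = 0"
    using pol_vanish_near_right[OF pol_on_line[OF p, of x "y - x"], of ?e 1] by blast
  then show ?thesis by simp
qed

text \<open>The affine factor is nonzero at \<open>x0\<close>, hence near it; on the segment from
  \<open>x0\<close> to y the polynomial itself then vanishes on an initial piece.\<close>

lemma pol_vanish_cancel:
  fixes p :: "'a::euclidean_space \<Rightarrow> 'v::euclidean_space"
  assumes p: "p \<in> pol X j" and S: "convex S" and 0: "\<And>x. x \<in> S \<Longrightarrow> (w \<bullet> x + d) *\<^sub>R p x = 0"
    and x0: "x0 \<in> S" "w \<bullet> x0 + d \<noteq> 0" and y: "y \<in> S"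
  shows "p y = 0"
proof -
  let ?a = "\<lambda>t. w \<bullet> (x0 + t *\<^sub>R (y - x0)) + d"
  have "isCont ?a 0" by (intro continuous_intros)
  moreover have "?a 0 \<noteq> 0" using x0 by simp
  ultimately obtain e where e: "e > 0" "\<And>t. \<bar>t\<bar> < e \<Longrightarrow> ?a t \<noteq> 0"
    using continuous_at_avoid[of 0 ?a 0] by (auto simp: dist_real_def)
  have "p (x0 + t *\<^sub>R (y - x0)) = 0" if t: "0 < t" "t < min e 1" for t
  proof -
    have "(1 - t) *\<^sub>R x0 + t *\<^sub>R y \<in> S" using S x0(1) y t by (intro convexD) auto
    then have "x0 + t *\<^sub>R (y - x0) \<in> S" by (simp add: algebra_simps)
    then show ?thesis using 0 e(2)[of t] t by (metis abs_of_pos min_less_iff_conj scaleR_eq_0_iff)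
  qed
  moreover have "0 < min e 1" using e by simp
  ultimately have "p (x0 + 1 *\<^sub>R (y - x0)) = 0"
    using pol_vanish_near_right[OF pol_on_line[OF p, of x0 "y - x0"], of "min e 1" 1] by blast
  then show ?thesis by simp
qed

text \<open>Division by the affine form l = w \<bullet> x + d. The remainder is p at the projection
  of x along u onto the plane l = 0, so it disappears as soon as p vanishes on that plane. At j = 0
  the bound j - 1 is truncated to 0, and the last clause replaces the missing degree -1.\<close>

lemma pol_expand:
  assumes p: "p \<in> pol X j" and X: "subspace X" and u: "w \<bullet> u = 1"
  obtains q where "q \<in> pol X (j - 1)" "\<And>x. p x = (w \<bullet> x + d) *\<^sub>R q x + p (x - (w \<bullet> x + d) *\<^sub>R u)"
    "j = 0 \<Longrightarrow> q = (\<lambda>x. 0)"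
proof -
  let ?l = "\<lambda>x. w \<bullet> x + d"
  let ?\<pi> = "\<lambda>x. x - ?l x *\<^sub>R u"
  have lin: "linear (\<lambda>x. x - (w \<bullet> x) *\<^sub>R u)"
    by (rule linearI) (auto simp: algebra_simps inner_add_right)
  have "\<exists>q. q \<in> pol X (j - 1) \<and> (\<forall>x. p x = ?l x *\<^sub>R q x + p (?\<pi> x)) \<and> (j = 0 \<longrightarrow> q = (\<lambda>x. 0))"
    using p
  proof (induction rule: pol_induct)
    case (const c j)
    show ?case by (rule exI[of _ "\<lambda>x. 0"]) (auto intro: pol_const subspace_0[OF X])
  next
    case (add j p p')
    then obtain q q' where q: "q \<in> pol X (j - 1)" "\<And>x. p x = ?l x *\<^sub>R q x + p (?\<pi> x)" "j = 0 \<longrightarrow> q = (\<lambda>x. 0)"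
      "q' \<in> pol X (j - 1)" "\<And>x. p' x = ?l x *\<^sub>R q' x + p' (?\<pi> x)" "j = 0 \<longrightarrow> q' = (\<lambda>x. 0)" by blast
    have *: "p x + p' x = ?l x *\<^sub>R (q x + q' x) + (p (?\<pi> x) + p' (?\<pi> x))" for x
      unfolding scaleR_add_right using q(2)[of x] q(5)[of x] by (metis add.assoc add.left_commute)
    show ?case
    proof (intro exI[of _ "\<lambda>x. q x + q' x"] conjI allI)
      show "(\<lambda>x. q x + q' x) \<in> pol X (j - 1)" by (rule pol_add[OF q(1,4)])
      show "p x + p' x = ?l x *\<^sub>R (q x + q' x) + (p (?\<pi> x) + p' (?\<pi> x))" for x by (rule *)
      show "j = 0 \<longrightarrow> (\<lambda>x. q x + q' x) = (\<lambda>x. 0)" using q(3,6) by simp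
    qed
  next
    case (mult j p v e)
    then obtain q where q: "q \<in> pol X (j - 1)" "\<And>x. p x = ?l x *\<^sub>R q x + p (?\<pi> x)" "j = 0 \<Longrightarrow> q = (\<lambda>x. 0)"
      by blast
    \<comment> \<open>From v \<bullet> x + e = (v \<bullet> \<pi>(x) + e) + l(x) (v \<bullet> u):
      the first summand multiplies both quotient and remainder of p, the second sends all of p into
      the quotient.\<close>
    let ?q = "\<lambda>x. (v \<bullet> ?\<pi> x + e) *\<^sub>R q x + (v \<bullet> u) *\<^sub>R p x"
    have "(\<lambda>x. (v \<bullet> ?\<pi> x + e) *\<^sub>R q x) \<in> pol X j"
    proof (cases "j = 0")
      case True
      then show ?thesis using q(3) by (auto intro: pol_const subspace_0[OF X])
    next
      case False
      have "v \<bullet> ?\<pi> x + e = (v - (v \<bullet> u) *\<^sub>R w) \<bullet> x + (e - d * (v \<bullet> u))" for x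
        by (simp add: algebra_simps inner_diff_right)
      moreover have "Suc (j - 1) = j" using False by simp
      ultimately show ?thesis
        using pol_mult[OF q(1), of "v - (v \<bullet> u) *\<^sub>R w" "e - d * (v \<bullet> u)"] by presburger
    qed
    then have 1: "?q \<in> pol X j" using mult by (intro pol_add pol_scale X)
    have 2: "(v \<bullet> x + e) *\<^sub>R p x = ?l x *\<^sub>R ?q x + (v \<bullet> ?\<pi> x + e) *\<^sub>R p (?\<pi> x)" for x
    proof -
      have "(v \<bullet> x + e) = (v \<bullet> ?\<pi> x + e) + ?l x * (v \<bullet> u)" by (simp add: inner_diff_right)
      then have "(v \<bullet> x + e) *\<^sub>R p x = (v \<bullet> ?\<pi> x + e) *\<^sub>R p x + (?l x * (v \<bullet> u)) *\<^sub>R p x"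
        by (simp only: scaleR_add_left)
      also have "(v \<bullet> ?\<pi> x + e) *\<^sub>R p x = (v \<bullet> ?\<pi> x + e) *\<^sub>R (?l x *\<^sub>R q x + p (?\<pi> x))"
        using q(2)[of x] by simp
      finally show ?thesis by (simp add: scaleR_add_right mult.commute)
    qed
    show ?case by (intro exI[of _ ?q] conjI allI 2) (use 1 in simp_all)
  qed
  then show ?thesis using that by blast
qed

lemma pol_has_derivative:
  fixes p :: "'a::euclidean_space \<Rightarrow> 'v::real_normed_vector"
  assumes p: "p \<in> pol X j" and X: "subspace X"
  obtains p' where "\<And>x. (p has_derivative p' x) (at x)" "\<And>h. (\<lambda>x. p' x h) \<in> pol X (j - 1)"
proof -
  have "\<exists>p'. (\<forall>x. (p has_derivative p' x) (at x)) \<and> (\<forall>h. (\<lambda>x. p' x h) \<in> pol X (j - 1))"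
    using p
  proof (induction rule: pol_induct)
    case (const c j)
    show ?case by (rule exI[of _ "\<lambda>x h. 0"]) (auto intro: pol_const subspace_0[OF X])
  next
    case (add j p q)
    then obtain p' q' where "\<forall>x. (p has_derivative p' x) (at x)" "\<forall>h. (\<lambda>x. p' x h) \<in> pol X (j - 1)"
      "\<forall>x. (q has_derivative q' x) (at x)" "\<forall>h. (\<lambda>x. q' x h) \<in> pol X (j - 1)" by blast
    then show ?case
      by (intro exI[of _ "\<lambda>x h. p' x h + q' x h"]) (auto intro: pol_add has_derivative_add)
  next
    case (mult j p w d)
    then obtain p' where p': "\<And>x. (p has_derivative p' x) (at x)" "\<And>h. (\<lambda>x. p' x h) \<in> pol X (j - 1)"
      by blast
    let ?D = "\<lambda>x h. (w \<bullet> x + d) *\<^sub>R p' x h + (w \<bullet> h) *\<^sub>R p x"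
    have "((\<lambda>x. (w \<bullet> x + d) *\<^sub>R p x) has_derivative ?D x) (at x)" for x
      by (auto intro!: derivative_eq_intros p'(1))
    \<comment> \<open>For j = 0 the truncated bound on p' does not drop, and the affine factor would
      overshoot the degree; but then p is constant and p' = 0.\<close>
    moreover have "(\<lambda>x. ?D x h) \<in> pol X j" for h
    proof (cases "j = 0")
      case True
      then obtain c where "c \<in> X" and c: "p = (\<lambda>x. c)" using pol_0_const[OF X] mult.hyps by blast
      have "p' x = (\<lambda>h. 0)" for x
        by (rule has_derivative_unique[OF p'(1)]) (simp add: c)
      then show ?thesis using mult.hyps X by (simp add: pol_scale)
    next
      case False
      then show ?thesis using pol_mult[OF p'(2), of w d h] mult.hyps X
        by (auto intro: pol_add pol_scale)
    qed
    ultimately show ?case by (intro exI[of _ ?D]) simp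
  qed
  then show ?thesis using that by blast
qed

text \<open>Repeated use of \<open>pol_expand\<close> writes \<open>p\<close> as a polynomial in \<open>u \<bullet> x\<close> whose coefficients do not depend on
  \<open>u \<bullet> x\<close>, so it can be integrated termwise; the power \<open>m\<close> strengthens the induction.\<close>

lemma pol_antiderivative:
  fixes p :: "'a::euclidean_space \<Rightarrow> 'v::real_normed_vector"
  assumes p: "p \<in> pol X j" and X: "subspace X" and u: "u \<bullet> u = 1"
  obtains P where "P \<in> pol X (Suc j)" "\<And>x F. (P has_derivative F) (at x) \<Longrightarrow> F u = p x"
proof -
  let ?l = "\<lambda>x. u \<bullet> x"
  let ?\<pi> = "\<lambda>x. x - ?l x *\<^sub>R u"
  have lin: "linear ?\<pi>" by (rule linearI) (auto simp: algebra_simps inner_add_right)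
  have pw: "(\<lambda>x. r * ?l x ^ n) \<in> pol UNIV n" for n r
  proof (induction n)
    case (Suc n)
    then show ?case using pol_mult[OF Suc, of u 0] by (simp add: mult.left_commute)
  qed (auto intro: pol_const)
  have "\<exists>P\<in>pol X (j + Suc m). \<forall>x. \<exists>F. (P has_derivative F) (at x) \<and> F u = ?l x ^ m *\<^sub>R p x" for m
    using p
  proof (induction j arbitrary: p m rule: less_induct)
    case (less j p m)
    obtain q where q: "q \<in> pol X (j - 1)" "\<And>x. p x = ?l x *\<^sub>R q x + p (?\<pi> x)" "j = 0 \<Longrightarrow> q = (\<lambda>x. 0)"
      using pol_expand[OF less.prems X u, of 0] by (metis add_0_right)
    obtain Q where Q: "Q \<in> pol X (j + Suc m)"
      "\<And>x. \<exists>F. (Q has_derivative F) (at x) \<and> F u = ?l x ^ Suc m *\<^sub>R q x"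
    proof (cases "j = 0")
      case True
      show ?thesis
        by (rule that[of "\<lambda>x. 0"]) (use q(3)[OF True] in \<open>auto intro!: pol_const subspace_0[OF X] exI[of _ "\<lambda>h. 0"]\<close>)
    next
      case False
      then have "j - 1 + Suc (Suc m) = j + Suc m" by simp
      then show ?thesis using less.IH[of "j - 1" q "Suc m"] q(1) False that by auto
    qed
    \<comment> \<open>The value p(\<pi>(x)) does not change along u, so only the power of u
      \<bullet> x has to be integrated.\<close>
    let ?R = "\<lambda>x. (1 / Suc m * ?l x ^ Suc m) *\<^sub>R p (?\<pi> x)"
    have "?R \<in> pol X (Suc m + j)"
      by (rule pol_scaleR[OF pw _ X]) (use pol_compose_affine[OF less.prems lin, of 0] in simp)
    then have R: "?R \<in> pol X (j + Suc m)" by (simp add: add.commute)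
    obtain p' where p': "\<And>x. (p has_derivative p' x) (at x)" using pol_has_derivative[OF less.prems X] by metis
    have "\<exists>F. (?R has_derivative F) (at x) \<and> F u = ?l x ^ m *\<^sub>R p (?\<pi> x)" for x
    proof -
      have *: "((\<lambda>x. p (?\<pi> x)) has_derivative (\<lambda>h. p' (?\<pi> x) (?\<pi> h))) (at x)"
        by (rule has_derivative_compose[OF _ p']) (auto intro!: derivative_eq_intros)
      let ?F = "\<lambda>h. (1 / Suc m * ?l x ^ Suc m) *\<^sub>R p' (?\<pi> x) (?\<pi> h) + (?l h * ?l x ^ m) *\<^sub>R p (?\<pi> x)"
      have "((\<lambda>x. 1 / Suc m * ?l x ^ Suc m) has_derivative (\<lambda>h. ?l h * ?l x ^ m)) (at x)"
      proof -
        have "((\<lambda>x. ?l x ^ Suc m) has_derivative (\<lambda>h. of_nat (Suc m) * ?l h * ?l x ^ (Suc m - 1))) (at x)"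
          by (rule has_derivative_power) (auto intro!: derivative_eq_intros)
        from has_derivative_mult_right[OF this, of "1 / Suc m"]
        have "((\<lambda>x. 1 / Suc m * ?l x ^ Suc m) has_derivative
          (\<lambda>h. 1 / Suc m * (of_nat (Suc m) * ?l h * ?l x ^ (Suc m - 1)))) (at x)" .
        moreover have "1 / Suc m * (of_nat (Suc m) * ?l h * ?l x ^ (Suc m - 1)) = ?l h * ?l x ^ m" for h
          by (simp del: of_nat_Suc)
        ultimately show ?thesis by (simp only:)
      qed
      from has_derivative_scaleR[OF this *]
      have "(?R has_derivative ?F) (at x)" .
      moreover have "p' (?\<pi> x) (?\<pi> u) = 0"
        using u has_derivative_linear[OF p'] by (simp add: linear_0)
      ultimately show ?thesis using u by (intro exI[of _ ?F]) simp
    qed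
    then have "\<exists>F. ((\<lambda>x. Q x + ?R x) has_derivative F) (at x) \<and> F u = ?l x ^ m *\<^sub>R p x" for x
    proof -
      obtain F where "(Q has_derivative F) (at x)" "F u = ?l x ^ Suc m *\<^sub>R q x" using Q(2) by blast
      moreover obtain G where "(?R has_derivative G) (at x)" "G u = ?l x ^ m *\<^sub>R p (?\<pi> x)"
        using \<open>\<And>x. \<exists>F. (?R has_derivative F) (at x) \<and> F u = ?l x ^ m *\<^sub>R p (?\<pi> x)\<close> by blast
      moreover have "?l x ^ m *\<^sub>R p x = ?l x ^ Suc m *\<^sub>R q x + ?l x ^ m *\<^sub>R p (?\<pi> x)"
        by (subst q(2)) (simp add: scaleR_add_right mult.commute)
      ultimately show ?thesis
        by (intro exI[of _ "\<lambda>h. F h + G h"]) (simp add: has_derivative_add)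
    qed
    then show ?case using pol_add[OF Q(1) R] by blast
  qed
  from this[of 0] obtain P where P: "P \<in> pol X (Suc j)"
    "\<And>x. \<exists>F. (P has_derivative F) (at x) \<and> F u = p x" by auto
  show ?thesis
  proof (rule that[OF P(1)])
    fix x F assume "(P has_derivative F) (at x)"
    then show "F u = p x" using P(2)[of x] has_derivative_unique by metis
  qed
qed

section \<open>The two descriptions of polynomial fields\<close>

definition monom_fun :: "nat^3 \<Rightarrow> real^3 \<Rightarrow> real" where
  "monom_fun \<alpha> x = (\<Prod>i\<in>UNIV. x $ i ^ (\<alpha> $ i))"

lemma finite_multi_indices: "finite {\<alpha> :: nat^3. (\<Sum>i\<in>UNIV. \<alpha> $ i) \<le> j}"
proof (rule finite_subset)
  show "{\<alpha> :: nat^3. (\<Sum>i\<in>UNIV. \<alpha> $ i) \<le> j} \<subseteq> vec_lambda ` (UNIV \<rightarrow>\<^sub>E {..j})"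
  proof
    fix \<alpha> :: "nat^3" assume "\<alpha> \<in> {\<alpha>. (\<Sum>i\<in>UNIV. \<alpha> $ i) \<le> j}"
    moreover have "\<alpha> $ i \<le> (\<Sum>i\<in>UNIV. \<alpha> $ i)" for i by (rule member_le_sum) auto
    ultimately have "(\<lambda>i. \<alpha> $ i) \<in> UNIV \<rightarrow>\<^sub>E {..j}" by (auto intro: order_trans)
    then show "\<alpha> \<in> vec_lambda ` (UNIV \<rightarrow>\<^sub>E {..j})"
      by (intro image_eqI[of _ _ "\<lambda>i. \<alpha> $ i"]) (simp_all add: vec_nth_inverse)
  qed
  show "finite (vec_lambda ` ((UNIV :: 3 set) \<rightarrow>\<^sub>E {..j}))"
    by (intro finite_imageI finite_PiE) auto
qed

lemma pol_coordinate_power: "(\<lambda>x :: real^3. x $ i ^ n) \<in> pol UNIV n"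
proof (induction n)
  case (Suc n)
  then show ?case using pol_mult[OF Suc, of "axis i 1" 0] by (simp add: inner_axis')
qed (simp add: pol_const)

lemma monom_fun_pol: "monom_fun \<alpha> \<in> pol UNIV (\<Sum>i\<in>UNIV. \<alpha> $ i)"
proof -
  have "(\<lambda>x::real^3. \<Prod>i\<in>I. x $ i ^ (\<alpha> $ i)) \<in> pol UNIV (\<Sum>i\<in>I. \<alpha> $ i)" if "finite I" for I
    using that
  proof induction
    case (insert i I)
    then show ?case
      using pol_scaleR[OF pol_coordinate_power[of i "\<alpha> $ i"] insert.IH] by simp
  qed (simp add: pol_const)
  then show ?thesis by (simp add: monom_fun_def[abs_def])
qed

lemma poly_fun_alt: "poly_fun j p \<longleftrightarrow> (\<exists>c. p = (\<lambda>x. \<Sum>\<alpha> | (\<Sum>i\<in>UNIV. \<alpha> $ i) \<le> j. monom_fun \<alpha> x *\<^sub>R c \<alpha>))"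
  by (simp add: poly_fun_def monom_fun_def)

lemma poly_fun_add:
  assumes "poly_fun j p" "poly_fun j q"
  shows "poly_fun j (\<lambda>x. p x + q x)"
proof -
  obtain c d where "p = (\<lambda>x. \<Sum>\<alpha> | (\<Sum>i\<in>UNIV. \<alpha> $ i) \<le> j. monom_fun \<alpha> x *\<^sub>R c \<alpha>)"
    "q = (\<lambda>x. \<Sum>\<alpha> | (\<Sum>i\<in>UNIV. \<alpha> $ i) \<le> j. monom_fun \<alpha> x *\<^sub>R d \<alpha>)"
    using assms unfolding poly_fun_alt by blast
  then show ?thesis unfolding poly_fun_alt
    by (intro exI[of _ "\<lambda>\<alpha>. c \<alpha> + d \<alpha>"]) (simp add: scaleR_add_right sum.distrib)
qed

lemma poly_fun_monom:
  assumes "(\<Sum>i\<in>UNIV. \<alpha> $ i) \<le> j"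
  shows "poly_fun j (\<lambda>x. monom_fun \<alpha> x *\<^sub>R c)"
  unfolding poly_fun_alt
proof (intro exI ext)
  fix x
  have "(\<Sum>\<beta> | (\<Sum>i\<in>UNIV. \<beta> $ i) \<le> j. monom_fun \<beta> x *\<^sub>R (if \<beta> = \<alpha> then c else 0)) =
     (\<Sum>\<beta> | (\<Sum>i\<in>UNIV. \<beta> $ i) \<le> j. if \<beta> = \<alpha> then monom_fun \<alpha> x *\<^sub>R c else 0)"
    by (rule sum.cong) auto
  then show "monom_fun \<alpha> x *\<^sub>R c =
     (\<Sum>\<beta> | (\<Sum>i\<in>UNIV. \<beta> $ i) \<le> j. monom_fun \<beta> x *\<^sub>R (if \<beta> = \<alpha> then c else 0))"
    using assms by (simp add: finite_multi_indices)
qed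

lemma poly_fun_const: "poly_fun j (\<lambda>x. c)"
  using poly_fun_monom[of 0 j c] by (simp add: monom_fun_def)

lemma poly_fun_sum:
  "(\<And>i. i \<in> I \<Longrightarrow> poly_fun j (p i)) \<Longrightarrow> poly_fun j (\<lambda>x. \<Sum>i\<in>I. p i x)"
  by (induction I rule: infinite_finite_induct) (auto intro: poly_fun_add poly_fun_const)

lemma coordinate_times_monom: "x $ i * monom_fun \<alpha> x = monom_fun (\<alpha> + axis i 1) x"
proof -
  have "monom_fun (\<alpha> + axis i 1) x = (\<Prod>k\<in>UNIV. x $ k ^ (\<alpha> $ k) * (if k = i then x $ i else 1))"
    unfolding monom_fun_def by (intro prod.cong) (auto simp: power_add axis_def)
  then show ?thesis by (simp add: prod.distrib monom_fun_def mult.commute)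
qed

lemma poly_fun_mult:
  assumes "poly_fun j p"
  shows "poly_fun (Suc j) (\<lambda>x. (w \<bullet> x + d) *\<^sub>R p x)"
proof -
  obtain c where c: "p = (\<lambda>x. \<Sum>\<alpha> | (\<Sum>i\<in>UNIV. \<alpha> $ i) \<le> j. monom_fun \<alpha> x *\<^sub>R c \<alpha>)"
    using assms unfolding poly_fun_alt by blast
  have *: "(w \<bullet> x + d) *\<^sub>R p x = (\<Sum>\<alpha> | (\<Sum>i\<in>UNIV. \<alpha> $ i) \<le> j.
      (\<Sum>i\<in>UNIV. monom_fun (\<alpha> + axis i 1) x *\<^sub>R w $ i *\<^sub>R c \<alpha>) + monom_fun \<alpha> x *\<^sub>R d *\<^sub>R c \<alpha>)" for x
    unfolding c scaleR_sum_right
  proof (rule sum.cong[OF refl])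
    fix \<alpha> :: "nat^3"
    have *: "monom_fun (\<alpha> + axis i 1) x *\<^sub>R w $ i *\<^sub>R c \<alpha> = (w $ i * x $ i) *\<^sub>R monom_fun \<alpha> x *\<^sub>R c \<alpha>" for i
      by (simp add: coordinate_times_monom[symmetric] mult_ac del: One_nat_def)
    show "(w \<bullet> x + d) *\<^sub>R monom_fun \<alpha> x *\<^sub>R c \<alpha> =
      (\<Sum>i\<in>UNIV. monom_fun (\<alpha> + axis i 1) x *\<^sub>R w $ i *\<^sub>R c \<alpha>) + monom_fun \<alpha> x *\<^sub>R d *\<^sub>R c \<alpha>"
      unfolding * scaleR_left_commute[of "monom_fun \<alpha> x" d]
      by (simp only: inner_vec_def scaleR_add_left scaleR_sum_left inner_real_def)
  qed
  have s: "(\<Sum>k\<in>UNIV. (\<alpha> + axis i 1) $ k) = Suc (\<Sum>k\<in>UNIV. \<alpha> $ k)" for \<alpha> :: "nat^3" and i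
    by (simp add: sum.distrib axis_def)
  show ?thesis unfolding *
    by (intro poly_fun_sum poly_fun_add poly_fun_monom) (auto simp: s simp del: vector_add_component One_nat_def)
qed

lemma poly_fun_iff_pol: "poly_fun j p \<longleftrightarrow> p \<in> pol UNIV j"
proof
  assume "poly_fun j p"
  then obtain c where c: "p = (\<lambda>x. \<Sum>\<alpha> | (\<Sum>i\<in>UNIV. \<alpha> $ i) \<le> j. monom_fun \<alpha> x *\<^sub>R c \<alpha>)"
    unfolding poly_fun_alt by blast
  show "p \<in> pol UNIV j" unfolding c
  proof (rule pol_sum, goal_cases)
    case (2 \<alpha>)
    then show ?case
      using pol_mono[OF pol_scaleR[OF monom_fun_pol[of \<alpha>] pol_const[of "c \<alpha>" UNIV 0]]] by simp
  qed simp
next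
  assume "p \<in> pol UNIV j"
  then show "poly_fun j p"
    by (induction rule: pol_induct) (auto intro: poly_fun_const poly_fun_add poly_fun_mult)
qed

text \<open>\<open>polys\<close> requires values in X only at points of D, while
  \<open>pol X\<close> requires coefficients in X. Composition with a linear projection P onto X
  changes nothing on D and moves the coefficients into X.\<close>

lemma polys_eq_image:
  assumes P: "linear P" "range P \<subseteq> X" "\<And>x. x \<in> X \<Longrightarrow> P x = x" and X: "subspace X"
  shows "polys j D X = zero_ext D ` pol X j"
proof safe
  fix f assume "f \<in> polys j D X"
  then obtain p where p: "f = zero_ext D p" "p \<in> pol UNIV j" "\<forall>x\<in>D. p x \<in> X"
    by (auto simp: polys_def poly_fun_iff_pol)
  have "(\<lambda>x. P (p x)) \<in> pol X j" using pol_linear[OF p(2) P(1,2)] .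
  moreover have "f = zero_ext D (\<lambda>x. P (p x))" using p P(3) by (auto simp: zero_ext_def)
  ultimately show "f \<in> zero_ext D ` pol X j" by blast
next
  fix p :: "real^3 \<Rightarrow> 'a" assume "p \<in> pol X j"
  then show "zero_ext D p \<in> polys j D X"
    using pol_value[OF X] pol_subset[of p X j UNIV] by (auto simp: polys_def poly_fun_iff_pol)
qed

lemma polys_UNIV: "polys j D UNIV = zero_ext D ` pol UNIV j"
  by (rule polys_eq_image[of "\<lambda>x. x"]) (auto simp: module_hom_ident)

abbreviation Sym :: "(real^3^3) set" where "Sym \<equiv> symmetric_matrices"

lemma linear_transpose: "linear (transpose :: real^'n^'m \<Rightarrow> real^'m^'n)"
  by (rule linearI) (auto simp: transpose_def vec_eq_iff)

lemma transpose_add: "transpose (A + B) = transpose A + transpose (B :: real^'n^'m)"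
  by (simp add: linear_add[OF linear_transpose])

lemma transpose_scaleR: "transpose (c *\<^sub>R A) = c *\<^sub>R transpose (A :: real^'n^'m)"
  by (simp add: linear_scale[OF linear_transpose])

lemma subspace_Sym: "subspace Sym"
  unfolding symmetric_matrices_def
  by (rule subspaceI) (auto simp: transpose_add transpose_scaleR linear_0[OF linear_transpose])

lemma linear_symmetric_part: "linear (\<lambda>A :: real^'n^'n. (1/2) *\<^sub>R (A + transpose A))"
  by (rule linearI) (auto simp: transpose_add transpose_scaleR algebra_simps)

lemma symmetric_part_symmetric: "(1/2) *\<^sub>R (A + transpose A) \<in> Sym"
  by (simp add: symmetric_matrices_def transpose_add transpose_scaleR add.commute)

lemma polys_symmetric: "polys j D Sym = zero_ext D ` pol Sym j"
proof (rule polys_eq_image[OF linear_symmetric_part _ _ subspace_Sym])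
  show "range (\<lambda>A. (1/2) *\<^sub>R (A + transpose A)) \<subseteq> Sym"
    using symmetric_part_symmetric by blast
  show "(1/2) *\<^sub>R (A + transpose A) = A" if "A \<in> Sym" for A
    using that by (simp add: symmetric_matrices_def scaleR_2[symmetric])
qed

lemma linear_zero_ext: "linear (zero_ext D :: (real^3 \<Rightarrow> 'v::real_vector) \<Rightarrow> _)"
  by (rule linearI) (auto simp: zero_ext_def fun_eq_iff)

lemma zero_ext_in: "x \<in> D \<Longrightarrow> zero_ext D p x = p x"
  by (simp add: zero_ext_def)

lemma zero_ext_eqI: "(\<And>x. x \<in> D \<Longrightarrow> p x = q x) \<Longrightarrow> zero_ext D p = zero_ext D q"
  by (auto simp: zero_ext_def)

lemma zero_ext_eq_0_iff: "zero_ext D p = 0 \<longleftrightarrow> (\<forall>x\<in>D. p x = 0)"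
  by (auto simp: zero_ext_def fun_eq_iff)

lemma subspace_zero_ext_pol: "subspace X \<Longrightarrow> subspace (zero_ext D ` pol X j)"
  by (rule linear_subspace_image[OF linear_zero_ext pol_subspace])

section \<open>Barycentric coordinates\<close>

text \<open>The coordinate of \<open>x\<close> at the vertex \<open>c\<close> is an affine function on the whole space. It is
  determined on the affine hull of \<open>C\<close> only, and unspecified if \<open>C\<close> is affinely dependent.\<close>

definition lam_data :: "'a::euclidean_space set \<Rightarrow> 'a \<Rightarrow> 'a \<times> real" where
  "lam_data C c = (SOME gd. fst gd \<bullet> c + snd gd = 1 \<and> (\<forall>b\<in>C - {c}. fst gd \<bullet> b + snd gd = 0))"

definition lam_grad :: "'a::euclidean_space set \<Rightarrow> 'a \<Rightarrow> 'a" where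
  "lam_grad C c = fst (lam_data C c)"

definition lam :: "'a::euclidean_space set \<Rightarrow> 'a \<Rightarrow> 'a \<Rightarrow> real" where
  "lam C c x = lam_grad C c \<bullet> x + snd (lam_data C c)"

text \<open>The gradient is the component z of c - a orthogonal to the directions of the opposite
  face, scaled so that the value at c is 1. Affine independence keeps z from vanishing.\<close>

lemma lam_exists:
  fixes C :: "'a::euclidean_space set"
  assumes "\<not> affine_dependent C" "c \<in> C"
  shows "\<exists>g d. g \<bullet> c + d = 1 \<and> (\<forall>b\<in>C - {c}. g \<bullet> b + d = 0)"
proof (cases "C - {c} = {}")
  case True
  then show ?thesis by (intro exI[of _ 0] exI[of _ 1]) auto
next
  case False
  then obtain a where a: "a \<in> C - {c}" by blast
  let ?S = "(\<lambda>x. - a + x) ` (C - {c})"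
  obtain y z where yz: "y \<in> span ?S" "\<And>w. w \<in> span ?S \<Longrightarrow> orthogonal z w" "c - a = y + z"
    using orthogonal_subspace_decomp_exists[of ?S "c - a"] by metis
  have "z \<noteq> 0"
  proof
    assume "z = 0"
    then have "c \<in> (\<lambda>x. a + x) ` span ?S" using yz by (intro image_eqI[of _ _ y]) (auto simp: algebra_simps)
    then have "c \<in> affine hull (C - {c})" using affine_hull_span_gen[OF hull_inc[OF a]] by blast
    then show False using assms unfolding affine_dependent_def by blast
  qed
  define g where "g = (1 / (z \<bullet> z)) *\<^sub>R z"
  have "g \<bullet> (b - a) = 0" if "b \<in> C - {c}" for b
  proof -
    have "- a + b \<in> span ?S" using that by (intro span_base) auto
    then show ?thesis using yz(2) by (simp add: g_def orthogonal_def)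
  qed
  moreover have "g \<bullet> (c - a) = 1"
    unfolding yz(3) g_def using yz(2)[OF yz(1)] \<open>z \<noteq> 0\<close> by (simp add: orthogonal_def inner_add_right)
  ultimately show ?thesis
    by (intro exI[of _ g] exI[of _ "- (g \<bullet> a)"]) (auto simp: inner_diff_right)
qed

lemma lam_vertex:
  assumes "\<not> affine_dependent C" "c \<in> C" "b \<in> C"
  shows "lam C c b = (if b = c then 1 else 0)"
proof -
  have "\<exists>gd. fst gd \<bullet> c + snd gd = 1 \<and> (\<forall>b\<in>C - {c}. fst gd \<bullet> b + snd gd = 0)"
    using lam_exists[OF assms(1,2)] by auto
  from someI_ex[OF this] show ?thesis using assms(3)
    by (auto simp: lam_def lam_grad_def lam_data_def)
qed

lemma lam_diff: "lam C c x - lam C c y = lam_grad C c \<bullet> (x - y)"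
  by (simp add: lam_def inner_diff_right)

lemma lam_sum:
  "lam C c (\<Sum>b\<in>B. u b *\<^sub>R b) = (\<Sum>b\<in>B. u b * lam C c b) + (1 - sum u B) * snd (lam_data C c)"
  by (simp add: lam_def inner_sum_right distrib_left sum.distrib algebra_simps sum_distrib_right)

lemma lam_affine_combination:
  assumes C: "\<not> affine_dependent C" "c \<in> C" and u: "sum u C = 1"
  shows "lam C c (\<Sum>b\<in>C. u b *\<^sub>R b) = u c"
proof -
  have "finite C" using C(1) by (rule aff_independent_finite)
  have "lam C c (\<Sum>b\<in>C. u b *\<^sub>R b) = (\<Sum>b\<in>C. u b * lam C c b)"
    using lam_sum[of C c u C] u by simp
  also have "\<dots> = (\<Sum>b\<in>C. if b = c then u b else 0)"
    by (rule sum.cong) (auto simp: lam_vertex[OF C])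
  finally show ?thesis using C(2) \<open>finite C\<close> by simp
qed

lemma lam_affine_hull:
  assumes C: "\<not> affine_dependent C" and x: "x \<in> affine hull C"
  shows "(\<Sum>c\<in>C. lam C c x) = 1" "(\<Sum>c\<in>C. lam C c x *\<^sub>R c) = x"
proof -
  have fin: "finite C" using C by (rule aff_independent_finite)
  obtain u where u: "sum u C = 1" "x = (\<Sum>b\<in>C. u b *\<^sub>R b)"
    using x unfolding affine_hull_finite[OF fin] by auto
  then have "lam C c x = u c" if "c \<in> C" for c using lam_affine_combination[OF C that] by simp
  then show "(\<Sum>c\<in>C. lam C c x) = 1" "(\<Sum>c\<in>C. lam C c x *\<^sub>R c) = x" using u by simp_all
qed

lemma lam_affine_hull_face:
  assumes C: "\<not> affine_dependent C" "c \<in> C" and x: "x \<in> affine hull C"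
  shows "lam C c x = 0 \<longleftrightarrow> x \<in> affine hull (C - {c})"
proof
  have fin: "finite C" using C by (simp add: aff_independent_finite)
  assume 0: "lam C c x = 0"
  have "(\<Sum>b\<in>C - {c}. lam C b x) = 1" "(\<Sum>b\<in>C - {c}. lam C b x *\<^sub>R b) = x"
    using lam_affine_hull[OF C(1) x] 0 by (simp_all add: sum.remove[OF fin C(2)])
  then show "x \<in> affine hull (C - {c})" unfolding affine_hull_finite[OF finite_Diff[OF fin]] by blast
next
  have fin: "finite C" using C by (simp add: aff_independent_finite)
  assume "x \<in> affine hull (C - {c})"
  then obtain u where u: "sum u (C - {c}) = 1" "x = (\<Sum>b\<in>C - {c}. u b *\<^sub>R b)"
    unfolding affine_hull_finite[OF finite_Diff[OF fin]] by auto
  let ?u = "\<lambda>b. if b = c then 0 else u b"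
  have "sum ?u C = 1" "x = (\<Sum>b\<in>C. ?u b *\<^sub>R b)" using u
    by (simp_all add: sum.remove[OF fin C(2)])
  then show "lam C c x = 0" using lam_affine_combination[OF C, of ?u] by simp
qed

lemma convex_hull_lam:
  assumes C: "\<not> affine_dependent C"
  shows "x \<in> convex hull C \<longleftrightarrow> x \<in> affine hull C \<and> (\<forall>c\<in>C. 0 \<le> lam C c x)"
proof
  have fin: "finite C" using C by (rule aff_independent_finite)
  assume x: "x \<in> convex hull C"
  then obtain u where u: "\<forall>b\<in>C. 0 \<le> u b" "sum u C = 1" "x = (\<Sum>b\<in>C. u b *\<^sub>R b)"
    unfolding convex_hull_finite[OF fin] by auto
  then show "x \<in> affine hull C \<and> (\<forall>c\<in>C. 0 \<le> lam C c x)"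
    using x convex_hull_subset_affine_hull[of C] lam_affine_combination[OF C] by auto
next
  have fin: "finite C" using C by (rule aff_independent_finite)
  assume "x \<in> affine hull C \<and> (\<forall>c\<in>C. 0 \<le> lam C c x)"
  then show "x \<in> convex hull C" unfolding convex_hull_finite[OF fin]
    using lam_affine_hull[OF C, of x] by (intro CollectI exI[of _ "\<lambda>c. lam C c x"]) simp
qed

lemma lam_pol: "p \<in> pol X j \<Longrightarrow> (\<lambda>x. lam C c x *\<^sub>R p x) \<in> pol X (Suc j)"
  unfolding lam_def by (rule pol_mult)

lemma lam_pol_1: "lam C c \<in> pol UNIV (Suc 0)"
  using pol_affine[of "lam_grad C c" "snd (lam_data C c)"] by (simp add: lam_def[abs_def])

text \<open>Division by the coordinate of c, projecting along c - a for another vertex a. Points of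
  the affine hull of C are projected into the affine hull of the opposite face, where p vanishes
  because it does on the face itself.\<close>

lemma face_factor:
  fixes p :: "'a::euclidean_space \<Rightarrow> 'v::euclidean_space"
  assumes C: "\<not> affine_dependent C" "c \<in> C" "C \<noteq> {c}" and X: "subspace X"
    and p: "p \<in> pol X (Suc j)" and 0: "\<And>x. x \<in> convex hull (C - {c}) \<Longrightarrow> p x = 0"
  obtains q where "q \<in> pol X j" "\<And>x. x \<in> affine hull C \<Longrightarrow> p x = lam C c x *\<^sub>R q x"
proof -
  obtain a where a: "a \<in> C" "a \<noteq> c" using C by blast
  define u where "u = c - a"
  have u: "lam_grad C c \<bullet> u = 1"
    unfolding u_def lam_diff[symmetric] using a C by (simp add: lam_vertex)
  obtain q where q: "q \<in> pol X j" "\<And>x. p x = lam C c x *\<^sub>R q x + p (x - lam C c x *\<^sub>R u)"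
    unfolding lam_def using pol_expand[OF p X u, of "snd (lam_data C c)"] by (metis diff_Suc_1)
  have "p (x - lam C c x *\<^sub>R u) = 0" if x: "x \<in> affine hull C" for x
  proof -
    have "x - lam C c x *\<^sub>R u = x + lam C c x *\<^sub>R (a - c)" by (simp add: u_def algebra_simps)
    also have "\<dots> \<in> affine hull C"
      by (rule mem_affine_3_minus) (use x a C in \<open>auto intro: hull_inc\<close>)
    finally have "x - lam C c x *\<^sub>R u \<in> affine hull C" .
    moreover have "lam C c (x - lam C c x *\<^sub>R u) = 0"
      using u by (simp add: lam_def inner_diff_right)
    ultimately have "x - lam C c x *\<^sub>R u \<in> affine hull (convex hull (C - {c}))"
      using lam_affine_hull_face[OF C(1,2)] by simp
    then show ?thesis using pol_vanish_affine_hull[OF p convex_convex_hull 0] by simp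
  qed
  then show ?thesis using q by (intro that[of q]) (metis add.right_neutral)+
qed

text \<open>The coordinate of c is 1 at c, which belongs to the face spanned by B, so the factor is
  not identically zero there.\<close>

lemma lam_cancel:
  fixes p :: "'a::euclidean_space \<Rightarrow> 'v::euclidean_space"
  assumes C: "\<not> affine_dependent C" "c \<in> B" "B \<subseteq> C" and p: "p \<in> pol X j"
    and 0: "\<And>x. x \<in> convex hull B \<Longrightarrow> lam C c x *\<^sub>R p x = 0" and y: "y \<in> convex hull B"
  shows "p y = 0"
proof (rule pol_vanish_cancel[OF p convex_convex_hull _ _ _ y])
  show "(lam_grad C c \<bullet> x + snd (lam_data C c)) *\<^sub>R p x = 0" if "x \<in> convex hull B" for x
    using 0[OF that] by (simp add: lam_def)
  show "c \<in> convex hull B" using C by (simp add: hull_inc)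
  show "lam_grad C c \<bullet> c + snd (lam_data C c) \<noteq> 0"
    using lam_vertex[of C c c] C unfolding lam_def by auto
qed

text \<open>Coordinates are divided out one at a time. The quotient by the coordinate of c still
  vanishes on the face opposite to another b, since that face contains c. Pairs A serve the matrix
  coefficients, A = C serves the moments on edges and faces.\<close>

lemma bubble_factor:
  fixes p :: "'a::euclidean_space \<Rightarrow> 'v::euclidean_space"
  assumes C: "\<not> affine_dependent C" "2 \<le> card C" and A: "A \<subseteq> C" and X: "subspace X"
    and p: "p \<in> pol X (j + card A)" and 0: "\<And>c x. c \<in> A \<Longrightarrow> x \<in> convex hull (C - {c}) \<Longrightarrow> p x = 0"
  shows "\<exists>q\<in>pol X j. \<forall>x\<in>affine hull C. p x = (\<Prod>c\<in>A. lam C c x) *\<^sub>R q x"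
proof -
  have "finite A" using A C(1) aff_independent_finite finite_subset by blast
  then show ?thesis using A p 0
  proof (induction A arbitrary: p rule: finite_induct)
    case empty
    then show ?case by (intro bexI[of _ p]) auto
  next
    case (insert c A)
    have "C \<noteq> {c}" using C(2) by auto
    moreover have "c \<in> C" "A \<subseteq> C" using insert by auto
    moreover have "p \<in> pol X (Suc (j + card A))" using insert by simp
    ultimately obtain q where q: "q \<in> pol X (j + card A)" "\<And>x. x \<in> affine hull C \<Longrightarrow> p x = lam C c x *\<^sub>R q x"
      using face_factor[OF C(1) _ _ X, of c p "j + card A"] insert.prems(3) by blast
    have "q x = 0" if b: "b \<in> A" "x \<in> convex hull (C - {b})" for b x
    proof (rule lam_cancel[OF C(1) _ _ q(1) _ b(2)])
      show "c \<in> C - {b}" using insert b by auto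
      fix y assume y: "y \<in> convex hull (C - {b})"
      then have "p y = 0" using insert.prems(3) b by blast
      moreover have "convex hull (C - {b}) \<subseteq> affine hull C"
        by (meson Diff_subset convex_hull_subset_affine_hull hull_mono order_trans)
      ultimately show "lam C c y *\<^sub>R q y = 0" using q(2) y by auto
    qed auto
    then obtain r where r: "r \<in> pol X j" "\<And>x. x \<in> affine hull C \<Longrightarrow> q x = (\<Prod>c\<in>A. lam C c x) *\<^sub>R r x"
      using insert.IH[OF \<open>A \<subseteq> C\<close> q(1)] by blast
    show ?case by (rule bexI[OF _ r(1)]) (use q(2) r(2) insert in auto)
  qed
qed

section \<open>Dimensions of polynomial spaces on simplices\<close>

lemma finite_dim_pol: "finite_dim (pol X j :: (real^3 \<Rightarrow> 'v::euclidean_space) set)"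
proof -
  let ?F = "(\<lambda>(\<alpha>, b). (\<lambda>x. monom_fun \<alpha> x *\<^sub>R b)) ` ({\<alpha>. (\<Sum>i\<in>UNIV. \<alpha> $ i) \<le> j} \<times> Basis) :: (real^3 \<Rightarrow> 'v) set"
  have "p \<in> span ?F" if p: "p \<in> pol X j" for p
  proof -
    have "poly_fun j p" using pol_subset[OF p, of UNIV] by (simp add: poly_fun_iff_pol)
    then obtain c where c: "p = (\<lambda>x. \<Sum>\<alpha> | (\<Sum>i\<in>UNIV. \<alpha> $ i) \<le> j. monom_fun \<alpha> x *\<^sub>R c \<alpha>)"
      unfolding poly_fun_alt by blast
    have "p = (\<Sum>\<alpha> | (\<Sum>i\<in>UNIV. \<alpha> $ i) \<le> j. \<Sum>b\<in>Basis. (c \<alpha> \<bullet> b) *\<^sub>R (\<lambda>x. monom_fun \<alpha> x *\<^sub>R b))"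
    proof
      fix x
      have "monom_fun \<alpha> x *\<^sub>R c \<alpha> = (\<Sum>b\<in>Basis. (c \<alpha> \<bullet> b) *\<^sub>R monom_fun \<alpha> x *\<^sub>R b)" for \<alpha>
        by (subst euclidean_representation[of "c \<alpha>", symmetric])
          (simp add: scaleR_sum_right mult.commute del: euclidean_representation)
      then show "p x = (\<Sum>\<alpha> | (\<Sum>i\<in>UNIV. \<alpha> $ i) \<le> j. \<Sum>b\<in>Basis. (c \<alpha> \<bullet> b) *\<^sub>R (\<lambda>x. monom_fun \<alpha> x *\<^sub>R b)) x"
        by (simp add: c sum_fun_apply)
    qed
    also have "\<dots> \<in> span ?F" by (intro span_sum span_scale span_base) auto
    finally show ?thesis .
  qed
  moreover have "finite ?F" by (simp add: finite_multi_indices)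
  ultimately show ?thesis unfolding finite_dim_def by blast
qed

lemma finite_dim_zero_ext_pol:
  "subspace X \<Longrightarrow> finite_dim (zero_ext D ` pol X j :: (real^3 \<Rightarrow> 'v::euclidean_space) set)"
  by (rule finite_dim_lin_image[OF pol_subspace finite_dim_pol linear_lin_on[OF linear_zero_ext]])

lemma lin_on_eval: "lin_on V (\<lambda>f. f c)"
  by (simp add: lin_on_def)

text \<open>Both base cases of the recursion for the dimension: constants, and polynomials of any
  degree on a single point. Evaluation at c is an isomorphism onto X.\<close>

lemma dim_zero_ext_pol_const:
  fixes X :: "'v::euclidean_space set"
  assumes X: "subspace X" and c: "c \<in> D" and "j = 0 \<or> D = {c}"
  shows "dim (zero_ext D ` pol X j) = dim X"
proof -
  let ?V = "zero_ext D ` pol X j"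
  have "(\<lambda>f. f c) ` ?V = X"
  proof safe
    fix p :: "real^3 \<Rightarrow> 'v" assume "p \<in> pol X j"
    then show "zero_ext D p c \<in> X" using c pol_value[OF X] by (simp add: zero_ext_in)
  next
    fix x assume "x \<in> X"
    then show "x \<in> (\<lambda>f. f c) ` ?V"
      using c by (intro rev_image_eqI[OF imageI[OF pol_const]]) (simp_all add: zero_ext_in)
  qed
  moreover have "dim ((\<lambda>f. f c) ` ?V) = dim ?V"
  proof (rule dim_lin_image_eq[OF subspace_zero_ext_pol[OF X] finite_dim_zero_ext_pol[OF X] lin_on_eval])
    fix f assume "f \<in> ?V" "f c = 0"
    then obtain p where p: "p \<in> pol X j" "f = zero_ext D p" "p c = 0" using c by (auto simp: zero_ext_in)
    have "p x = 0" if "x \<in> D" for x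
      using assms(3) that p(3) pol_0_const[OF X, of p] p(1) by (metis singletonD)
    then show "f = 0" using p(2) by (simp add: zero_ext_eq_0_iff)
  qed
  ultimately show ?thesis by simp
qed

text \<open>Restriction to the facet opposite to \<open>c\<close> is onto, and its kernel consists of the multiples of the
  barycentric coordinate of \<open>c\<close>. This is Pascal's recursion.\<close>

lemma dim_zero_ext_pol_Suc:
  fixes X :: "'v::euclidean_space set" and C :: "(real^3) set"
  assumes C: "\<not> affine_dependent C" "c \<in> C" "C \<noteq> {c}" and X: "subspace X"
  shows "dim (zero_ext (convex hull C) ` pol X (Suc j)) =
    dim (zero_ext (convex hull C) ` pol X j) + dim (zero_ext (convex hull (C - {c})) ` pol X (Suc j))"
proof -
  let ?K = "convex hull C" and ?F = "convex hull (C - {c})"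
  let ?V = "zero_ext ?K ` pol X (Suc j)" and ?U = "zero_ext ?K ` pol X j"
  let ?R = "zero_ext ?F :: (real^3 \<Rightarrow> 'v) \<Rightarrow> _"
  let ?M = "\<lambda>g x. lam C c x *\<^sub>R g x :: 'v"
  have sub: "?F \<subseteq> ?K" by (rule hull_mono) auto
  have "dim ?V = dim {f \<in> ?V. ?R f = 0} + dim (?R ` ?V)"
    by (rule rank_nullity[OF subspace_zero_ext_pol[OF X] finite_dim_zero_ext_pol[OF X] linear_lin_on[OF linear_zero_ext]])
  also have "?R ` ?V = zero_ext ?F ` pol X (Suc j)"
    unfolding image_image by (rule image_cong[OF refl], rule zero_ext_eqI) (use sub in \<open>auto simp: zero_ext_in\<close>)
  also have "{f \<in> ?V. ?R f = 0} = ?M ` ?U"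
  proof (rule set_eqI, rule iffI)
    fix f assume "f \<in> {f \<in> ?V. ?R f = 0}"
    then obtain p where p: "p \<in> pol X (Suc j)" "f = zero_ext ?K p" "?R f = 0" by blast
    have "p x = 0" if "x \<in> ?F" for x
    proof -
      have "f x = 0" using p(3) that by (simp add: zero_ext_eq_0_iff)
      then show ?thesis using p(2) that sub by (simp add: zero_ext_in subset_iff)
    qed
    then obtain q where q: "q \<in> pol X j" "\<And>x. x \<in> affine hull C \<Longrightarrow> p x = lam C c x *\<^sub>R q x"
      using face_factor[OF C X p(1)] by blast
    then have "f = ?M (zero_ext ?K q)"
      using p(2) convex_hull_subset_affine_hull[of C] by (auto simp: zero_ext_def fun_eq_iff)
    then show "f \<in> ?M ` ?U" using q(1) by blast
  next
    fix f assume "f \<in> ?M ` ?U"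
    then obtain q where q: "q \<in> pol X j" "f = ?M (zero_ext ?K q)" by blast
    then have f: "f = zero_ext ?K (?M q)" by (auto simp: zero_ext_def)
    have "lam C c x = 0" if "x \<in> ?F" for x
    proof -
      have "x \<in> affine hull (C - {c})" using that convex_hull_subset_affine_hull by blast
      moreover have "affine hull (C - {c}) \<subseteq> affine hull C" by (rule hull_mono) auto
      ultimately show ?thesis using lam_affine_hull_face[OF C(1,2)] by blast
    qed
    then have "?R f = 0" using f by (auto simp: zero_ext_eq_0_iff zero_ext_def)
    then show "f \<in> {f \<in> ?V. ?R f = 0}" using f lam_pol[OF q(1)] by blast
  qed
  also have "dim (?M ` ?U) = dim ?U"
  proof (rule dim_lin_image_eq[OF subspace_zero_ext_pol[OF X] finite_dim_zero_ext_pol[OF X]])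
    show "lin_on ?U ?M" by (auto simp: lin_on_def fun_eq_iff scaleR_add_right)
    fix f assume "f \<in> ?U" "?M f = 0"
    then obtain q where q: "q \<in> pol X j" "f = zero_ext ?K q" "\<And>x. lam C c x *\<^sub>R f x = 0"
      by (auto simp: fun_eq_iff)
    then have "lam C c x *\<^sub>R q x = 0" if "x \<in> ?K" for x
      using q(3)[of x] that by (simp add: zero_ext_in)
    then show "f = 0" using lam_cancel[OF C(1,2) order_refl q(1)] q(2) by (simp add: zero_ext_eq_0_iff)
  qed
  finally show ?thesis .
qed

text \<open>The outer induction on d leaves the degree free, as the facet term of the recursion has
  the raised degree \<open>Suc j\<close>.\<close>

theorem dim_zero_ext_pol:
  fixes X :: "'v::euclidean_space set" and C :: "(real^3) set"
  assumes "\<not> affine_dependent C" "card C = Suc d" and X: "subspace X"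
  shows "dim (zero_ext (convex hull C) ` pol X j) = dim X * ((j + d) choose d)"
  using assms(1,2)
proof (induction d arbitrary: C j)
  case 0
  then obtain c where "C = {c}" by (metis One_nat_def card_1_singletonE)
  then show ?case using dim_zero_ext_pol_const[OF X, of c "{c}" j] by simp
next
  case (Suc d)
  then obtain c where c: "c \<in> C" by fastforce
  have "C \<noteq> {c}" using Suc by auto
  have "card (C - {c}) = Suc d" using c Suc by simp
  note IH = Suc.IH[OF affine_independent_Diff[OF Suc.prems(1)] this]
  show ?case
  proof (induction j)
    case 0
    have "c \<in> convex hull C" using c by (rule hull_inc)
    then show ?case using dim_zero_ext_pol_const[OF X] by simp
  next
    case (Suc j)
    have "((Suc j + Suc d) choose Suc d) = ((j + Suc d) choose Suc d) + ((Suc j + d) choose d)" by simp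
    then show ?case
      using dim_zero_ext_pol_Suc[OF \<open>\<not> affine_dependent C\<close> c \<open>C \<noteq> {c}\<close> X, of j] Suc IH[of "Suc j"]
      by (simp only: distrib_left)
  qed
qed

section \<open>Derivatives within a convex body\<close>

text \<open>The difference L of the two derivatives vanishes on y - x for every y in K, by
  differentiating along the segment from x to y. As K contains a ball, these directions span the
  space. This covers boundary points, where K is no neighbourhood of x.\<close>

lemma has_derivative_unique_convex:
  fixes f :: "'a::euclidean_space \<Rightarrow> 'v::real_normed_vector"
  assumes K: "convex K" "interior K \<noteq> {}" "x \<in> K"
    and F: "(f has_derivative F) (at x within K)" and G: "(f has_derivative G) (at x within K)"
  shows "F = G"
proof -
  define L where "L = (\<lambda>h. F h - G h)"
  have L: "((\<lambda>_. 0) has_derivative L) (at x within K)"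
    using has_derivative_diff[OF F G] by (simp add: L_def)
  have linL: "linear L" using L by (rule has_derivative_linear)
  have L0: "L (y - x) = 0" if y: "y \<in> K" for y
  proof -
    let ?s = "\<lambda>t::real. x + t *\<^sub>R (y - x)"
    have s: "?s t \<in> K" if "t \<in> {0..1}" for t
    proof -
      have "(1 - t) *\<^sub>R x + t *\<^sub>R y \<in> K" using K y that by (intro convexD) auto
      then show ?thesis by (simp add: algebra_simps)
    qed
    have "(?s has_derivative (\<lambda>t. t *\<^sub>R (y - x))) (at 0 within {0..1})"
      by (auto intro!: derivative_eq_intros)
    moreover have "((\<lambda>_. 0 :: 'v) has_derivative L) (at (?s 0) within ?s ` {0..1})"
      using has_derivative_subset[OF L, of "?s ` {0..1}"] image_subsetI[of "{0..1}" ?s K] s by simp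
    ultimately have "((\<lambda>_. 0) \<circ> ?s has_derivative L \<circ> (\<lambda>t. t *\<^sub>R (y - x))) (at 0 within {0..1})"
      by (rule diff_chain_within)
    then have "((\<lambda>_. 0) has_vector_derivative L (y - x)) (at (0::real) within {0..1})"
      by (simp add: has_vector_derivative_def o_def linear_scale[OF linL])
    moreover have "((\<lambda>_. 0 :: 'v) has_vector_derivative 0) (at (0::real) within {0..1})"
      by simp
    ultimately show "L (y - x) = 0"
      by (intro vector_derivative_unique_within[of "0::real" "{0..1}"]) (auto simp: at_within_Icc_at_right)
  qed
  obtain z e where z: "e > 0" "cball z e \<subseteq> K"
    using K(2) unfolding ex_in_conv[symmetric] mem_interior_cball by blast
  have "L h = 0" for h
  proof (cases "h = 0")
    case False
    have "z \<in> K" using z by auto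
    have "z + (e / norm h) *\<^sub>R h \<in> K" using z False by (intro subsetD[OF z(2)]) (simp add: dist_norm)
    then have "L (z + (e / norm h) *\<^sub>R h - x) = 0" by (rule L0)
    moreover have "z + (e / norm h) *\<^sub>R h - x = (z - x) + (e / norm h) *\<^sub>R h" by simp
    ultimately have "L (z - x) + (e / norm h) *\<^sub>R L h = 0"
      by (simp only: linear_add[OF linL] linear_scale[OF linL])
    then show ?thesis using L0[OF \<open>z \<in> K\<close>] z False by simp
  qed (simp add: linear_0[OF linL])
  then show ?thesis by (auto simp: L_def fun_eq_iff)
qed

text \<open>\<open>frechet_derivative\<close> is a choice among derivatives; uniqueness within K
  identifies it with the derivative of the polynomial that the field agrees with on K.\<close>

lemma frechet_derivative_within_convex:
  fixes f :: "'a::euclidean_space \<Rightarrow> 'v::real_normed_vector"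
  assumes "convex K" "interior K \<noteq> {}" "x \<in> K"
    and p: "(p has_derivative p') (at x)" and eq: "\<And>y. y \<in> K \<Longrightarrow> f y = p y"
  shows "frechet_derivative f (at x within K) = p'"
proof -
  have "(f has_derivative p') (at x within K)"
    using has_derivative_transform[OF assms(3) eq has_derivative_at_withinI[OF p]] by simp
  then have "(f has_derivative frechet_derivative f (at x within K)) (at x within K)"
    using frechet_derivative_works differentiable_def by blast
  then show ?thesis
    using has_derivative_unique_convex[OF assms(1-3)] \<open>(f has_derivative p') (at x within K)\<close> by blast
qed

lemma div_on_zero_ext:
  assumes K: "convex K" "interior K \<noteq> {}" "x \<in> K" and p: "(p has_derivative p') (at x)"
  shows "div_on K (zero_ext K p) x = (\<chi> i. \<Sum>j\<in>UNIV. p' (axis j 1) $ i $ j)"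
proof -
  have "frechet_derivative (\<lambda>y. zero_ext K p y $ i) (at x within K) = (\<lambda>h. p' h $ i)" for i
    by (rule frechet_derivative_within_convex[OF K, of "\<lambda>y. p y $ i"])
      (auto simp: zero_ext_in intro!: bounded_linear.has_derivative[OF bounded_linear_vec_nth p])
  then show ?thesis using K(3)
    by (simp add: div_on_def zero_ext_in trace_def matrix_def)
qed

lemma sym_grad_on_zero_ext:
  assumes K: "convex K" "interior K \<noteq> {}" and p: "\<And>x. (p has_derivative p' x) (at x)"
  shows "sym_grad_on K (zero_ext K p) =
    zero_ext K (\<lambda>x. (1/2) *\<^sub>R (matrix (p' x) + transpose (matrix (p' x))))"
proof
  fix x
  have "frechet_derivative (zero_ext K p) (at x within K) = p' x" if "x \<in> K"
    by (rule frechet_derivative_within_convex[OF K that p]) (simp add: zero_ext_in)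
  then show "sym_grad_on K (zero_ext K p) x =
    zero_ext K (\<lambda>x. (1/2) *\<^sub>R (matrix (p' x) + transpose (matrix (p' x)))) x"
    by (auto simp: sym_grad_on_def grad_on_def zero_ext_def linear_0[OF linear_transpose])
qed

section \<open>Rank-one decomposition of symmetric matrices on a tetrahedron\<close>

definition outer_square :: "real^3 \<Rightarrow> real^3^3" where
  "outer_square s = (\<chi> i j. s $ i * s $ j)"

lemma outer_square_vec: "outer_square s *v x = (s \<bullet> x) *\<^sub>R s"
  by (simp add: outer_square_def matrix_vector_mult_def vec_eq_iff inner_vec_def
      sum_distrib_left sum_distrib_right mult_ac)

lemma outer_square_symmetric: "outer_square s \<in> Sym"
  by (simp add: outer_square_def symmetric_matrices_def transpose_def vec_eq_iff mult.commute)

lemma outer_square_inner: "outer_square s \<bullet> A = s \<bullet> (A *v s)"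
  by (simp add: outer_square_def matrix_vector_mult_def inner_vec_def sum_distrib_left mult_ac)

lemma outer_square_minus: "outer_square (- s) = outer_square s"
  by (simp add: outer_square_def)

lemma symmetric_matrix_inner:
  assumes "A \<in> Sym"
  shows "x \<bullet> (A *v y) = y \<bullet> (A *v x)"
proof -
  have "A *v x = transpose A *v x" using assms by (simp only: symmetric_matrices_def mem_Collect_eq)
  then have "A *v x = x v* A" by (simp only: transpose_matrix_vector)
  then show ?thesis by (simp add: dot_lmul_matrix inner_commute[of y])
qed

lemma matrix_eqI_inner:
  fixes A B :: "real^3^3"
  assumes "\<And>x y. x \<bullet> (A *v y) = x \<bullet> (B *v y)"
  shows "A = B"
proof -
  have "A *v y = B *v y" for y using assms by (metis vector_eq_ldot)
  then show ?thesis by (simp add: matrix_eq)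
qed

locale tetrahedron =
  fixes C :: "(real^3) set"
  assumes indep: "\<not> affine_dependent C" and card_vertices: "card C = 4"
begin

definition K :: "(real^3) set" where "K = convex hull C"

abbreviation \<phi> :: "real^3 \<Rightarrow> real^3 \<Rightarrow> real" where "\<phi> \<equiv> lam C"

abbreviation g :: "real^3 \<Rightarrow> real^3" where "g \<equiv> lam_grad C"

lemma finite_vertices: "finite C"
  using card_vertices by (metis card.infinite zero_neq_numeral)

lemma affine_hull_vertices: "affine hull C = UNIV"
  using aff_dim_affine_independent[OF indep] card_vertices by (simp flip: aff_dim_eq_full)

lemma sum_lam: "(\<Sum>c\<in>C. \<phi> c x) = 1" "(\<Sum>c\<in>C. \<phi> c x *\<^sub>R c) = x"
  using lam_affine_hull[OF indep] affine_hull_vertices by auto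

lemma mem_K: "x \<in> K \<longleftrightarrow> (\<forall>c\<in>C. 0 \<le> \<phi> c x)"
  unfolding K_def convex_hull_lam[OF indep] affine_hull_vertices by simp

lemma convex_K: "convex K" by (simp add: K_def)

lemma compact_K: "compact K"
  unfolding K_def by (rule finite_imp_compact_convex_hull[OF finite_vertices])

lemma interior_K: "interior K \<noteq> {}"
proof -
  have "aff_dim K = 3"
    using aff_dim_affine_independent[OF indep] card_vertices by (simp add: K_def aff_dim_convex_hull)
  moreover have "convex hull C \<noteq> {}" using card_vertices by auto
  ultimately show ?thesis
    using interior_rel_interior_gen[of K] rel_interior_eq_empty[OF convex_K] by (simp add: K_def)
qed

lemma K_nonempty: "K \<noteq> {}" using interior_K by auto

lemma vertex_in_K: "c \<in> C \<Longrightarrow> c \<in> K"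
  by (simp add: K_def hull_inc)

lemma grad_diff: "a \<in> C \<Longrightarrow> b \<in> C \<Longrightarrow> c \<in> C \<Longrightarrow> g c \<bullet> (a - b) = (if a = c then 1 else 0) - (if b = c then 1 else 0)"
  unfolding lam_diff[symmetric] by (simp add: lam_vertex[OF indep])

lemma grad_inner: "g c \<bullet> h = \<phi> c h - \<phi> c 0"
  by (simp add: lam_diff)

lemma sum_grad_inner: "(\<Sum>c\<in>C. g c \<bullet> h) = 0"
  unfolding grad_inner sum_subtractf sum_lam by simp

lemma sum_grad: "(\<Sum>c\<in>C. g c) = 0"
  by (rule vector_eq_rdot[THEN iffD1]) (simp add: inner_sum_left sum_grad_inner)

lemma sum_grad_vertex: "(\<Sum>c\<in>C. (g c \<bullet> h) *\<^sub>R c) = h"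
  unfolding grad_inner scaleR_diff_left sum_subtractf sum_lam by simp

lemma sum_vertex_grad: "(\<Sum>c\<in>C. (x \<bullet> c) *\<^sub>R g c) = x"
proof (rule vector_eq_rdot[THEN iffD1], rule allI)
  fix h
  have "(\<Sum>c\<in>C. (x \<bullet> c) *\<^sub>R g c) \<bullet> h = x \<bullet> (\<Sum>c\<in>C. (g c \<bullet> h) *\<^sub>R c)"
    by (simp add: inner_sum_left inner_sum_right mult.commute)
  then show "(\<Sum>c\<in>C. (x \<bullet> c) *\<^sub>R g c) \<bullet> h = x \<bullet> h" by (simp add: sum_grad_vertex)
qed

lemma other_vertex:
  assumes "c \<in> C" obtains a where "a \<in> C" "a \<noteq> c"
proof -
  have "\<not> C \<subseteq> {c}" using card_mono[of "{c}" C] card_vertices by auto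
  then show ?thesis using that by blast
qed

lemma grad_nonzero:
  assumes "c \<in> C" shows "g c \<noteq> 0"
proof -
  obtain a where "a \<in> C" "a \<noteq> c" using other_vertex[OF assms] by blast
  then show ?thesis using grad_diff[of c a c] assms by auto
qed

text \<open>The entries of T in the redundant frame of the four gradients. For symmetric T the six
  off-diagonal ones, one for each edge, determine T.\<close>

definition frame_coeff :: "real^3^3 \<Rightarrow> real^3 \<Rightarrow> real^3 \<Rightarrow> real" where
  "frame_coeff T a b = g a \<bullet> (T *v g b)"

lemma sum_frame_coeff: "(\<Sum>b\<in>C. frame_coeff T a b) = 0"
proof -
  have "(\<Sum>b\<in>C. frame_coeff T a b) = g a \<bullet> (T *v (\<Sum>b\<in>C. g b))"
    by (simp add: frame_coeff_def inner_sum_right linear_sum[OF matrix_vector_mul_linear])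
  then show ?thesis by (simp add: sum_grad)
qed

lemma frame_coeff_commute: "T \<in> Sym \<Longrightarrow> frame_coeff T a b = frame_coeff T b a"
  unfolding frame_coeff_def by (rule symmetric_matrix_inner)

lemma inner_frame: "x \<bullet> (T *v y) = (\<Sum>a\<in>C. \<Sum>b\<in>C. frame_coeff T a b * ((x \<bullet> a) * (y \<bullet> b)))"
proof -
  have "g a \<bullet> (T *v y) = (\<Sum>b\<in>C. (y \<bullet> b) * frame_coeff T a b)" for a
  proof -
    have "g a \<bullet> (T *v y) = g a \<bullet> (T *v (\<Sum>b\<in>C. (y \<bullet> b) *\<^sub>R g b))" by (simp only: sum_vertex_grad)
    then show ?thesis
      by (simp add: inner_sum_right linear_sum[OF matrix_vector_mul_linear] matrix_vector_mult_scaleR frame_coeff_def)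
  qed
  moreover have "x \<bullet> (T *v y) = (\<Sum>a\<in>C. (x \<bullet> a) * (g a \<bullet> (T *v y)))"
  proof -
    have "x \<bullet> (T *v y) = (\<Sum>a\<in>C. (x \<bullet> a) *\<^sub>R g a) \<bullet> (T *v y)" by (simp only: sum_vertex_grad)
    then show ?thesis by (simp only: inner_sum_left inner_scaleR_left)
  qed
  ultimately show ?thesis by (simp add: sum_distrib_left mult_ac)
qed

text \<open>The rows of the matrix \<open>t\<^sub>a\<^sub>b = g\<^sub>a \<bullet> T g\<^sub>b\<close> sum to zero, so in the expansion of
  \<open>(a - b)(a - b)'\<close> only the mixed terms \<open>ab'\<close> survive.\<close>

theorem symmetric_decomposition:
  assumes T: "T \<in> Sym"
  shows "T = (\<Sum>a\<in>C. \<Sum>b\<in>C. (- (1/2) * frame_coeff T a b) *\<^sub>R outer_square (a - b))"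
proof (rule matrix_eqI_inner)
  fix x y
  let ?t = "frame_coeff T"
  have row: "(\<Sum>a\<in>C. \<Sum>b\<in>C. ?t a b * r a) = 0" for r
    by (simp add: sum_distrib_right[symmetric] sum_frame_coeff)
  have swap: "(\<Sum>a\<in>C. \<Sum>b\<in>C. ?t a b * r a b) = (\<Sum>a\<in>C. \<Sum>b\<in>C. ?t a b * r b a)" for r
    by (subst sum.swap) (simp add: frame_coeff_commute[OF T])
  have col: "(\<Sum>a\<in>C. \<Sum>b\<in>C. ?t a b * r b) = 0" for r
    using swap[of "\<lambda>a b. r b"] row[of r] by simp
  have lin: "linear (\<lambda>A :: real^3^3. x \<bullet> (A *v y))"
    by (rule linearI)
      (simp_all add: matrix_vector_mult_add_rdistrib inner_add_right scaleR_matrix_vector_assoc[symmetric])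
  have "x \<bullet> ((\<Sum>a\<in>C. \<Sum>b\<in>C. (- (1/2) * ?t a b) *\<^sub>R outer_square (a - b)) *v y) =
     (\<Sum>a\<in>C. \<Sum>b\<in>C. - (1/2) * (?t a b * ((x \<bullet> (a - b)) * (y \<bullet> (a - b)))))"
    unfolding linear_sum[OF lin] linear_scale[OF lin] by (simp add: outer_square_vec inner_commute mult_ac)
  also have "\<dots> = - (1/2) * (\<Sum>a\<in>C. \<Sum>b\<in>C. ?t a b * ((x \<bullet> (a - b)) * (y \<bullet> (a - b))))"
    by (simp only: sum_distrib_left)
  also have "(\<Sum>a\<in>C. \<Sum>b\<in>C. ?t a b * ((x \<bullet> (a - b)) * (y \<bullet> (a - b)))) =
     (\<Sum>a\<in>C. \<Sum>b\<in>C. ?t a b * ((x \<bullet> a) * (y \<bullet> a)) + ?t a b * ((x \<bullet> b) * (y \<bullet> b))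
       - ?t a b * ((x \<bullet> a) * (y \<bullet> b)) - ?t a b * ((x \<bullet> b) * (y \<bullet> a)))"
    by (intro sum.cong) (auto simp: inner_diff_right algebra_simps)
  also have "\<dots> = (\<Sum>a\<in>C. \<Sum>b\<in>C. ?t a b * ((x \<bullet> a) * (y \<bullet> a))) + (\<Sum>a\<in>C. \<Sum>b\<in>C. ?t a b * ((x \<bullet> b) * (y \<bullet> b)))
       - (\<Sum>a\<in>C. \<Sum>b\<in>C. ?t a b * ((x \<bullet> a) * (y \<bullet> b))) - (\<Sum>a\<in>C. \<Sum>b\<in>C. ?t a b * ((x \<bullet> b) * (y \<bullet> a)))"
    by (simp only: sum.distrib sum_subtractf)
  also have "\<dots> = - 2 * (\<Sum>a\<in>C. \<Sum>b\<in>C. ?t a b * ((x \<bullet> a) * (y \<bullet> b)))"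
    using row[of "\<lambda>a. (x \<bullet> a) * (y \<bullet> a)"] col[of "\<lambda>b. (x \<bullet> b) * (y \<bullet> b)"]
      swap[of "\<lambda>a b. (x \<bullet> b) * (y \<bullet> a)"] by simp
  finally show "x \<bullet> (T *v y) = x \<bullet> ((\<Sum>a\<in>C. \<Sum>b\<in>C. (- (1/2) * ?t a b) *\<^sub>R outer_square (a - b)) *v y)"
    using inner_frame[of x T y] by simp
qed

lemma inner_decomposition:
  assumes T: "T \<in> Sym"
  shows "T \<bullet> U = (\<Sum>a\<in>C. \<Sum>b\<in>C. (- (1/2) * frame_coeff T a b) * ((a - b) \<bullet> (U *v (a - b))))"
  by (subst symmetric_decomposition[OF T]) (simp only: inner_sum_left inner_scaleR_left outer_square_inner)

text \<open>With U = T in \<open>inner_decomposition\<close>, T : T becomes a combination of the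
  edge values of T.\<close>

lemma symmetric_zeroI:
  assumes T: "T \<in> Sym" and 0: "\<And>a b. a \<in> C \<Longrightarrow> b \<in> C \<Longrightarrow> (a - b) \<bullet> (T *v (a - b)) = 0"
  shows "T = 0"
proof -
  have "T \<bullet> T = 0" unfolding inner_decomposition[OF T] by (intro sum.neutral ballI) (simp add: 0)
  then show ?thesis by simp
qed

subsection \<open>Facets and their normals\<close>

text \<open>Indexed by the opposite vertex: \<open>facet c\<close> lies in the zero set of
  \<open>\<phi> c\<close>, and \<open>g c\<close> is normal to it.\<close>

definition facet :: "real^3 \<Rightarrow> (real^3) set" where "facet c = convex hull (C - {c})"

lemma facet_iff: "f facet_of K \<longleftrightarrow> (\<exists>c\<in>C. f = facet c)"
  unfolding K_def facet_def facet_of_convex_hull_affine_independent_alt[OF indep] card_vertices by auto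

lemma mem_facet: "c \<in> C \<Longrightarrow> x \<in> facet c \<longleftrightarrow> x \<in> K \<and> \<phi> c x = 0"
proof -
  assume c: "c \<in> C"
  have "facet c \<subseteq> K" unfolding facet_def K_def by (rule hull_mono) auto
  moreover have "x \<in> facet c \<Longrightarrow> \<phi> c x = 0"
    using lam_affine_hull_face[OF indep c, of x] convex_hull_subset_affine_hull[of "C - {c}"]
    by (auto simp: facet_def affine_hull_vertices)
  moreover have "x \<in> facet c" if x: "x \<in> K" "\<phi> c x = 0"
  proof -
    have "(\<Sum>b\<in>C - {c}. \<phi> b x) = 1" "(\<Sum>b\<in>C - {c}. \<phi> b x *\<^sub>R b) = x"
      using sum_lam[of x] x by (simp_all add: sum.remove[OF finite_vertices c])
    moreover have "\<forall>b\<in>C - {c}. 0 \<le> \<phi> b x" using x mem_K by auto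
    ultimately show ?thesis
      unfolding facet_def convex_hull_finite[OF finite_Diff[OF finite_vertices]]
      by (intro CollectI exI[of _ "\<lambda>b. \<phi> b x"]) simp
  qed
  ultimately show "x \<in> facet c \<longleftrightarrow> x \<in> K \<and> \<phi> c x = 0" by blast
qed

text \<open>In n = \<Sum> (n \<bullet> b) g_b the factor n \<bullet> b is the same at the three
  vertices of the facet; subtracting this value times \<Sum> g_b = 0 leaves only the term of
  c.\<close>

lemma normal_to_facet:
  assumes c: "c \<in> C" and n: "normal_to (facet c) n"
  obtains r where "n = r *\<^sub>R g c"
proof -
  obtain a where a: "a \<in> C - {c}" using other_vertex[OF c] by blast
  have "n \<bullet> (b - a) = 0" if "b \<in> C - {c}" for b
    using n a that unfolding normal_to_def facet_def by (simp add: hull_inc)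
  then have 0: "n \<bullet> b = n \<bullet> a" if "b \<in> C - {c}" for b using that by (simp add: inner_diff_right)
  have "n = (\<Sum>b\<in>C. (n \<bullet> b) *\<^sub>R g b) - (n \<bullet> a) *\<^sub>R (\<Sum>b\<in>C. g b)"
    by (simp add: sum_vertex_grad sum_grad)
  also have "\<dots> = (\<Sum>b\<in>C. (n \<bullet> b - n \<bullet> a) *\<^sub>R g b)"
    by (simp add: scaleR_sum_right scaleR_diff_left sum_subtractf)
  also have "\<dots> = (n \<bullet> c - n \<bullet> a) *\<^sub>R g c"
    using 0 by (simp add: sum.remove[OF finite_vertices c])
  finally show ?thesis using that by blast
qed

lemma outward_unit_normal_grad:
  assumes c: "c \<in> C"
  shows "outward_unit_normal K (facet c) ((- 1 / norm (g c)) *\<^sub>R g c)"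
  unfolding outward_unit_normal_def
proof (intro conjI ballI)
  show "norm ((- 1 / norm (g c)) *\<^sub>R g c) = 1" using grad_nonzero[OF c] by simp
  fix x y assume "x \<in> facet c" "y \<in> K"
  then have "0 \<le> g c \<bullet> (y - x)" unfolding lam_diff[symmetric] using c mem_facet mem_K by simp
  then show "(- 1 / norm (g c)) *\<^sub>R g c \<bullet> (y - x) \<le> 0" by simp
qed

lemma outward_unit_normal_normal_to:
  assumes c: "c \<in> C" and n: "outward_unit_normal K (facet c) n"
  shows "normal_to (facet c) n"
  unfolding normal_to_def
proof (intro ballI)
  fix x y assume xy: "x \<in> facet c" "y \<in> facet c"
  then have "x \<in> K" "y \<in> K" using mem_facet c by auto
  then have "n \<bullet> (y - x) \<le> 0" "n \<bullet> (x - y) \<le> 0" using n xy by (auto simp: outward_unit_normal_def)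
  then show "n \<bullet> (y - x) = 0" by (simp add: inner_diff_right)
qed

text \<open>Every outward unit normal is a multiple of \<open>g c\<close>, and
  \<open>outward_unit_normal_grad\<close> supplies one with a nonzero factor, so the quantifier over
  normals in \<open>M_space\<close> is not vacuous.\<close>

lemma normal_vanish_iff:
  "(\<forall>f n. f facet_of K \<longrightarrow> outward_unit_normal K f n \<longrightarrow> (\<forall>x\<in>f. T x *v n = 0)) \<longleftrightarrow>
   (\<forall>c\<in>C. \<forall>x\<in>facet c. T x *v g c = 0)"
proof (intro iffI ballI allI impI)
  fix c x assume *: "\<forall>f n. f facet_of K \<longrightarrow> outward_unit_normal K f n \<longrightarrow> (\<forall>x\<in>f. T x *v n = 0)"
    and c: "c \<in> C" and x: "x \<in> facet c"
  have "T x *v ((- 1 / norm (g c)) *\<^sub>R g c) = 0" using * c x facet_iff outward_unit_normal_grad by blast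
  then have "(- 1 / norm (g c)) *\<^sub>R (T x *v g c) = 0" by (simp only: matrix_vector_mult_scaleR)
  then show "T x *v g c = 0" using grad_nonzero[OF c] by simp
next
  fix f n x assume *: "\<forall>c\<in>C. \<forall>x\<in>facet c. T x *v g c = 0" and f: "f facet_of K"
    and n: "outward_unit_normal K f n" and x: "x \<in> f"
  obtain c where c: "c \<in> C" "f = facet c" using f facet_iff by blast
  obtain r where "n = r *\<^sub>R g c" using normal_to_facet[OF c(1)] outward_unit_normal_normal_to c n by metis
  then show "T x *v n = 0" using * c x by (simp add: matrix_vector_mult_scaleR)
qed

end

section \<open>Integrals of continuous functions on compact sets\<close>

lemma integrable_on_compact:
  fixes f :: "'a::euclidean_space \<Rightarrow> 'b::euclidean_space"
  assumes "compact S" "continuous_on S f"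
  shows "f integrable_on S"
  using borel_integrable_compact[OF assms]
  by (intro set_borel_integral_eq_integral(1)) (simp add: set_integrable_def)

lemma integral_compact_lborel:
  fixes f :: "'a::euclidean_space \<Rightarrow> real"
  assumes "compact S" "continuous_on S f"
  shows "integral S f = (LINT x|lborel. indicator S x *\<^sub>R f x)"
  using set_borel_integral_eq_integral(2)[of S f] borel_integrable_compact[OF assms]
  by (simp add: set_integrable_def set_lebesgue_integral_def)

text \<open>Around an interior point, a box with zero integral forces f = 0 by continuity; boundary
  points follow since a convex body is the closure of its interior.\<close>

lemma integral_zero_convex:
  fixes f :: "'a::euclidean_space \<Rightarrow> real"
  assumes S: "compact S" "convex S" "interior S \<noteq> {}" and f: "continuous_on S f"
    and nonneg: "\<And>x. x \<in> S \<Longrightarrow> 0 \<le> f x" and 0: "integral S f = 0" and x: "x \<in> S"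
  shows "f x = 0"
proof -
  have int: "f y = 0" if y: "y \<in> interior S" for y
  proof -
    obtain a b where ab: "cbox a b \<subseteq> interior S" "y \<in> box a b" "\<forall>i\<in>Basis. a \<bullet> i < b \<bullet> i"
      using open_contains_cbox[OF open_interior y] by blast
    have sub: "cbox a b \<subseteq> S" using ab interior_subset by blast
    have cont: "continuous_on (cbox a b) f" using f sub by (rule continuous_on_subset)
    have "integral (cbox a b) f \<le> integral S f"
      by (rule integral_subset_le[OF sub integrable_continuous[OF cont] integrable_on_compact[OF S(1) f]])
        (use nonneg in blast)
    moreover have "0 \<le> integral (cbox a b) f"
      by (rule integral_nonneg[OF integrable_continuous[OF cont]]) (use nonneg sub in blast)
    ultimately have "integral (cbox a b) f = 0" using 0 by simp
    moreover have "box a b \<noteq> {}" using ab(2) by auto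
    ultimately show "f y = 0"
      using integral_cbox_eq_0_iff[OF cont] nonneg sub ab(2) box_subset_cbox by blast
  qed
  have "closure (interior S) = S"
    using convex_closure_interior[OF S(2,3)] compact_imp_closed[OF S(1)] by simp
  then show ?thesis using continuous_constant_on_closure[of "interior S" f 0 x] f int x by simp
qed

lemma lborel_integral_translation:
  fixes f :: "'a::euclidean_space \<Rightarrow> real"
  assumes "integrable lborel f"
  shows "integrable lborel (\<lambda>x. f (x + c))" "(LINT x|lborel. f (x + c)) = (LINT x|lborel. f x)"
proof -
  have f: "f \<in> borel_measurable borel" using borel_measurable_integrable[OF assms] by simp
  have "integrable (distr lborel borel ((+) c)) f" using assms by (simp add: lborel_distr_plus)
  then show "integrable lborel (\<lambda>x. f (x + c))"
    using f by (subst (asm) integrable_distr_eq) (auto simp: add.commute)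
  have "(LINT x|lborel. f x) = (LINT x|distr lborel borel ((+) c). f x)" by (simp add: lborel_distr_plus)
  also have "\<dots> = (LINT x|lborel. f (x + c))"
    using f by (subst integral_distr) (auto simp: add.commute)
  finally show "(LINT x|lborel. f (x + c)) = (LINT x|lborel. f x)" by simp
qed

lemma AE_not_frontier_convex:
  fixes S :: "'a::euclidean_space set"
  assumes "convex S"
  shows "AE x in lborel. x \<notin> frontier S"
proof (rule AE_not_in)
  have "frontier S \<in> null_sets lebesgue"
    using negligible_convex_frontier[OF assms] by (simp add: negligible_iff_null_sets)
  then show "frontier S \<in> null_sets lborel"
    by (subst (asm) null_sets_completion_iff) (auto intro: borel_closed)
qed

context tetrahedron
begin

lemma lam_shift:
  assumes "a \<in> C" "b \<in> C" "c \<in> C"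
  shows "\<phi> c (x + t *\<^sub>R (a - b)) = \<phi> c x + t * ((if a = c then 1 else 0) - (if b = c then 1 else 0))"
proof -
  have "\<phi> c (x + t *\<^sub>R (a - b)) - \<phi> c x = t * (g c \<bullet> (a - b))" by (simp add: lam_diff)
  then show ?thesis using grad_diff[OF assms] by simp
qed

lemma lam_le_1:
  assumes "x \<in> K" "c \<in> C" shows "\<phi> c x \<le> 1"
  using sum_lam(1)[of x] member_le_sum[OF assms(2), of "\<lambda>c. \<phi> c x"] finite_vertices assms(1) mem_K by auto

text \<open>The zero extension of \<open>\<phi> a \<phi> b q\<close> is Lipschitz continuous along \<open>a - b\<close>, although it jumps
  across the two facets that contain the edge. Its difference quotients have integral zero by translation
  invariance, and dominated convergence passes to the derivative.\<close>

theorem integral_edge_derivative: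
  assumes ab: "a \<in> C" "b \<in> C" "a \<noteq> b" and q: "q \<in> pol (UNIV :: real set) j"
    and f: "f \<in> pol UNIV m" "\<And>x. x \<in> K \<Longrightarrow> f x = \<phi> a x * \<phi> b x * q x"
    and f': "\<And>x. (f has_derivative f' x) (at x)"
  shows "integral K (\<lambda>x. f' x (a - b)) = 0"
proof -
  define s where "s = a - b"
  obtain p' where "\<And>x. (f has_derivative p' x) (at x)" "\<And>h. (\<lambda>x. p' x h) \<in> pol UNIV (m - 1)"
    using pol_has_derivative[OF f(1)] by auto
  then have f's: "(\<lambda>x. f' x s) \<in> pol UNIV (m - 1)"
    using has_derivative_unique[OF f'] by (metis (no_types, lifting) ext)
  have cq: "continuous_on K q" using q by (rule pol_continuous_on)
  have cf: "continuous_on K f" using f(1) by (rule pol_continuous_on)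
  have cf': "continuous_on K (\<lambda>x. f' x s)" using f's by (rule pol_continuous_on)
  obtain Q where Q: "\<And>x. x \<in> K \<Longrightarrow> \<bar>q x\<bar> \<le> Q"
    using compact_imp_bounded[OF compact_continuous_image[OF cq compact_K]]
    unfolding bounded_iff by auto
  obtain B where B: "\<And>x. x \<in> K \<Longrightarrow> \<bar>f' x s\<bar> \<le> B"
    using compact_imp_bounded[OF compact_continuous_image[OF cf' compact_K]]
    unfolding bounded_iff by auto
  obtain R where R: "\<And>x. x \<in> K \<Longrightarrow> norm x \<le> R"
    using compact_imp_bounded[OF compact_K] unfolding bounded_iff by auto
  have pos: "0 \<le> Q" "0 \<le> B" using Q[of a] B[of a] vertex_in_K[OF ab(1)] by linarith+
  define F where "F = (\<lambda>x. indicator K x *\<^sub>R f x :: real)"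
  have F_in: "F x = f x" if "x \<in> K" for x using that by (simp add: F_def)
  have F_out: "F x = 0" if "x \<notin> K" for x using that by (simp add: F_def)
  have F: "integrable lborel F" unfolding F_def by (rule borel_integrable_compact[OF compact_K cf])
  \<comment> \<open>On K both coordinates lie between 0 and 1, so their product is bounded by either
    one.\<close>
  have small: "\<bar>f x\<bar> \<le> r * Q" if x: "x \<in> K" and r: "\<phi> a x \<le> r \<or> \<phi> b x \<le> r" for x r
  proof -
    have 1: "0 \<le> \<phi> a x" "\<phi> a x \<le> 1" "0 \<le> \<phi> b x" "\<phi> b x \<le> 1"
      using x ab mem_K lam_le_1 by auto
    then have "\<phi> a x * \<phi> b x \<le> r"
      using r mult_left_le[of "\<phi> b x" "\<phi> a x"] mult_left_le[of "\<phi> a x" "\<phi> b x"]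
      by (auto simp: mult.commute)
    moreover have "\<bar>f x\<bar> = (\<phi> a x * \<phi> b x) * \<bar>q x\<bar>" using f(2)[OF x] 1 by (simp add: abs_mult)
    moreover have "0 \<le> \<phi> a x * \<phi> b x" using 1 by simp
    ultimately show ?thesis using mult_mono[of "\<phi> a x * \<phi> b x" r "\<bar>q x\<bar>" Q] Q[OF x] by simp
  qed
  \<comment> \<open>Along s only \<open>\<phi> a\<close> grows and only \<open>\<phi> b\<close>
    decreases, each at unit rate. A shift by h s that leaves K thus starts where
    \<open>\<phi> b\<close> is at most h, and one that enters K ends where \<open>\<phi> a\<close>
    is at most h; in both cases \<open>small\<close> bounds the nonzero value by h Q. If both ends
    lie in K, the mean value theorem gives h B.\<close>
  have lip: "\<bar>F (x + h *\<^sub>R s) - F x\<bar> \<le> h * (B + Q)" if h: "0 < h" for x h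
  proof -
    let ?y = "x + h *\<^sub>R s"
    have \<phi>: "\<phi> c ?y = \<phi> c x + h * ((if a = c then 1 else 0) - (if b = c then 1 else 0))" if "c \<in> C" for c
      unfolding s_def by (rule lam_shift[OF ab(1,2) that])
    have hQ: "0 \<le> h * B" "0 \<le> h * Q" using h pos by auto
    consider "x \<in> K" "?y \<in> K" | "x \<in> K" "?y \<notin> K" | "x \<notin> K" "?y \<in> K" | "x \<notin> K" "?y \<notin> K" by blast
    then show ?thesis
    proof cases
      case 1
      let ?l = "\<lambda>t. x + t *\<^sub>R s"
      have "((\<lambda>t. f (?l t)) has_derivative (\<lambda>r. f' (?l t) (r *\<^sub>R s))) (at t within {0..h})" for t
        by (rule has_derivative_compose[OF _ f']) (auto intro!: derivative_eq_intros)
      then obtain t where t: "t \<in> {0..h}" "f (?l h) - f (?l 0) = f' (?l t) ((h - 0) *\<^sub>R s)"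
        using mvt_very_simple[of 0 h "\<lambda>t. f (?l t)" "\<lambda>t r. f' (?l t) (r *\<^sub>R s)"] h by auto
      have "?l t \<in> K"
      proof -
        have "(1 - t / h) *\<^sub>R x + (t / h) *\<^sub>R ?y \<in> K"
          using convexD[OF convex_K 1, of "1 - t / h" "t / h"] t(1) h by simp
        then show ?thesis using h by (simp add: algebra_simps)
      qed
      then have "\<bar>f' (?l t) (h *\<^sub>R s)\<bar> \<le> h * B"
        using B h by (simp add: linear_scale[OF has_derivative_linear[OF f']] abs_mult)
      then show ?thesis using t(2) 1 hQ by (simp add: F_in distrib_left)
    next
      case 2
      then obtain c where c: "c \<in> C" "\<phi> c ?y < 0" using mem_K not_le by blast
      have "\<not> (b \<noteq> c)"
      proof
        assume "b \<noteq> c"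
        then have "\<phi> c x \<le> \<phi> c ?y" using \<phi>[OF c(1)] h by simp
        then show False using c 2(1) mem_K by force
      qed
      then have "\<phi> b x \<le> h" using c \<phi>[OF c(1)] ab by auto
      then show ?thesis using small[OF 2(1), of h] 2 hQ by (simp add: F_in F_out distrib_left)
    next
      case 3
      then obtain c where c: "c \<in> C" "\<phi> c x < 0" using mem_K not_le by blast
      have "\<not> (a \<noteq> c)"
      proof
        assume "a \<noteq> c"
        then have "\<phi> c ?y \<le> \<phi> c x" using \<phi>[OF c(1)] h by simp
        then show False using c 3(2) mem_K by force
      qed
      then have "\<phi> a ?y \<le> h" using c \<phi>[OF c(1)] ab by auto
      then show ?thesis using small[OF 3(2), of h] 3 hQ by (simp add: F_in F_out distrib_left)
    next
      case 4
      then show ?thesis using hQ by (simp add: F_out distrib_left)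
    qed
  qed
  define h where "h n = 1 / real (Suc n)" for n
  have h: "0 < h n" "h n \<le> 1" for n by (auto simp: h_def)
  have h0: "h \<longlonglongrightarrow> 0" unfolding h_def by (rule LIMSEQ_Suc[OF lim_1_over_n])
  define D where "D n x = (F (x + h n *\<^sub>R s) - F x) / h n" for n x
  define G where "G x = (indicator K x *\<^sub>R f' x s :: real)" for x
  have intD: "(LINT x|lborel. D n x) = 0" for n
  proof -
    have "(LINT x|lborel. D n x) = ((LINT x|lborel. F (x + h n *\<^sub>R s)) - (LINT x|lborel. F x)) / h n"
      unfolding D_def by (simp add: lborel_integral_translation(1)[OF F] F)
    then show ?thesis by (simp add: lborel_integral_translation(2)[OF F])
  qed
  have conv: "(\<lambda>n. D n x) \<longlonglongrightarrow> G x" if x: "x \<notin> frontier K" for x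
  proof -
    have lim: "(\<lambda>n. x + h n *\<^sub>R s) \<longlonglongrightarrow> x"
      using tendsto_add[OF tendsto_const tendsto_scaleR[OF h0 tendsto_const]] by simp
    show ?thesis
    proof (cases "x \<in> K")
      case True
      then have xi: "x \<in> interior K" using x compact_imp_closed[OF compact_K] by (simp add: frontier_def)
      have "\<forall>\<^sub>F n in sequentially. x + h n *\<^sub>R s \<in> interior K"
        using topological_tendstoD[OF lim open_interior xi] .
      then have ev: "\<forall>\<^sub>F n in sequentially. (f (x + h n *\<^sub>R s) - f x) / h n = D n x"
        by (rule eventually_mono) (use True F_in subsetD[OF interior_subset[of K]] in \<open>simp add: D_def\<close>)
      have "((\<lambda>t. f (x + t *\<^sub>R s)) has_derivative (\<lambda>r. f' (x + 0 *\<^sub>R s) (r *\<^sub>R s))) (at 0)"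
        by (rule has_derivative_compose[OF _ f']) (auto intro!: derivative_eq_intros)
      then have "((\<lambda>t. f (x + t *\<^sub>R s)) has_real_derivative f' x s) (at 0)"
        by (simp add: has_field_derivative_def linear_scale[OF has_derivative_linear[OF f']] mult_commute_abs)
      then have "((\<lambda>t. (f (x + t *\<^sub>R s) - f x) / t) \<longlongrightarrow> f' x s) (at 0)"
        by (simp add: DERIV_def)
      moreover have "filterlim h (at 0) sequentially"
        using h0 h(1) by (auto simp: filterlim_at intro!: eventuallyI) (metis less_irrefl)
      ultimately have "(\<lambda>n. (f (x + h n *\<^sub>R s) - f x) / h n) \<longlonglongrightarrow> f' x s"
        by (rule filterlim_compose)
      then show ?thesis using True ev by (simp add: G_def tendsto_cong)
    next
      case False
      have "\<forall>\<^sub>F n in sequentially. x + h n *\<^sub>R s \<in> - K"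
        by (rule topological_tendstoD[OF lim]) (use False compact_imp_closed[OF compact_K] in \<open>auto simp: open_Compl\<close>)
      then have "\<forall>\<^sub>F n in sequentially. D n x = 0"
        by (rule eventually_mono) (use False in \<open>auto simp: D_def F_out\<close>)
      then show ?thesis using False by (simp add: G_def tendsto_eventually)
    qed
  qed
  \<comment> \<open>As h n is at most 1, the shift is no longer than s. Outside the enlarged ball
    both points miss K, so one multiple of an indicator dominates all difference quotients.\<close>
  have bound: "\<bar>D n x\<bar> \<le> indicator (cball 0 (R + norm s)) x *\<^sub>R (B + Q)" for n x
  proof (cases "x \<in> cball 0 (R + norm s)")
    case True
    have "\<bar>D n x\<bar> = \<bar>F (x + h n *\<^sub>R s) - F x\<bar> / h n" using h(1)[of n] by (simp add: D_def)
    also have "\<dots> \<le> B + Q" using lip[OF h(1)[of n], of x] h(1)[of n] by (simp add: pos_divide_le_eq mult.commute)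
    finally show ?thesis using True by simp
  next
    case False
    then have "x \<notin> K" using R[of x] norm_ge_zero[of s] by (auto simp: dist_norm)
    moreover have "x + h n *\<^sub>R s \<notin> K"
    proof
      assume "x + h n *\<^sub>R s \<in> K"
      then have "norm (x + h n *\<^sub>R s) \<le> R" by (rule R)
      moreover have "norm x \<le> norm (x + h n *\<^sub>R s) + norm (h n *\<^sub>R s)"
        using norm_triangle_ineq4[of "x + h n *\<^sub>R s" "h n *\<^sub>R s"] by simp
      moreover have "norm (h n *\<^sub>R s) \<le> norm s" using h[of n] by (simp add: mult_left_le_one_le)
      ultimately show False using False by (simp add: dist_norm)
    qed
    ultimately show ?thesis using False by (simp add: D_def F_out)
  qed
  have "(\<lambda>n. LINT x|lborel. D n x) \<longlonglongrightarrow> (LINT x|lborel. G x)"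
  proof (rule integral_dominated_convergence[where w = "\<lambda>x. indicator (cball 0 (R + norm s)) x *\<^sub>R (B + Q)"])
    show "G \<in> borel_measurable lborel" unfolding G_def
      by (rule borel_measurable_integrable[OF borel_integrable_compact[OF compact_K cf']])
    show "D n \<in> borel_measurable lborel" for n
      unfolding D_def
      by (rule borel_measurable_integrable) (simp add: lborel_integral_translation(1)[OF F] F)
    show "integrable lborel (\<lambda>x. indicator (cball 0 (R + norm s)) x *\<^sub>R (B + Q))"
      by (rule borel_integrable_compact) auto
    show "AE x in lborel. (\<lambda>n. D n x) \<longlonglongrightarrow> G x"
      using AE_not_frontier_convex[OF convex_K] by (rule eventually_mono) (rule conv)
    show "AE x in lborel. norm (D n x) \<le> indicator (cball 0 (R + norm s)) x *\<^sub>R (B + Q)" for n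
      using bound by simp
  qed
  then have "(LINT x|lborel. G x) = 0" using intD by (simp add: LIMSEQ_const_iff)
  then show ?thesis
    using integral_compact_lborel[OF compact_K cf'] by (simp add: G_def s_def)
qed

section \<open>Divergence and symmetric gradient of polynomial fields\<close>

lemma frame_coeff_linear: "linear (\<lambda>T. frame_coeff T a b)"
  by (rule linearI)
    (simp_all add: frame_coeff_def matrix_vector_mult_add_rdistrib inner_add_right scaleR_matrix_vector_assoc[symmetric])

lemma frame_coeff_bounded_linear: "bounded_linear (\<lambda>T. frame_coeff T a b)"
  using frame_coeff_linear by (simp add: linear_conv_bounded_linear)

lemma frame_coeff_pol: "P \<in> pol X j \<Longrightarrow> (\<lambda>x. frame_coeff (P x) a b) \<in> pol UNIV j"
  by (rule pol_linear[OF _ frame_coeff_linear]) auto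

text \<open>For a constant vector s, the row divergence of t s s' is s times the derivative of t
  along s. Applied to the decomposition of P, this leaves only derivatives of each coefficient along
  its own edge, the form that \<open>integral_edge_derivative\<close> handles.\<close>

lemma div_on_pol:
  assumes P: "P \<in> pol Sym j" and P': "\<And>x. (P has_derivative P' x) (at x)"
  obtains D where "D \<in> pol UNIV (j - 1)" "div_on K (zero_ext K P) = zero_ext K D"
    "\<And>x. D x = (\<Sum>a\<in>C. \<Sum>b\<in>C. (- (1/2) * frame_coeff (P' x (a - b)) a b) *\<^sub>R (a - b))"
proof -
  obtain R where R: "\<And>x. (P has_derivative R x) (at x)" "\<And>h. (\<lambda>x. R x h) \<in> pol Sym (j - 1)"
    using pol_has_derivative[OF P subspace_Sym] by auto
  have "R x = P' x" for x by (rule has_derivative_unique[OF R(1) P'])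
  then have pol': "(\<lambda>x. P' x h) \<in> pol Sym (j - 1)" for h using R(2) by simp
  let ?D = "\<lambda>x. \<Sum>a\<in>C. \<Sum>b\<in>C. (- (1/2) * frame_coeff (P' x (a - b)) a b) *\<^sub>R (a - b)"
  have "?D \<in> pol UNIV (j - 1)"
  proof (intro pol_sum subspace_UNIV)
    fix a b
    have "linear (\<lambda>T. (- (1/2) * frame_coeff T a b) *\<^sub>R (a - b))"
      by (rule linearI)
        (simp_all add: linear_add[OF frame_coeff_linear] linear_scale[OF frame_coeff_linear] scaleR_add_left scaleR_diff_left add_divide_distrib)
    from pol_linear[OF pol' this, of UNIV "a - b"]
    show "(\<lambda>x. (- (1/2) * frame_coeff (P' x (a - b)) a b) *\<^sub>R (a - b)) \<in> pol UNIV (j - 1)" by simp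
  qed
  moreover have "div_on K (zero_ext K P) = zero_ext K ?D"
  proof
    fix x
    show "div_on K (zero_ext K P) x = zero_ext K ?D x"
    proof (cases "x \<in> K")
      case True
      have lin: "linear (\<lambda>h. frame_coeff (P' x h) a b)" for a b
        using linear_compose[OF has_derivative_linear[OF P'] frame_coeff_linear] by (simp add: o_def)
      have expand: "(\<Sum>j\<in>UNIV. frame_coeff (P' x (axis j 1)) a b * s $ j) = frame_coeff (P' x s) a b" for a b s
      proof -
        have "s = (\<Sum>j\<in>UNIV. s $ j *\<^sub>R axis j 1)"
          using basis_expansion[of s] by (simp add: scalar_mult_eq_scaleR)
        then have "frame_coeff (P' x s) a b = frame_coeff (P' x (\<Sum>j\<in>UNIV. s $ j *\<^sub>R axis j 1)) a b" by simp
        also have "\<dots> = (\<Sum>j\<in>UNIV. frame_coeff (P' x (axis j 1)) a b * s $ j)"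
          by (simp add: linear_sum[OF lin] linear_scale[OF lin] mult.commute)
        finally show ?thesis by simp
      qed
      have "P' x h $ i $ j = (\<Sum>a\<in>C. \<Sum>b\<in>C. (- (1/2) * frame_coeff (P' x h) a b) * ((a - b) $ i * (a - b) $ j))" for h i j
      proof -
        have "P' x h \<in> Sym" by (rule pol_value[OF subspace_Sym pol'])
        from arg_cong[OF symmetric_decomposition[OF this], of "\<lambda>A. A $ i $ j"]
        have "P' x h $ i $ j = (\<Sum>a\<in>C. \<Sum>b\<in>C. (- (1/2) * frame_coeff (P' x h) a b) *\<^sub>R outer_square (a - b)) $ i $ j" .
        also have "\<dots> = (\<Sum>a\<in>C. \<Sum>b\<in>C. (- (1/2) * frame_coeff (P' x h) a b) * ((a - b) $ i * (a - b) $ j))"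
          by (simp add: outer_square_def)
        finally show ?thesis .
      qed
      then have "div_on K (zero_ext K P) x $ i = (\<Sum>j\<in>UNIV. \<Sum>a\<in>C. \<Sum>b\<in>C.
          (- (1/2) * frame_coeff (P' x (axis j 1)) a b) * ((a - b) $ i * (a - b) $ j))" for i
        by (simp add: div_on_zero_ext[OF convex_K interior_K True P'])
      also have "\<dots> i = (\<Sum>a\<in>C. \<Sum>b\<in>C. \<Sum>j\<in>UNIV.
          (- (1/2) * frame_coeff (P' x (axis j 1)) a b) * ((a - b) $ i * (a - b) $ j))" for i
        by (subst sum.swap, rule sum.cong[OF refl], subst sum.swap) simp
      also have "\<dots> i = (\<Sum>a\<in>C. \<Sum>b\<in>C. - (1/2) * (a - b) $ i *
          (\<Sum>j\<in>UNIV. frame_coeff (P' x (axis j 1)) a b * (a - b) $ j))" for i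
        by (simp only: sum_distrib_left mult_ac)
      also have "\<dots> i = ?D x $ i" for i unfolding expand by (simp add: mult_ac)
      finally show ?thesis using True by (simp add: vec_eq_iff zero_ext_in)
    qed (simp add: div_on_def zero_ext_def)
  qed
  ultimately show ?thesis using that by blast
qed

text \<open>The antisymmetric part of the gradient does not contribute to the quadratic form. The
  last conclusion turns edge components of \<epsilon>(p) into derivatives of p along the
  edge.\<close>

lemma sym_grad_on_pol:
  assumes p: "p \<in> pol UNIV j" and p': "\<And>x. (p has_derivative p' x) (at x)"
  obtains E where "E \<in> pol Sym (j - 1)" "sym_grad_on K (zero_ext K p) = zero_ext K E"
    "\<And>x s. s \<bullet> (E x *v s) = s \<bullet> p' x s"
proof -
  obtain r where r: "\<And>x. (p has_derivative r x) (at x)" "\<And>h. (\<lambda>x. r x h) \<in> pol UNIV (j - 1)"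
    using pol_has_derivative[OF p] by auto
  have "r x = p' x" for x by (rule has_derivative_unique[OF r(1) p'])
  then have pol': "(\<lambda>x. p' x h) \<in> pol UNIV (j - 1)" for h using r(2) by simp
  let ?E = "\<lambda>x. (1/2) *\<^sub>R (matrix (p' x) + transpose (matrix (p' x)))"
  have "(\<lambda>x. matrix (p' x)) \<in> pol UNIV (j - 1)"
  proof -
    have "(\<lambda>x. matrix (p' x)) = (\<lambda>x. \<Sum>k\<in>UNIV. (\<chi> i l. if l = k then p' x (axis k 1) $ i else 0))"
      by (auto simp: fun_eq_iff vec_eq_iff matrix_def)
    also have "\<dots> \<in> pol UNIV (j - 1)"
    proof (intro pol_sum subspace_UNIV)
      fix k :: 3
      have "linear (\<lambda>v :: real^3. (\<chi> i l. if l = k then v $ i else 0) :: real^3^3)"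
        by (rule linearI) (auto simp: vec_eq_iff)
      from pol_linear[OF pol' this, of UNIV "axis k 1"]
      show "(\<lambda>x. (\<chi> i l. if l = k then p' x (axis k 1) $ i else 0)) \<in> pol UNIV (j - 1)" by simp
    qed
    finally show ?thesis .
  qed
  from pol_linear[OF this linear_symmetric_part, of Sym]
  have "?E \<in> pol Sym (j - 1)" using symmetric_part_symmetric by blast
  moreover have "s \<bullet> (?E x *v s) = s \<bullet> p' x s" for x s
  proof -
    let ?A = "matrix (p' x)"
    have "s \<bullet> (transpose ?A *v s) = s \<bullet> (?A *v s)"
      by (metis dot_lmul_matrix inner_commute transpose_matrix_vector)
    moreover have "?A *v s = p' x s" 
      using matrix_works[of "p' x"] has_derivative_linear[OF p'] by (simp add: linear_matrix_vector_mul_eq)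
    moreover have "s \<bullet> (?E x *v s) = (1/2) * (s \<bullet> (?A *v s) + s \<bullet> (transpose ?A *v s))"
      by (simp only: scaleR_matrix_vector_assoc[symmetric] matrix_vector_mult_add_rdistrib inner_scaleR_right inner_add_right)
    ultimately show ?thesis by simp
  qed
  ultimately show ?thesis using that sym_grad_on_zero_ext[OF convex_K interior_K p'] by blast
qed

text \<open>The common argument for divergence and symmetric gradient: \<open>\<Phi>\<close> reads
  the value of the operator off the derivative at a point of K, where a zero extension is
  differentiated like its polynomial, and off K the value is 0.\<close>

lemma lin_on_differential:
  fixes A :: "(real^3 \<Rightarrow> 'v::euclidean_space) \<Rightarrow> real^3 \<Rightarrow> 'w::real_vector"
  assumes X: "subspace X"
    and in_K: "\<And>p p' x. x \<in> K \<Longrightarrow> (p has_derivative p') (at x) \<Longrightarrow> A (zero_ext K p) x = \<Phi> p'"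
    and out: "\<And>f x. x \<notin> K \<Longrightarrow> A f x = 0"
    and \<Phi>: "\<And>F G. \<Phi> (\<lambda>h. F h + G h) = \<Phi> F + \<Phi> G" "\<And>c F. \<Phi> (\<lambda>h. c *\<^sub>R F h) = c *\<^sub>R \<Phi> F"
  shows "lin_on (zero_ext K ` pol X j) A"
proof -
  have "A (zero_ext K P + zero_ext K Q) x = (A (zero_ext K P) + A (zero_ext K Q)) x"
    "A (c *\<^sub>R zero_ext K P) x = (c *\<^sub>R A (zero_ext K P)) x"
    if P: "P \<in> pol X j" and Q: "Q \<in> pol X j" for P Q c x
  proof -
    obtain P' where P': "\<And>x. (P has_derivative P' x) (at x)"
      by (rule pol_has_derivative[OF P X]) blast
    obtain Q' where Q': "\<And>x. (Q has_derivative Q' x) (at x)"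
      by (rule pol_has_derivative[OF Q X]) blast
    have eq: "zero_ext K P + zero_ext K Q = zero_ext K (\<lambda>x. P x + Q x)"
      "c *\<^sub>R zero_ext K P = zero_ext K (\<lambda>x. c *\<^sub>R P x)" by (auto simp: zero_ext_def)
    show "A (zero_ext K P + zero_ext K Q) x = (A (zero_ext K P) + A (zero_ext K Q)) x"
      unfolding eq using out[of x] in_K[OF _ has_derivative_add[OF P' Q'], of x] in_K[OF _ P', of x] in_K[OF _ Q', of x]
      by (cases "x \<in> K") (simp_all add: \<Phi>)
    show "A (c *\<^sub>R zero_ext K P) x = (c *\<^sub>R A (zero_ext K P)) x"
      unfolding eq using out[of x] in_K[OF _ has_derivative_scaleR_right[OF P'], of x c] in_K[OF _ P', of x]
      by (cases "x \<in> K") (simp_all add: \<Phi>)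
  qed
  then show ?thesis unfolding lin_on_def by blast
qed

lemma lin_on_div: "lin_on (zero_ext K ` pol Sym j) (div_on K)"
proof (rule lin_on_differential[OF subspace_Sym])
  show "div_on K (zero_ext K p) x = (\<chi> i. \<Sum>j\<in>UNIV. p' (axis j 1) $ i $ j)"
    if "x \<in> K" "(p has_derivative p') (at x)" for p p' x
    by (rule div_on_zero_ext[OF convex_K interior_K that])
qed (simp_all add: div_on_def zero_ext_def vec_eq_iff sum.distrib sum_distrib_left)

lemma lin_on_sym_grad: "lin_on (zero_ext K ` (pol UNIV j :: (real^3 \<Rightarrow> real^3) set)) (sym_grad_on K)"
proof (rule lin_on_differential[OF subspace_UNIV, where \<Phi> = "\<lambda>F. (1/2) *\<^sub>R (matrix F + transpose (matrix F))"])
  show "sym_grad_on K (zero_ext K p) x = (1/2) *\<^sub>R (matrix p' + transpose (matrix p'))"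
    if "x \<in> K" "(p has_derivative p') (at x)" for p p' x
    using frechet_derivative_within_convex[OF convex_K interior_K that, of "zero_ext K p"] that(1)
    by (simp add: sym_grad_on_def grad_on_def zero_ext_in)
  show "sym_grad_on K f x = 0" if "x \<notin> K" for f x
    using that by (simp add: sym_grad_on_def grad_on_def zero_ext_def linear_0[OF linear_transpose])
qed (simp_all add: matrix_def transpose_def vec_eq_iff algebra_simps)

section \<open>Integration by parts for fields with vanishing normal component\<close>

definition normal_free :: "(real^3 \<Rightarrow> real^3^3) \<Rightarrow> bool" where
  "normal_free T \<longleftrightarrow> (\<forall>c\<in>C. \<forall>x\<in>facet c. T x *v g c = 0)"

lemma facet_subset: "facet c \<subseteq> K"
  unfolding facet_def K_def by (rule hull_mono) auto

lemma normal_free_zero_ext: "normal_free (zero_ext K P) \<longleftrightarrow> normal_free P"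
  unfolding normal_free_def using facet_subset by (auto simp: zero_ext_def subset_iff)

text \<open>On \<open>facet b\<close> the condition T g_b = 0 kills the coefficient; on
  \<open>facet a\<close> the symmetry of T first exchanges the two gradients.\<close>

lemma bubble_coeff:
  assumes P: "P \<in> pol Sym (j + 2)" and 0: "normal_free P"
    and ab: "a \<in> C" "b \<in> C" "a \<noteq> b"
  obtains q where "q \<in> pol UNIV j" "\<And>x. frame_coeff (P x) a b = \<phi> a x * \<phi> b x * q x"
proof -
  have sym: "P x \<in> Sym" for x by (rule pol_value[OF subspace_Sym P])
  have "\<exists>q\<in>pol UNIV j. \<forall>x\<in>affine hull C. frame_coeff (P x) a b = (\<Prod>c\<in>{a, b}. \<phi> c x) *\<^sub>R q x"
  proof (rule bubble_factor[OF indep])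
    show "(\<lambda>x. frame_coeff (P x) a b) \<in> pol UNIV (j + card {a, b})"
      using frame_coeff_pol[OF P] ab by (simp add: numeral_2_eq_2)
    fix c x assume c: "c \<in> {a, b}" and x: "x \<in> convex hull (C - {c})"
    have "frame_coeff (P x) a b = frame_coeff (P x) b a" by (rule frame_coeff_commute[OF sym])
    then show "frame_coeff (P x) a b = 0"
      using 0 c x ab unfolding normal_free_def facet_def frame_coeff_def by fastforce
  qed (use ab card_vertices in auto)
  then show ?thesis using that ab affine_hull_vertices by auto
qed

text \<open>With t_ab the frame coefficients of T, the sum div T \<bullet> v + T : \<epsilon>(v) is
  -1/2 times the sum over a, b of the derivatives along a - b of t_ab ((a - b) \<bullet> v). For a
  \<noteq> b the function differentiated contains the factor \<open>\<phi> a * \<phi> b\<close>, so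
  each integral vanishes.\<close>

theorem integration_by_parts:
  assumes T: "T \<in> zero_ext K ` pol Sym (j + 2)" "normal_free T"
    and v: "v \<in> zero_ext K ` pol UNIV i"
  shows "integral K (\<lambda>x. div_on K T x \<bullet> v x) = - integral K (\<lambda>x. T x \<bullet> sym_grad_on K v x)"
proof -
  obtain P where P: "P \<in> pol Sym (j + 2)" "T = zero_ext K P" using T by blast
  have nf: "normal_free P" using T P normal_free_zero_ext by simp
  obtain p where p: "p \<in> pol UNIV i" "v = zero_ext K p" using v by blast
  obtain P' where P': "\<And>x. (P has_derivative P' x) (at x)" "\<And>h. (\<lambda>x. P' x h) \<in> pol Sym (j + 2 - 1)"
    by (rule pol_has_derivative[OF P(1) subspace_Sym]) blast
  obtain p' where p': "\<And>x. (p has_derivative p' x) (at x)" "\<And>h. (\<lambda>x. p' x h) \<in> pol UNIV (i - 1)"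
    using pol_has_derivative[OF p(1)] by auto
  obtain D where D: "D \<in> pol UNIV (j + 2 - 1)" "div_on K (zero_ext K P) = zero_ext K D"
    "\<And>x. D x = (\<Sum>a\<in>C. \<Sum>b\<in>C. (- (1/2) * frame_coeff (P' x (a - b)) a b) *\<^sub>R (a - b))"
    by (rule div_on_pol[OF P(1) P'(1)]) blast
  obtain E where E: "E \<in> pol Sym (i - 1)" "sym_grad_on K (zero_ext K p) = zero_ext K E"
    "\<And>x s. s \<bullet> (E x *v s) = s \<bullet> p' x s"
    by (rule sym_grad_on_pol[OF p(1) p'(1)]) blast
  define f where "f a b x = frame_coeff (P x) a b * ((a - b) \<bullet> p x)" for a b x
  define f' where "f' a b x h = frame_coeff (P x) a b * ((a - b) \<bullet> p' x h) + frame_coeff (P' x h) a b * ((a - b) \<bullet> p x)" for a b x h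
  have deriv: "(f a b has_derivative f' a b x) (at x)" for a b x
    unfolding f_def[abs_def] f'_def[abs_def]
    by (intro has_derivative_mult bounded_linear.has_derivative[OF frame_coeff_bounded_linear P'(1)]
        bounded_linear.has_derivative[OF bounded_linear_inner_right p'(1)])
  have polf: "f a b \<in> pol UNIV (j + 2 + i)" for a b
    using pol_scaleR[OF frame_coeff_pol[OF P(1)] pol_inner[OF pol_const p(1), of "a - b" 0] subspace_UNIV, of a b]
    by (simp add: f_def[abs_def])
  have cont': "continuous_on K (\<lambda>x. f' a b x h)" for a b h
  proof -
    obtain r where r: "\<And>x. (f a b has_derivative r x) (at x)" "\<And>h. (\<lambda>x. r x h) \<in> pol UNIV (j + 2 + i - 1)"
      by (rule pol_has_derivative[OF polf[of a b] subspace_UNIV]) blast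
    have "r x = f' a b x" for x by (rule has_derivative_unique[OF r(1) deriv])
    then have "(\<lambda>x. f' a b x h) \<in> pol UNIV (j + 2 + i - 1)" using r(2)[of h] by simp
    then show ?thesis by (rule pol_continuous_on)
  qed
  have zero: "integral K (\<lambda>x. f' a b x (a - b)) = 0" if ab: "a \<in> C" "b \<in> C" for a b
  proof (cases "a = b")
    case True
    then show ?thesis
      using linear_0[OF has_derivative_linear[OF deriv[of b b]]] by simp
  next
    case False
    obtain q where q: "q \<in> pol UNIV j" "\<And>x. frame_coeff (P x) a b = \<phi> a x * \<phi> b x * q x"
      by (rule bubble_coeff[OF P(1) nf ab False]) blast
    show ?thesis
    proof (rule integral_edge_derivative[OF ab False _ polf _ deriv])
      show "(\<lambda>x. q x *\<^sub>R ((a - b) \<bullet> p x)) \<in> pol UNIV (j + (0 + i))"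
        by (rule pol_scaleR[OF q(1) pol_inner[OF pol_const p(1)]]) auto
      show "f a b x = \<phi> a x * \<phi> b x * (q x *\<^sub>R ((a - b) \<bullet> p x))" for x by (simp add: f_def q(2))
    qed
  qed
  have eq: "D x \<bullet> p x + P x \<bullet> E x = (\<Sum>a\<in>C. \<Sum>b\<in>C. - (1/2) * f' a b x (a - b))" for x
  proof -
    have "P x \<in> Sym" by (rule pol_value[OF subspace_Sym P(1)])
    from inner_decomposition[OF this]
    have "P x \<bullet> E x = (\<Sum>a\<in>C. \<Sum>b\<in>C. (- (1/2) * frame_coeff (P x) a b) * ((a - b) \<bullet> p' x (a - b)))"
      by (simp only: E(3))
    moreover have "D x \<bullet> p x = (\<Sum>a\<in>C. \<Sum>b\<in>C. (- (1/2) * frame_coeff (P' x (a - b)) a b) * ((a - b) \<bullet> p x))"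
      unfolding D(3) by (simp only: inner_sum_left inner_scaleR_left)
    ultimately have "D x \<bullet> p x + P x \<bullet> E x = (\<Sum>a\<in>C. \<Sum>b\<in>C.
        (- (1/2) * frame_coeff (P' x (a - b)) a b) * ((a - b) \<bullet> p x) +
        (- (1/2) * frame_coeff (P x) a b) * ((a - b) \<bullet> p' x (a - b)))"
      by (simp only: sum.distrib)
    also have "\<dots> = (\<Sum>a\<in>C. \<Sum>b\<in>C. - (1/2) * f' a b x (a - b))"
      unfolding f'_def by (intro sum.cong refl) algebra
    finally show ?thesis .
  qed
  have intD: "(\<lambda>x. D x \<bullet> p x) integrable_on K"
    by (rule integrable_on_compact[OF compact_K]) (intro continuous_intros pol_continuous_on[OF D(1)] pol_continuous_on[OF p(1)])
  have intE: "(\<lambda>x. P x \<bullet> E x) integrable_on K"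
    by (rule integrable_on_compact[OF compact_K]) (intro continuous_intros pol_continuous_on[OF P(1)] pol_continuous_on[OF E(1)])
  have int': "(\<lambda>x. - (1/2) * f' a b x (a - b)) integrable_on K" for a b
    by (rule integrable_on_compact[OF compact_K]) (intro continuous_intros cont')
  have "integral K (\<lambda>x. D x \<bullet> p x) + integral K (\<lambda>x. P x \<bullet> E x) = integral K (\<lambda>x. D x \<bullet> p x + P x \<bullet> E x)"
    by (rule integral_add[OF intD intE, symmetric])
  also have "\<dots> = (\<Sum>a\<in>C. \<Sum>b\<in>C. integral K (\<lambda>x. - (1/2) * f' a b x (a - b)))"
  proof -
    have 1: "(\<lambda>x. \<Sum>b\<in>C. - (1/2) * f' a b x (a - b)) integrable_on K" for a
      by (intro integrable_sum finite_vertices int')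
    have 2: "integral K (\<lambda>x. \<Sum>b\<in>C. - (1/2) * f' a b x (a - b)) =
        (\<Sum>b\<in>C. integral K (\<lambda>x. - (1/2) * f' a b x (a - b)))" for a
      by (rule integral_sum[OF finite_vertices int'])
    show ?thesis unfolding eq 2[symmetric] by (rule integral_sum[OF finite_vertices 1])
  qed
  also have "\<dots> = 0" by (intro sum.neutral ballI) (simp add: zero)
  finally have "integral K (\<lambda>x. D x \<bullet> p x) = - integral K (\<lambda>x. P x \<bullet> E x)" by simp
  moreover have "integral K (\<lambda>x. div_on K T x \<bullet> v x) = integral K (\<lambda>x. D x \<bullet> p x)"
    by (rule integral_cong) (simp add: P(2) p(2) D(2) zero_ext_in)
  moreover have "integral K (\<lambda>x. T x \<bullet> sym_grad_on K v x) = integral K (\<lambda>x. P x \<bullet> E x)"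
    by (rule integral_cong) (simp add: P(2) p(2) E(2) zero_ext_in)
  ultimately show ?thesis by simp
qed

end

section \<open>Dimension counts\<close>

lemma dim_Sym: "dim Sym = 6"
proof -
  let ?f = "\<lambda>A :: real^3^3. (vector [A$1$1, A$2$2, A$3$3], vector [A$1$2, A$1$3, A$2$3]) :: (real^3) \<times> (real^3)"
  have lin: "linear ?f" by (rule linearI) (simp_all add: vec_eq_iff forall_3)
  have "dim (?f ` Sym) = dim Sym"
  proof (rule dim_lin_image_eq[OF subspace_Sym finite_dim_euclidean linear_lin_on[OF lin]])
    fix A :: "real^3^3" assume A: "A \<in> Sym" "?f A = 0"
    have s: "A $ i $ j = A $ j $ i" for i j
    proof -
      have "transpose A $ i $ j = A $ i $ j" using A(1) by (simp add: symmetric_matrices_def)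
      then show ?thesis by (simp add: transpose_def)
    qed
    have "A $ i $ i = 0" "A $ 1 $ 2 = 0" "A $ 1 $ 3 = 0" "A $ 2 $ 3 = 0" for i
      using A(2) exhaust_3[of i] by (auto simp: vec_eq_iff forall_3 zero_prod_def)
    then show "A = 0" using s[of 2 1] s[of 3 1] s[of 3 2] by (simp add: vec_eq_iff forall_3)
  qed
  moreover have "?f ` Sym = UNIV"
  proof (rule subset_antisym[OF subset_UNIV subsetI])
    fix uw :: "(real^3) \<times> (real^3)"
    obtain u w where uw: "uw = (u, w)" by force
    let ?A = "vector [vector [u$1, w$1, w$2], vector [w$1, u$2, w$3], vector [w$2, w$3, u$3]] :: real^3^3"
    have "?A \<in> Sym" by (simp add: symmetric_matrices_def transpose_def vec_eq_iff forall_3)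
    moreover have "?f ?A = uw" by (simp add: uw vec_eq_iff forall_3)
    ultimately show "uw \<in> ?f ` Sym" by blast
  qed
  ultimately show ?thesis by simp
qed

lemma integral_inner_pol:
  fixes u :: "real^3 \<Rightarrow> 'v::euclidean_space"
  assumes K: "compact K" and u: "u \<in> zero_ext K ` pol X i" and v: "v \<in> zero_ext K ` pol Y j"
  shows "(\<lambda>x. u x \<bullet> v x) integrable_on K"
proof -
  obtain p q where p: "p \<in> pol X i" "u = zero_ext K p" and q: "q \<in> pol Y j" "v = zero_ext K q"
    using u v by blast
  have "(\<lambda>x. p x \<bullet> q x) integrable_on K"
    by (rule integrable_on_compact[OF K]) (intro continuous_intros pol_continuous_on[OF p(1)] pol_continuous_on[OF q(1)])
  then show ?thesis by (rule integrable_eq) (simp add: p q zero_ext_in)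
qed

lemma lin_on_integral_inner:
  fixes v :: "real^3 \<Rightarrow> 'v::euclidean_space"
  assumes K: "compact K" and v: "v \<in> zero_ext K ` pol Y j"
  shows "lin_on (zero_ext K ` pol X i) (\<lambda>u. integral K (\<lambda>x. u x \<bullet> v x))"
  unfolding lin_on_def
  using integral_inner_pol[OF K _ v] by (auto simp: inner_add_left integral_add)

lemma integral_inner_commute:
  fixes u v :: "real^3 \<Rightarrow> 'v::euclidean_space"
  shows "integral K (\<lambda>x. u x \<bullet> v x) = integral K (\<lambda>x. v x \<bullet> u x)"
  by (simp add: inner_commute)

lemma pol_id: "(\<lambda>x. x) \<in> pol UNIV (Suc 0)"
proof -
  have "(\<lambda>x :: 'a. \<Sum>b\<in>Basis. (b \<bullet> x + 0) *\<^sub>R b) \<in> pol UNIV (Suc 0)"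
    by (intro pol_sum subspace_UNIV pol_mult pol_const) auto
  then show ?thesis by (simp add: inner_commute[of _ "_ :: 'a"] euclidean_representation)
qed

context tetrahedron
begin

lemma dim_pol_K:
  fixes X :: "'v::euclidean_space set"
  shows "subspace X \<Longrightarrow> dim (zero_ext K ` pol X j) = dim X * ((j + 3) choose 3)"
  unfolding K_def by (rule dim_zero_ext_pol[OF indep]) (simp_all add: card_vertices)

section \<open>Infinitesimal rigid motions: the kernel of the symmetric gradient\<close>

lemma const_on_vertices_zero:
  assumes "\<And>c. c \<in> C \<Longrightarrow> u \<bullet> c = r"
  shows "u = 0"
proof -
  have "u = (\<Sum>c\<in>C. (u \<bullet> c) *\<^sub>R g c)" by (simp only: sum_vertex_grad)
  also have "\<dots> = (\<Sum>c\<in>C. r *\<^sub>R g c)" using assms by (intro sum.cong) auto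
  finally show ?thesis by (simp add: scaleR_sum_right[symmetric] sum_grad)
qed

text \<open>By the mean value theorem on the segment from y to x, the left side is (x - y)'
  \<epsilon>(p) (x - y) at an intermediate point. The kernel of \<epsilon> is thus identified
  without second derivatives.\<close>

lemma sym_grad_zero_inner:
  assumes p: "p \<in> pol UNIV j" and 0: "sym_grad_on K (zero_ext K p) = 0" and xy: "x \<in> K" "y \<in> K"
  shows "(p x - p y) \<bullet> (x - y) = 0"
proof -
  obtain p' where p': "\<And>x. (p has_derivative p' x) (at x)"
    by (rule pol_has_derivative[OF p subspace_UNIV]) blast
  obtain E where E: "sym_grad_on K (zero_ext K p) = zero_ext K E" "\<And>x s. s \<bullet> (E x *v s) = s \<bullet> p' x s"
    by (rule sym_grad_on_pol[OF p p']) blast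
  let ?l = "\<lambda>t. y + t *\<^sub>R (x - y)"
  have "((\<lambda>t. p (?l t) \<bullet> (x - y)) has_derivative (\<lambda>r. p' (?l t) (r *\<^sub>R (x - y)) \<bullet> (x - y))) (at t within {0..1})" for t
    by (rule bounded_linear.has_derivative[OF bounded_linear_inner_left],
        rule has_derivative_compose[OF _ p']) (auto intro!: derivative_eq_intros)
  then obtain t where t: "t \<in> {0..1}"
    "p (?l 1) \<bullet> (x - y) - p (?l 0) \<bullet> (x - y) = p' (?l t) ((1 - 0) *\<^sub>R (x - y)) \<bullet> (x - y)"
    using mvt_very_simple[of 0 1 "\<lambda>t. p (?l t) \<bullet> (x - y)" "\<lambda>t r. p' (?l t) (r *\<^sub>R (x - y)) \<bullet> (x - y)"] by auto
  have "(1 - t) *\<^sub>R y + t *\<^sub>R x \<in> K" using convexD[OF convex_K xy(2,1), of "1 - t" t] t(1) by simp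
  then have "?l t \<in> K" by (simp add: algebra_simps)
  then have "E (?l t) = 0" using 0 E(1) by (simp add: zero_ext_eq_0_iff)
  then have "(x - y) \<bullet> p' (?l t) (x - y) = 0" using E(2)[of "x - y" "?l t"] by simp
  moreover have "(p x - p y) \<bullet> (x - y) = p (?l 1) \<bullet> (x - y) - p (?l 0) \<bullet> (x - y)"
    by (simp add: inner_diff_left)
  ultimately show ?thesis unfolding t(2) by (simp add: inner_commute)
qed

text \<open>For 1 \<le> j these are the fields x \<mapsto> c + w \<times> x on K, for j = 0 only the
  constants.\<close>

definition rigid :: "nat \<Rightarrow> (real^3 \<Rightarrow> real^3) set" where
  "rigid j = {w \<in> zero_ext K ` pol UNIV j. sym_grad_on K w = 0}"

lemma subspace_rigid: "subspace (rigid j)"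
  unfolding rigid_def by (rule lin_on_kernel_subspace[OF subspace_zero_ext_pol[OF subspace_UNIV] lin_on_sym_grad])

lemma finite_dim_rigid: "finite_dim (rigid j)"
  by (rule finite_dim_subset[OF finite_dim_zero_ext_pol[OF subspace_UNIV]]) (auto simp: rigid_def)

lemma rigid_inner:
  assumes "w \<in> rigid j" "x \<in> K" "y \<in> K"
  shows "(w x - w y) \<bullet> (x - y) = 0"
proof -
  obtain p where p: "p \<in> pol UNIV j" "w = zero_ext K p" using assms(1) by (auto simp: rigid_def)
  have "sym_grad_on K (zero_ext K p) = 0" using assms(1) p(2) by (simp add: rigid_def)
  from sym_grad_zero_inner[OF p(1) this assms(2,3)] show ?thesis using assms(2,3) p(2) by (simp add: zero_ext_in)
qed

text \<open>Six of the twelve components of the values at the vertices suffice: \<open>rigid_inner\<close> gives one linear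
  relation for each edge.\<close>

lemma dim_rigid_le: "dim (rigid j) \<le> 6"
proof -
  obtain v0 v1 v2 v3 where C: "C = {v0, v1, v2, v3}"
    using card_vertices by (auto simp: numeral_eq_Suc card_Suc_eq)
  \<comment> \<open>All of \<open>w v0\<close>, two components of \<open>w v1\<close> and one of
    \<open>w v2\<close>. The edge relations supply the rest: one component at \<open>v1\<close>, two
    at \<open>v2\<close>, all three at \<open>v3\<close>.\<close>
  let ?f = "\<lambda>w :: real^3 \<Rightarrow> real^3. (w v0, vector [w v1 \<bullet> (v2 - v0), w v1 \<bullet> (v3 - v0), w v2 \<bullet> (v3 - v0)]) :: (real^3) \<times> (real^3)"
  have K: "v0 \<in> K" "v1 \<in> K" "v2 \<in> K" "v3 \<in> K" using vertex_in_K C by auto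
  have "dim (rigid j) \<le> dim (UNIV :: ((real^3) \<times> (real^3)) set)"
  proof (rule dim_le_injective[OF subspace_rigid finite_dim_rigid _ finite_dim_euclidean subset_UNIV])
    show "lin_on (rigid j) ?f"
      by (rule linear_lin_on, rule linearI) (simp_all add: vec_eq_iff forall_3 inner_add_left)
    fix w assume w: "w \<in> rigid j" and 0: "?f w = 0"
    have f: "w v0 = 0" "w v1 \<bullet> (v2 - v0) = 0" "w v1 \<bullet> (v3 - v0) = 0" "w v2 \<bullet> (v3 - v0) = 0"
      using 0 by (simp_all add: zero_prod_def vec_eq_iff forall_3)
    note r = rigid_inner[OF w]
    have 1: "w v1 = 0"
      by (rule const_on_vertices_zero[of _ "w v1 \<bullet> v0"])
        (use C f r[OF K(2,1)] in \<open>auto simp: inner_diff_right\<close>)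
    have 2: "w v2 = 0"
      by (rule const_on_vertices_zero[of _ "w v2 \<bullet> v0"])
        (use C f 1 r[OF K(3,1)] r[OF K(3,2)] in \<open>auto simp: inner_diff_right\<close>)
    have 3: "w v3 = 0"
      by (rule const_on_vertices_zero[of _ "w v3 \<bullet> v0"])
        (use C f 1 2 r[OF K(4,1)] r[OF K(4,2)] r[OF K(4,3)] in \<open>auto simp: inner_diff_right\<close>)
    \<comment> \<open>Any x in K is treated as a fifth point: w vanishes at the vertices, so w x is
      orthogonal to x - c for each vertex c.\<close>
    have "w x = 0" if x: "x \<in> K" for x
      by (rule const_on_vertices_zero[of _ "w x \<bullet> x"])
        (use C f 1 2 3 r[OF x K(1)] r[OF x K(2)] r[OF x K(3)] r[OF x K(4)] in \<open>auto simp: inner_diff_right\<close>)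
    then show "w = 0" using w by (auto simp: rigid_def zero_ext_eq_0_iff zero_ext_in)
  qed
  then show ?thesis by simp
qed

text \<open>The parameters (c, w) of x \<mapsto> c + w \<times> x are recovered from its values at
  the four vertices. The rotations have degree 1, hence 1 \<le> j.\<close>

lemma dim_rigid_ge:
  assumes "1 \<le> j" shows "6 \<le> dim (rigid j)"
proof -
  let ?L = "\<lambda>cw. zero_ext K (\<lambda>x. fst cw + cross3 (snd cw) x)"
  have lin_cross: "linear (cross3 w)" for w
    by (rule linearI) (auto simp: cross_add_right cross_mult_right)
  have "linear ?L"
    by (rule linearI) (auto simp: zero_ext_def fun_eq_iff cross_add_left cross_mult_left scaleR_add_right)
  then have "dim (?L ` UNIV) = dim (UNIV :: ((real^3) \<times> (real^3)) set)"
  proof (intro dim_lin_image_eq finite_dim_euclidean subspace_UNIV linear_lin_on)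
    fix cw :: "(real^3) \<times> (real^3)" assume "?L cw = 0"
    then have 0: "fst cw + cross3 (snd cw) x = 0" if "x \<in> K" for x using that by (simp add: zero_ext_eq_0_iff)
    have "cross3 (snd cw) h = 0" for h
    proof -
      have "cross3 (snd cw) h = cross3 (snd cw) (\<Sum>c\<in>C. (g c \<bullet> h) *\<^sub>R c)" by (simp only: sum_grad_vertex)
      also have "\<dots> = (\<Sum>c\<in>C. (g c \<bullet> h) *\<^sub>R cross3 (snd cw) c)"
        by (simp add: linear_sum[OF lin_cross] linear_scale[OF lin_cross])
      also have "\<dots> = (\<Sum>c\<in>C. (g c \<bullet> h) *\<^sub>R (- fst cw))"
      proof (rule sum.cong[OF refl])
        fix c assume "c \<in> C"
        then have "cross3 (snd cw) c = - fst cw" using 0[OF vertex_in_K] by (metis minus_unique)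
        then show "(g c \<bullet> h) *\<^sub>R cross3 (snd cw) c = (g c \<bullet> h) *\<^sub>R (- fst cw)" by (simp only:)
      qed
      finally show ?thesis by (simp only: scaleR_sum_left[symmetric] sum_grad_inner) simp
    qed
    \<comment> \<open>The product with the first axis exposes the second and third component, that
      with the second axis the first and third.\<close>
    from this[of "axis 1 1"] this[of "axis 2 1"] have "snd cw = 0"
      by (simp add: cross3_def vec_eq_iff forall_3 axis_def)
    then show "cw = 0" using 0 K_nonempty by (auto simp: zero_prod_def prod_eq_iff)
  qed
  moreover have "?L ` UNIV \<subseteq> rigid j"
  proof safe
    fix c w :: "real^3"
    let ?p = "\<lambda>x. c + cross3 w x"
    have p: "?p \<in> pol UNIV j"
      by (intro pol_add pol_const UNIV_I pol_mono[OF pol_linear[OF pol_id lin_cross]]) (use assms in auto)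
    have p': "(?p has_derivative cross3 w) (at x)" for x
      using has_derivative_add[OF has_derivative_const bounded_linear_imp_has_derivative, of "cross3 w" c "at x"] lin_cross
      by (simp add: linear_conv_bounded_linear)
    obtain E where E: "E \<in> pol Sym (j - 1)" "sym_grad_on K (zero_ext K ?p) = zero_ext K E"
      "\<And>x s. s \<bullet> (E x *v s) = s \<bullet> cross3 w s"
      by (rule sym_grad_on_pol[OF p p']) blast
    have "E x = 0" for x
      by (rule symmetric_zeroI[OF pol_value[OF subspace_Sym E(1)]]) (simp add: E(3) dot_cross_self)
    then show "?L (c, w) \<in> rigid j" unfolding rigid_def using p E(2) by (auto simp: zero_ext_eq_0_iff)
  qed
  ultimately show ?thesis using finite_dim_dim_mono[OF finite_dim_rigid, of "?L ` UNIV" j] by simp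
qed

lemma dim_sym_grad_image:
  assumes "1 \<le> k"
  shows "dim (sym_grad_on K ` V_space k K) + 6 = 3 * ((k + 3) choose 3)"
proof -
  have "dim (zero_ext K ` pol UNIV k :: (real^3 \<Rightarrow> real^3) set) =
      dim (rigid k) + dim (sym_grad_on K ` zero_ext K ` pol UNIV k)"
    unfolding rigid_def
    by (rule rank_nullity[OF subspace_zero_ext_pol[OF subspace_UNIV] finite_dim_zero_ext_pol[OF subspace_UNIV] lin_on_sym_grad])
  moreover have "dim (rigid k) = 6" using dim_rigid_le[of k] dim_rigid_ge[OF assms] by simp
  ultimately show ?thesis by (simp add: dim_pol_K[OF subspace_UNIV] V_space_def polys_UNIV)
qed

section \<open>Fields with vanishing normal component: edge bubbles and their divergences\<close>

definition M_tilde :: "nat \<Rightarrow> (real^3 \<Rightarrow> real^3^3) set" where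
  "M_tilde k = {T \<in> zero_ext K ` pol Sym (k + 3). normal_free T}"

lemma subspace_M_tilde: "subspace (M_tilde k)"
proof -
  have "M_tilde k = zero_ext K ` pol Sym (k + 3) \<inter> {T. normal_free T}"
    by (auto simp: M_tilde_def)
  moreover have "subspace {T. normal_free T}"
    by (rule subspaceI)
      (auto simp: normal_free_def matrix_vector_mult_add_rdistrib scaleR_matrix_vector_assoc[symmetric])
  ultimately show ?thesis
    using subspace_inter[OF subspace_zero_ext_pol[OF subspace_Sym]] by metis
qed

lemma finite_dim_M_tilde: "finite_dim (M_tilde k)"
  by (rule finite_dim_subset[OF finite_dim_zero_ext_pol[OF subspace_Sym]]) (auto simp: M_tilde_def)

lemma div_on_image:
  "div_on K ` zero_ext K ` pol Sym (Suc j) \<subseteq> zero_ext K ` pol UNIV j"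
proof safe
  fix P :: "real^3 \<Rightarrow> real^3^3" assume P: "P \<in> pol Sym (Suc j)"
  obtain P' where P': "\<And>x. (P has_derivative P' x) (at x)"
    by (rule pol_has_derivative[OF P subspace_Sym]) blast
  obtain D where "D \<in> pol UNIV (Suc j - 1)" "div_on K (zero_ext K P) = zero_ext K D"
    by (rule div_on_pol[OF P P']) blast
  then show "div_on K (zero_ext K P) \<in> zero_ext K ` pol UNIV j" by simp
qed

text \<open>On a facet that does not contain the edge, one of the two coordinates is zero. On a
  facet that contains it, a - b is tangential, so (a - b)(a - b)' annihilates the normal.\<close>

lemma edge_bubble_in_M_tilde:
  assumes ab: "a \<in> C" "b \<in> C" "a \<noteq> b" and q: "q \<in> pol UNIV (k + 1)"
  shows "zero_ext K (\<lambda>x. (\<phi> a x * \<phi> b x * q x) *\<^sub>R outer_square (a - b)) \<in> M_tilde k"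
proof -
  have "(\<lambda>x. q x *\<^sub>R outer_square (a - b)) \<in> pol Sym (k + 1)"
    using pol_scaleR[OF q pol_const[OF outer_square_symmetric, of _ 0] subspace_Sym] by simp
  from lam_pol[OF lam_pol[OF this], of C a C b]
  have "(\<lambda>x. (\<phi> a x * \<phi> b x * q x) *\<^sub>R outer_square (a - b)) \<in> pol Sym (k + 3)"
    by (simp add: numeral_3_eq_3 mult.assoc)
  moreover have "normal_free (\<lambda>x. (\<phi> a x * \<phi> b x * q x) *\<^sub>R outer_square (a - b))"
    unfolding normal_free_def
  proof (intro ballI)
    fix c x assume c: "c \<in> C" and x: "x \<in> facet c"
    then have "\<phi> c x = 0" using mem_facet by blast
    moreover have "(a - b) \<bullet> g c = 0" if "c \<noteq> a" "c \<noteq> b"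
      using grad_diff[OF ab(1,2) c] that by (simp add: inner_commute)
    ultimately show "((\<phi> a x * \<phi> b x * q x) *\<^sub>R outer_square (a - b)) *v g c = 0"
      by (cases "c = a \<or> c = b") (auto simp: scaleR_matrix_vector_assoc[symmetric] outer_square_vec)
  qed
  ultimately show ?thesis unfolding M_tilde_def using normal_free_zero_ext by blast
qed

text \<open>Testing with \<open>\<phi> a \<phi> b ((a - b)' \<epsilon>(v) (a - b)) (a - b)(a - b)'\<close> shows that every edge component of
  \<open>\<epsilon>(v)\<close> vanishes.\<close>

lemma div_M_tilde_orthogonal:
  assumes v: "v \<in> zero_ext K ` pol UNIV (k + 2)"
    and 0: "\<And>T. T \<in> M_tilde k \<Longrightarrow> integral K (\<lambda>x. div_on K T x \<bullet> v x) = 0"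
  shows "v \<in> rigid (k + 2)"
proof -
  obtain p where p: "p \<in> pol UNIV (k + 2)" "v = zero_ext K p" using v by blast
  obtain p' where p': "\<And>x. (p has_derivative p' x) (at x)"
    by (rule pol_has_derivative[OF p(1) subspace_UNIV]) blast
  obtain E where E: "E \<in> pol Sym (k + 2 - 1)" "sym_grad_on K (zero_ext K p) = zero_ext K E"
    by (rule sym_grad_on_pol[OF p(1) p']) blast
  have edge: "(a - b) \<bullet> (E x *v (a - b)) = 0" if ab: "a \<in> C" "b \<in> C" "a \<noteq> b" and x: "x \<in> K" for a b x
  proof -
    define q where "q y = outer_square (a - b) \<bullet> E y" for y
    have q: "q \<in> pol UNIV (k + 1)"
      using pol_linear[OF E(1) bounded_linear.linear[OF bounded_linear_inner_right[of "outer_square (a - b)"]] subset_UNIV]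
      by (simp add: q_def[abs_def])
    let ?P = "\<lambda>y. (\<phi> a y * \<phi> b y * q y) *\<^sub>R outer_square (a - b)"
    let ?T = "zero_ext K ?P"
    have T: "?T \<in> M_tilde k" by (rule edge_bubble_in_M_tilde[OF ab q])
    then have T': "?T \<in> zero_ext K ` pol Sym ((k + 1) + 2)" "normal_free ?T"
      by (auto simp: M_tilde_def numeral_3_eq_3)
    have "0 = - integral K (\<lambda>x. ?T x \<bullet> sym_grad_on K v x)"
      using integration_by_parts[OF T' v] 0[OF T] by simp
    also have "integral K (\<lambda>x. ?T x \<bullet> sym_grad_on K v x) = integral K (\<lambda>y. \<phi> a y * \<phi> b y * q y ^ 2)"
      by (rule integral_cong) (simp add: p(2) E(2) zero_ext_in q_def power2_eq_square)
    finally have int0: "integral K (\<lambda>y. \<phi> a y * \<phi> b y * q y ^ 2) = 0" by simp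
    have cont: "continuous_on K (\<lambda>y. \<phi> a y * \<phi> b y * q y ^ 2)"
      by (intro continuous_intros pol_continuous_on[OF lam_pol_1] pol_continuous_on[OF q])
    have "\<phi> a y * \<phi> b y * q y ^ 2 = 0" if "y \<in> K" for y
      by (rule integral_zero_convex[OF compact_K convex_K interior_K cont _ int0 that]) (use mem_K ab in auto)
    then have z: "\<phi> a y *\<^sub>R (\<phi> b y *\<^sub>R q y) = 0" if "y \<in> convex hull C" for y using that by (auto simp: K_def)
    have "\<phi> b y *\<^sub>R q y = 0" if "y \<in> convex hull C" for y
      by (rule lam_cancel[OF indep ab(1) order_refl lam_pol[OF q] z that])
    then have "q x = 0" using lam_cancel[OF indep ab(2) order_refl q, of x] x by (simp add: K_def)
    then show ?thesis by (simp add: q_def outer_square_inner)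
  qed
  have "E x = 0" if x: "x \<in> K" for x
    by (rule symmetric_zeroI[OF pol_value[OF subspace_Sym E(1)]]) (metis edge x cancel_comm_monoid_add_class.diff_cancel inner_zero_left)
  then show ?thesis using v p(2) E(2) by (simp add: rigid_def zero_ext_eq_0_iff)
qed

text \<open>The fields of P_(k+2) orthogonal to a basis of the divergences are rigid and form a
  space of dimension at most six, while each member of that basis costs at most one dimension. Here
  k + 5 is (k + 2) + 3.\<close>

lemma dim_div_M_tilde: "3 * ((k + 5) choose 3) \<le> 6 + dim (div_on K ` M_tilde k)"
proof -
  let ?V = "zero_ext K ` pol UNIV (k + 2) :: (real^3 \<Rightarrow> real^3) set" and ?W = "div_on K ` M_tilde k"
  let ?I = "\<lambda>w v. integral K (\<lambda>x. v x \<bullet> w x)"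
  have sub: "M_tilde k \<subseteq> zero_ext K ` pol Sym (Suc (k + 2))"
    by (auto simp: M_tilde_def numeral_3_eq_3)
  then have W: "?W \<subseteq> ?V" using div_on_image[of "k + 2"] by blast
  have V: "subspace ?V" "finite_dim ?V"
    by (rule subspace_zero_ext_pol[OF subspace_UNIV]) (rule finite_dim_zero_ext_pol[OF subspace_UNIV])
  obtain B where B: "B \<subseteq> ?W" "?W \<subseteq> span B" "finite B" "card B = dim ?W"
    by (rule finite_dim_basis[OF finite_dim_subset[OF V(2) W]])
  have lin: "lin_on ?V (?I w)" if "w \<in> ?V" for w
    by (rule lin_on_integral_inner[OF compact_K that])
  have 1: "dim ?V \<le> dim {v \<in> ?V. \<forall>w\<in>B. ?I w v = 0} + card B"
    by (rule dim_le_card_functionals[OF V B(3)]) (use lin B(1) W in blast)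
  have "{v \<in> ?V. \<forall>w\<in>B. ?I w v = 0} \<subseteq> rigid (k + 2)"
  proof
    fix v assume "v \<in> {v \<in> ?V. \<forall>w\<in>B. ?I w v = 0}"
    then have v: "v \<in> ?V" "\<forall>w\<in>B. ?I w v = 0" by simp_all
    have "subspace {w \<in> ?V. ?I v w = 0}" by (rule lin_on_kernel_subspace[OF V(1) lin[OF v(1)]])
    moreover have "B \<subseteq> {w \<in> ?V. ?I v w = 0}"
      using B(1) W v(2) integral_inner_commute[of K v] by auto
    ultimately have "span B \<subseteq> {w \<in> ?V. ?I v w = 0}" by (rule span_minimal[rotated])
    then show "v \<in> rigid (k + 2)" using div_M_tilde_orthogonal[OF v(1)] B(2) by blast
  qed
  then have "dim {v \<in> ?V. \<forall>w\<in>B. ?I w v = 0} \<le> 6"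
    using finite_dim_dim_mono[OF finite_dim_rigid] dim_rigid_le order_trans by blast
  moreover have "dim ?V = 3 * ((k + 5) choose 3)"
  proof -
    have "k + 2 + 3 = k + 5" by simp
    then show ?thesis
      using dim_pol_K[OF subspace_UNIV, where 'v = "real^3", of "k + 2"] by (simp only: dim_UNIV) simp
  qed
  ultimately show ?thesis using 1 B(4) by linarith
qed

text \<open>A function of the unordered pair, so that (a, b) and (b, a) yield one bubble. For a pair
  the double sum contains the outer square of a - b twice, whence the factor 1/2.\<close>

definition edge_square :: "(real^3) set \<Rightarrow> real^3^3" where
  "edge_square D = (1/2) *\<^sub>R (\<Sum>a\<in>D. \<Sum>b\<in>D. outer_square (a - b))"

lemma edge_square_pair: "a \<noteq> b \<Longrightarrow> edge_square {a, b} = outer_square (a - b)"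
proof -
  assume "a \<noteq> b"
  moreover have "outer_square 0 = 0" by (simp add: outer_square_def vec_eq_iff)
  moreover have "outer_square (b - a) = outer_square (a - b)" using outer_square_minus[of "a - b"] by simp
  ultimately show ?thesis by (simp add: edge_square_def scaleR_2[symmetric])
qed

definition edge_bubble :: "(real^3) set \<Rightarrow> (real^3 \<Rightarrow> real) \<Rightarrow> real^3 \<Rightarrow> real^3^3" where
  "edge_bubble D q = (\<lambda>x. ((\<Prod>c\<in>D. \<phi> c x) * q x) *\<^sub>R edge_square D)"

lemma linear_edge_bubble: "linear (edge_bubble D)"
  by (rule linearI) (auto simp: edge_bubble_def fun_eq_iff distrib_left scaleR_add_left)

text \<open>\<open>symmetric_decomposition\<close> is applied pointwise, with
  \<open>bubble_coeff\<close> for each off-diagonal coefficient; the terms with a = b carry the zero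
  matrix. Extending the factors by zero makes them elements of a space of known dimension.\<close>

lemma M_tilde_sum_bubbles:
  assumes T: "T \<in> M_tilde k"
  obtains q where "\<And>a b. q a b \<in> pol (UNIV :: real set) (k + 1)"
    "T = (\<Sum>a\<in>C. \<Sum>b\<in>C. (if a = b then 0 else (- (1/2)) *\<^sub>R edge_bubble {a, b} (zero_ext K (q a b))))"
proof -
  obtain P where P: "P \<in> pol Sym (k + 1 + 2)" "T = zero_ext K P"
    using T by (auto simp: M_tilde_def numeral_3_eq_3)
  have nf: "normal_free P" using T P(2) normal_free_zero_ext by (simp add: M_tilde_def)
  have "\<exists>q\<in>pol UNIV (k + 1). a \<in> C \<longrightarrow> b \<in> C \<longrightarrow> a \<noteq> b \<longrightarrow> (\<forall>x. frame_coeff (P x) a b = \<phi> a x * \<phi> b x * q x)" for a b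
  proof (cases "a \<in> C \<and> b \<in> C \<and> a \<noteq> b")
    case True
    then obtain q where "q \<in> pol UNIV (k + 1)" "\<And>x. frame_coeff (P x) a b = \<phi> a x * \<phi> b x * q x"
      using bubble_coeff[OF P(1) nf, of a b] by blast
    then show ?thesis by blast
  next
    case False
    then show ?thesis using pol_const[of 0 "UNIV :: real set" "k + 1"] by blast
  qed
  then obtain q where q: "\<And>a b. q a b \<in> pol UNIV (k + 1)"
    "\<And>a b x. a \<in> C \<Longrightarrow> b \<in> C \<Longrightarrow> a \<noteq> b \<Longrightarrow> frame_coeff (P x) a b = \<phi> a x * \<phi> b x * q a b x"
    by metis
  let ?S = "\<lambda>a b. (if a = b then 0 else (- (1/2)) *\<^sub>R edge_bubble {a, b} (zero_ext K (q a b)))"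
  have "T x = (\<Sum>a\<in>C. \<Sum>b\<in>C. ?S a b) x" for x
  proof (cases "x \<in> K")
    case True
    have "(- (1/2) * frame_coeff (P x) a b) *\<^sub>R outer_square (a - b) = ?S a b x" if "a \<in> C" "b \<in> C" for a b
    proof (cases "a = b")
      case True
      then show ?thesis by (simp add: outer_square_def vec_eq_iff)
    next
      case False
      then show ?thesis using q(2)[OF that False] True
        by (simp add: edge_bubble_def edge_square_pair zero_ext_in)
    qed
    then have "(\<Sum>a\<in>C. \<Sum>b\<in>C. (- (1/2) * frame_coeff (P x) a b) *\<^sub>R outer_square (a - b)) = (\<Sum>a\<in>C. \<Sum>b\<in>C. ?S a b x)"
      by (intro sum.cong refl) blast
    moreover have "P x = (\<Sum>a\<in>C. \<Sum>b\<in>C. (- (1/2) * frame_coeff (P x) a b) *\<^sub>R outer_square (a - b))"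
      by (rule symmetric_decomposition[OF pol_value[OF subspace_Sym P(1)]])
    ultimately show ?thesis using True by (simp add: P(2) zero_ext_in sum_fun_apply)
  next
    case False
    have "?S a b x = 0" for a b using False by (simp add: edge_bubble_def zero_ext_def)
    then show ?thesis using False by (simp add: P(2) zero_ext_def sum_fun_apply)
  qed
  then have "T = (\<Sum>a\<in>C. \<Sum>b\<in>C. ?S a b)" by (rule ext)
  then show ?thesis using that q(1) by blast
qed

lemma card_vertex_pairs: "finite {D. D \<subseteq> C \<and> card D = 2}" "card {D. D \<subseteq> C \<and> card D = 2} = 6"
proof -
  show "finite {D. D \<subseteq> C \<and> card D = 2}" using finite_vertices by simp
  have "card {D. D \<subseteq> C \<and> card D = 2} = 4 choose 2" using n_subsets[OF finite_vertices, of 2] card_vertices by simp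
  then show "card {D. D \<subseteq> C \<and> card D = 2} = 6" by (simp add: choose_two)
qed

lemma card_UN_le_mult:
  assumes "finite I" "\<And>i. i \<in> I \<Longrightarrow> card (A i) \<le> n"
  shows "card (\<Union>i\<in>I. A i) \<le> card I * n"
  by (rule order_trans[OF card_UN_le[OF assms(1)]]) (use sum_bounded_above[of I "\<lambda>i. card (A i)" n] assms in simp)

text \<open>Six edges, each carrying one copy of P_(k+1): both orders of a pair contribute to the
  same bubbles. A spanning set is enough for an upper bound.\<close>

lemma dim_M_tilde: "dim (M_tilde k) \<le> 6 * ((k + 4) choose 3)"
proof -
  let ?Q = "zero_ext K ` pol UNIV (k + 1) :: (real^3 \<Rightarrow> real) set"
  let ?E = "{D. D \<subseteq> C \<and> card D = 2}"
  obtain B where B: "B \<subseteq> ?Q" "?Q \<subseteq> span B" "finite B" "card B = dim ?Q"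
    by (rule finite_dim_basis[OF finite_dim_zero_ext_pol[OF subspace_UNIV]])
  let ?S = "\<Union>D\<in>?E. edge_bubble D ` B"
  have cardB: "card B = (k + 4) choose 3"
  proof -
    have "k + 1 + 3 = k + 4" by simp
    then show ?thesis unfolding B(4) using dim_pol_K[OF subspace_UNIV, where 'v = real, of "k + 1"]
      by (simp add: add.commute)
  qed
  have "M_tilde k \<subseteq> span ?S"
  proof
    fix T assume "T \<in> M_tilde k"
    then obtain q where q: "\<And>a b. q a b \<in> pol (UNIV :: real set) (k + 1)"
      "T = (\<Sum>a\<in>C. \<Sum>b\<in>C. (if a = b then 0 else (- (1/2)) *\<^sub>R edge_bubble {a, b} (zero_ext K (q a b))))"
      by (rule M_tilde_sum_bubbles) blast
    have "edge_bubble {a, b} (zero_ext K (q a b)) \<in> span ?S" if "a \<in> C" "b \<in> C" "a \<noteq> b" for a b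
    proof -
      have "zero_ext K (q a b) \<in> span B" using q(1) B(2) by blast
      then have "edge_bubble {a, b} (zero_ext K (q a b)) \<in> span (edge_bubble {a, b} ` B)"
        unfolding linear_span_image[OF linear_edge_bubble] by (rule imageI)
      moreover have "span (edge_bubble {a, b} ` B) \<subseteq> span ?S"
        by (rule span_mono, rule UN_upper[of "{a, b}" ?E "\<lambda>D. edge_bubble D ` B"]) (use that in simp)
      ultimately show ?thesis by blast
    qed
    then have "(if a = b then 0 else (- (1/2)) *\<^sub>R edge_bubble {a, b} (zero_ext K (q a b))) \<in> span ?S"
      if "a \<in> C" "b \<in> C" for a b
      by (cases "a = b") (use that in \<open>auto simp del: scaleR_minus_left intro!: span_zero span_scale\<close>)
    then show "T \<in> span ?S" unfolding q(2) by (intro span_sum)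
  qed
  moreover have "finite ?S" using B(3) card_vertex_pairs(1) by blast
  ultimately have "dim (M_tilde k) \<le> card ?S" by (rule dim_le_card)
  also have "\<dots> \<le> card ?E * card B"
    by (rule card_UN_le_mult[OF card_vertex_pairs(1)]) (rule card_image_le[OF B(3)])
  finally show ?thesis using card_vertex_pairs(2) cardB by simp
qed

lemma M_space_eq: "M_space (k + 3) K = {T \<in> M_tilde k. div_on K T = 0}"
proof -
  have "div_on K T x = 0" if "x \<notin> K" for T x using that by (simp add: div_on_def zero_ext_def)
  then have "(\<forall>x\<in>K. div_on K T x = 0) \<longleftrightarrow> div_on K T = 0" for T by (auto simp: fun_eq_iff)
  then show ?thesis
    unfolding M_space_def polys_symmetric normal_vanish_iff M_tilde_def normal_free_def by auto
qed

text \<open>\<open>M_space\<close> is the kernel of the divergence on \<open>M_tilde\<close>, so an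
  upper bound for the domain and a lower bound for the image combine. Written as a sum, because
  subtraction of naturals truncates.\<close>

lemma dim_M_space: "dim (M_space (k + 3) K) + 3 * ((k + 5) choose 3) \<le> 6 * ((k + 4) choose 3) + 6"
proof -
  have "lin_on (M_tilde k) (div_on K)"
    by (rule lin_on_subset[OF lin_on_div[of "k + 3"]]) (auto simp: M_tilde_def)
  from rank_nullity[OF subspace_M_tilde finite_dim_M_tilde this]
  have "dim (M_tilde k) = dim (M_space (k + 3) K) + dim (div_on K ` M_tilde k)" by (simp only: M_space_eq)
  then show ?thesis using dim_M_tilde[of k] dim_div_M_tilde[of k] by linarith
qed

section \<open>The space \<Sigma>_K and its dimension from below\<close>

lemma Sigma_space_eq:
  "Sigma_space k K = {T \<in> zero_ext K ` pol Sym (k + 3). div_on K T \<in> zero_ext K ` pol UNIV k}"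
  unfolding Sigma_space_def polys_symmetric polys_UNIV ..

lemma subspace_Sigma_space: "subspace (Sigma_space k K)"
proof -
  let ?P = "zero_ext K ` pol Sym (k + 3) :: (real^3 \<Rightarrow> real^3^3) set"
  let ?V = "zero_ext K ` pol UNIV k :: (real^3 \<Rightarrow> real^3) set"
  have P: "subspace ?P" by (rule subspace_zero_ext_pol[OF subspace_Sym])
  have V: "subspace ?V" by (rule subspace_zero_ext_pol[OF subspace_UNIV])
  note lin = lin_on_div[of "k + 3"]
  show ?thesis unfolding Sigma_space_eq
  proof (rule subspaceI)
    show "0 \<in> {T \<in> ?P. div_on K T \<in> ?V}"
      using subspace_0[OF P] subspace_0[OF V] lin_on_zero[OF P lin] by simp
    show "S + T \<in> {T \<in> ?P. div_on K T \<in> ?V}" if "S \<in> {T \<in> ?P. div_on K T \<in> ?V}" "T \<in> {T \<in> ?P. div_on K T \<in> ?V}" for S T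
    proof -
      have "div_on K (S + T) = div_on K S + div_on K T" using that lin unfolding lin_on_def by blast
      then show ?thesis using that subspace_add[OF P] subspace_add[OF V] by simp
    qed
    show "c *\<^sub>R T \<in> {T \<in> ?P. div_on K T \<in> ?V}" if "T \<in> {T \<in> ?P. div_on K T \<in> ?V}" for c T
    proof -
      have "div_on K (c *\<^sub>R T) = c *\<^sub>R div_on K T" using that lin unfolding lin_on_def by blast
      then show ?thesis using that subspace_scale[OF P] subspace_scale[OF V] by simp
    qed
  qed
qed

lemma finite_dim_Sigma_space: "finite_dim (Sigma_space k K)"
  by (rule finite_dim_subset[OF finite_dim_zero_ext_pol[OF subspace_Sym]]) (auto simp: Sigma_space_eq)

text \<open>A diagonal field does it: its i-th entry is an antiderivative of v_i along the i-th
  axis, so row i has divergence v_i. The degree rises only to k + 1, within the k + 3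
  allowed.\<close>

lemma div_surjective:
  assumes v: "v \<in> pol (UNIV :: (real^3) set) k"
  obtains T where "T \<in> pol Sym (Suc k)" "div_on K (zero_ext K T) = zero_ext K v"
proof -
  have "\<exists>p\<in>pol (UNIV :: real set) (Suc k). \<forall>x F. (p has_derivative F) (at x) \<longrightarrow> F (axis i 1) = v x $ i" for i
  proof -
    have "(\<lambda>x. v x $ i) \<in> pol UNIV k"
      by (rule pol_linear[OF v]) (auto intro: bounded_linear.linear bounded_linear_vec_nth)
    then show ?thesis
      by (rule pol_antiderivative[OF _ subspace_UNIV, of _ k "axis i 1"]) (auto simp: inner_axis_axis)
  qed
  then obtain p where p: "\<And>i. p i \<in> pol (UNIV :: real set) (Suc k)"
    "\<And>i x F. (p i has_derivative F) (at x) \<Longrightarrow> F (axis i 1) = v x $ i" by metis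
  define T where "T x = (\<Sum>l\<in>UNIV. p l x *\<^sub>R (\<chi> i j. if i = l \<and> j = l then 1 else 0 :: real^3^3))" for x
  have T_nth: "T x $ i $ j = (if i = j then p i x else 0)" for x i j
  proof -
    have "T x $ i $ j = (\<Sum>l\<in>UNIV. if l = i then (if i = j then p i x else 0) else 0)"
      unfolding T_def sum_component by (rule sum.cong) auto
    then show ?thesis by simp
  qed
  have T: "T \<in> pol Sym (Suc k)" unfolding T_def[abs_def]
  proof (intro pol_sum subspace_Sym)
    fix l :: 3
    have "(\<chi> i j. if i = l \<and> j = l then 1 else 0 :: real^3^3) \<in> Sym"
      by (auto simp: symmetric_matrices_def transpose_def vec_eq_iff)
    from pol_scaleR[OF p(1) pol_const[OF this, of 0] subspace_Sym]
    show "(\<lambda>x. p l x *\<^sub>R (\<chi> i j. if i = l \<and> j = l then 1 else 0)) \<in> pol Sym (Suc k)" by simp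
  qed
  obtain T' where T': "\<And>x. (T has_derivative T' x) (at x)"
    by (rule pol_has_derivative[OF T subspace_Sym]) blast
  have comp: "((\<lambda>x. T x $ i $ j) has_derivative (\<lambda>h. T' x h $ i $ j)) (at x)" for i j x
    by (rule bounded_linear.has_derivative[OF bounded_linear_vec_nth bounded_linear.has_derivative[OF bounded_linear_vec_nth T']])
  have off: "T' x h $ i $ j = 0" if "i \<noteq> j" for x h i j
  proof -
    have "((\<lambda>x :: real^3. 0 :: real) has_derivative (\<lambda>h. T' x h $ i $ j)) (at x)"
      using comp[of i j x] that by (simp add: T_nth)
    from has_derivative_unique[OF this has_derivative_const] show ?thesis by metis
  qed
  have diag: "T' x (axis i 1) $ i $ i = v x $ i" for x i
    using comp[of i i x] by (intro p(2)) (simp add: T_nth)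
  have "div_on K (zero_ext K T) = zero_ext K v"
  proof
    fix x
    show "div_on K (zero_ext K T) x = zero_ext K v x"
    proof (cases "x \<in> K")
      case True
      have "(\<Sum>j\<in>UNIV. T' x (axis j 1) $ i $ j) = (\<Sum>j\<in>UNIV. if j = i then v x $ i else 0)" for i
        by (rule sum.cong) (auto simp: off diag)
      then show ?thesis using True
        by (simp add: div_on_zero_ext[OF convex_K interior_K True T'] zero_ext_in vec_eq_iff)
    qed (simp add: div_on_def zero_ext_def)
  qed
  then show ?thesis using that T by blast
qed

text \<open>The divergence has the same kernel on \<open>Sigma_space\<close> as on all symmetric
  fields of degree k + 3. On the former its image is all of P_k, on the latter it lies in P_(k+2);
  comparing the two rank formulas gives the bound.\<close>

lemma dim_Sigma_space_ge:
  "6 * ((k + 6) choose 3) + 3 * ((k + 3) choose 3) \<le> dim (Sigma_space k K) + 3 * ((k + 5) choose 3)"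
proof -
  let ?P = "zero_ext K ` pol Sym (k + 3) :: (real^3 \<Rightarrow> real^3^3) set"
  let ?V = "\<lambda>j. zero_ext K ` pol UNIV j :: (real^3 \<Rightarrow> real^3) set"
  have P: "subspace ?P" "finite_dim ?P"
    by (rule subspace_zero_ext_pol[OF subspace_Sym], rule finite_dim_zero_ext_pol[OF subspace_Sym])
  note lin = lin_on_div[of "k + 3"]
  have fd: "finite_dim (?V j)" for j by (rule finite_dim_zero_ext_pol[OF subspace_UNIV])
  have sub: "Sigma_space k K \<subseteq> ?P" by (auto simp: Sigma_space_eq)
  have kernel: "{T \<in> Sigma_space k K. div_on K T = 0} = {T \<in> ?P. div_on K T = 0}"
    using subspace_0[OF subspace_zero_ext_pol[OF subspace_UNIV]] by (auto simp: Sigma_space_eq)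
  have range: "div_on K ` Sigma_space k K = ?V k"
  proof
    show "div_on K ` Sigma_space k K \<subseteq> ?V k" by (auto simp: Sigma_space_eq)
    show "?V k \<subseteq> div_on K ` Sigma_space k K"
    proof
      fix w assume "w \<in> ?V k"
      then obtain v where v: "v \<in> pol UNIV k" "w = zero_ext K v" by blast
      obtain T where T: "T \<in> pol Sym (Suc k)" "div_on K (zero_ext K T) = zero_ext K v"
        by (rule div_surjective[OF v(1)])
      have "T \<in> pol Sym (k + 3)" using T(1) by (rule pol_mono) simp
      then have "zero_ext K T \<in> Sigma_space k K" using T(2) v by (auto simp: Sigma_space_eq)
      then show "w \<in> div_on K ` Sigma_space k K" using T(2) v(2) by (metis image_eqI)
    qed
  qed
  have "dim ?P = dim {T \<in> ?P. div_on K T = 0} + dim (div_on K ` ?P)" by (rule rank_nullity[OF P lin])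
  moreover have "dim (div_on K ` ?P) \<le> dim (?V (k + 2))"
    by (rule finite_dim_dim_mono[OF fd]) (use div_on_image[of "k + 2"] in \<open>simp add: numeral_3_eq_3\<close>)
  moreover have "dim (Sigma_space k K) = dim {T \<in> ?P. div_on K T = 0} + dim (?V k)"
    using rank_nullity[OF subspace_Sigma_space finite_dim_Sigma_space lin_on_subset[OF lin sub]]
    unfolding kernel range .
  moreover have "dim ?P = 6 * ((k + 6) choose 3)"
  proof -
    have "k + 3 + 3 = k + 6" by simp
    then show ?thesis using dim_pol_K[OF subspace_Sym, of "k + 3"] by (simp only: dim_Sym)
  qed
  moreover have "dim (?V (k + 2)) = 3 * ((k + 5) choose 3)"
  proof -
    have "k + 2 + 3 = k + 5" by simp
    then show ?thesis using dim_pol_K[OF subspace_UNIV, where 'v = "real^3", of "k + 2"] by (simp only: dim_UNIV) simp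
  qed
  moreover have "dim (?V k) = 3 * ((k + 3) choose 3)"
    using dim_pol_K[OF subspace_UNIV, where 'v = "real^3", of k] by simp
  ultimately show ?thesis by linarith
qed

end

section \<open>Moments over edges and faces\<close>

text \<open>The common interface of edge and face integrals: linearity on continuous functions,
  dependence on the values on D alone, and definiteness. The moment argument uses nothing else about
  arc length or area.\<close>

definition integral_like :: "(real^3) set \<Rightarrow> ((real^3 \<Rightarrow> real) \<Rightarrow> real) \<Rightarrow> bool" where
  "integral_like D J \<longleftrightarrow>
     (\<forall>f h. continuous_on D f \<longrightarrow> continuous_on D h \<longrightarrow> J (\<lambda>x. f x + h x) = J f + J h) \<and>
     (\<forall>c f. continuous_on D f \<longrightarrow> J (\<lambda>x. c * f x) = c * J f) \<and>
     (\<forall>f h. (\<forall>x\<in>D. f x = h x) \<longrightarrow> J f = J h) \<and>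
     (\<forall>f. continuous_on D f \<longrightarrow> (\<forall>x\<in>D. 0 \<le> f x) \<longrightarrow> J f = 0 \<longrightarrow> (\<forall>x\<in>D. f x = 0))"

lemma integral_like_add:
  "integral_like D J \<Longrightarrow> continuous_on D f \<Longrightarrow> continuous_on D h \<Longrightarrow> J (\<lambda>x. f x + h x) = J f + J h"
  by (simp add: integral_like_def)

lemma integral_like_mult:
  "integral_like D J \<Longrightarrow> continuous_on D f \<Longrightarrow> J (\<lambda>x. c * f x) = c * J f"
  by (simp add: integral_like_def)

lemma integral_like_cong:
  assumes "integral_like D J" "\<And>x. x \<in> D \<Longrightarrow> f x = h x"
  shows "J f = J h"
proof -
  have "\<forall>f h. (\<forall>x\<in>D. f x = h x) \<longrightarrow> J f = J h"
    using assms(1) unfolding integral_like_def by (elim conjE)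
  from spec[OF spec[OF this, of f], of h] show ?thesis using assms(2) by simp
qed

lemma integral_like_zero:
  assumes "integral_like D J" "continuous_on D f" "\<And>x. x \<in> D \<Longrightarrow> 0 \<le> f x" "J f = 0" "x \<in> D"
  shows "f x = 0"
proof -
  have "\<forall>f. continuous_on D f \<longrightarrow> (\<forall>x\<in>D. 0 \<le> f x) \<longrightarrow> J f = 0 \<longrightarrow> (\<forall>x\<in>D. f x = 0)"
    using assms(1) unfolding integral_like_def by (elim conjE)
  from spec[OF this, of f] show ?thesis using assms(2-5) by simp
qed

lemma integral_like_parametrized:
  fixes S :: "'a::euclidean_space set"
  assumes S: "compact S" "convex S" "interior S \<noteq> {}" and \<psi>: "continuous_on S \<psi>" "\<psi> ` S = D" and r: "r \<noteq> 0"
    and J: "\<And>f. J f = r * integral S (\<lambda>s. f (\<psi> s))"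
  shows "integral_like D J"
proof -
  have c: "continuous_on S (\<lambda>s. f (\<psi> s))" if "continuous_on D f" for f :: "real^3 \<Rightarrow> real"
    using continuous_on_compose2[OF that \<psi>(1)] \<psi>(2) by simp
  have i: "(\<lambda>s. f (\<psi> s)) integrable_on S" if "continuous_on D f" for f :: "real^3 \<Rightarrow> real"
    by (rule integrable_on_compact[OF S(1) c[OF that]])
  show ?thesis unfolding integral_like_def
  proof (intro conjI allI impI ballI)
    fix f h :: "real^3 \<Rightarrow> real" assume "continuous_on D f" "continuous_on D h"
    then show "J (\<lambda>x. f x + h x) = J f + J h" by (simp add: J integral_add[OF i i] distrib_left)
  next
    fix c and f :: "real^3 \<Rightarrow> real" assume "continuous_on D f"
    then show "J (\<lambda>x. c * f x) = c * J f" by (simp add: J)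
  next
    fix f h :: "real^3 \<Rightarrow> real" assume "\<forall>x\<in>D. f x = h x"
    then have "integral S (\<lambda>s. f (\<psi> s)) = integral S (\<lambda>s. h (\<psi> s))"
      by (intro integral_cong) (use \<psi>(2) in blast)
    then show "J f = J h" by (simp add: J)
  next
    fix f x assume f: "continuous_on D f" "\<forall>x\<in>D. 0 \<le> f x" "J f = 0" and x: "x \<in> D"
    obtain s where s: "s \<in> S" "x = \<psi> s" using x \<psi>(2) by blast
    have "f (\<psi> s) = 0"
      by (rule integral_zero_convex[OF S c[OF f(1)] _ _ s(1)]) (use f(2,3) \<psi>(2) r in \<open>auto simp: J\<close>)
    then show "f x = 0" using s by simp
  qed
qed

lemma affine_dependent_3_cross:
  assumes "\<not> affine_dependent {a, b, c}" "a \<noteq> b" "b \<noteq> c" "a \<noteq> c"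
  shows "cross3 (b - a) (c - a) \<noteq> 0"
proof
  assume "cross3 (b - a) (c - a) = 0"
  then have "collinear {0, b - a, c - a}" by (simp add: cross_eq_0)
  then have "collinear {a, b, c}"
    using collinear_3[of b a c] by (simp add: insert_commute)
  then show False using assms by (simp add: affine_dependent_imp_collinear_3 collinear_3_eq_affine_dependent)
qed

lemma edge_integral_like:
  assumes "u \<noteq> v"
  shows "integral_like (convex hull {u, v}) (edge_integral (convex hull {u, v}))"
proof -
  let ?e = "convex hull {u, v}"
  define p where "p = (SOME p. ?e = convex hull {fst p, snd p})"
  have "\<exists>p. ?e = convex hull {fst p, snd p}" by (rule exI[of _ "(u, v)"]) simp
  then have p: "?e = convex hull {fst p, snd p}" unfolding p_def by (rule someI_ex)
  obtain a b where ab: "p = (a, b)" by force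
  \<comment> \<open>The chosen pair (a, b) need not be (u, v), but both consist of the extreme
    points of the segment. Hence a \<noteq> b, and the scale factor is not 0.\<close>
  have "{x. x extreme_point_of ?e} = {u, v}"
    using extreme_point_of_convex_hull_affine_independent[of "{u, v}"] by auto
  moreover have "{x. x extreme_point_of ?e} = {a, b}"
    using extreme_point_of_convex_hull_affine_independent[of "{a, b}"] p ab by auto
  ultimately have "a \<noteq> b" using assms by auto
  show ?thesis
  proof (rule integral_like_parametrized[of "{0..1::real}" "\<lambda>t. a + t *\<^sub>R (b - a)" _ "norm (b - a)"])
    show "(\<lambda>t. a + t *\<^sub>R (b - a)) ` {0..1} = ?e"
    proof -
      have "(\<lambda>t. a + t *\<^sub>R (b - a)) = (\<lambda>t. (1 - t) *\<^sub>R a + t *\<^sub>R b)" by (auto simp: algebra_simps)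
      then show ?thesis
        using p ab by (simp only: segment_convex_hull[symmetric] closed_segment_image_interval fst_conv snd_conv)
    qed
    show "edge_integral ?e f = norm (b - a) * integral {0..1} (\<lambda>t. f (a + t *\<^sub>R (b - a)))" for f
      using ab by (simp add: edge_integral_def p_def[symmetric])
  qed (use \<open>a \<noteq> b\<close> in \<open>auto intro!: continuous_intros\<close>)
qed

lemma unit_triangle: 
  defines "S \<equiv> {(t, u). 0 \<le> t \<and> 0 \<le> u \<and> t + u \<le> (1::real)}"
  shows "compact S" "convex S" "interior S \<noteq> {}"
proof -
  have S: "S = {x. 0 \<le> fst x} \<inter> {x. 0 \<le> snd x} \<inter> {x. fst x + snd x \<le> 1}" by (auto simp: S_def)
  have "closed S" unfolding S by (intro closed_Int closed_Collect_le continuous_intros)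
  moreover have "S \<subseteq> cbox (0, 0) (1, 1)" by (auto simp: S_def)
  then have "bounded S" using bounded_cbox bounded_subset by blast
  ultimately show "compact S" by (simp add: compact_eq_bounded_closed)
  show "convex S"
  proof (rule convexI)
    fix x y :: "real \<times> real" and a b :: real
    assume x: "x \<in> S" and y: "y \<in> S" and ab: "0 \<le> a" "0 \<le> b" "a + b = 1"
    have "a * (fst x + snd x) + b * (fst y + snd y) \<le> a * 1 + b * 1"
      using x y ab unfolding S by (intro add_mono mult_left_mono) auto
    then have "a * fst x + b * fst y + (a * snd x + b * snd y) \<le> 1" using ab by (simp add: algebra_simps)
    then show "a *\<^sub>R x + b *\<^sub>R y \<in> S" using x y ab unfolding S by simp
  qed
  let ?U = "{x :: real \<times> real. 0 < fst x} \<inter> {x. 0 < snd x} \<inter> {x. fst x + snd x < 1}"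
  have "open ?U" by (intro open_Int open_Collect_less continuous_intros)
  moreover have "?U \<subseteq> S" by (auto simp: S_def)
  ultimately have "?U \<subseteq> interior S" by (rule interior_maximal[rotated])
  moreover have "(1/4, 1/4) \<in> ?U" by simp
  ultimately show "interior S \<noteq> {}" by blast
qed

lemma face_integral_like:
  assumes F: "\<not> affine_dependent F" "card F = 3"
  shows "integral_like (convex hull F) (face_integral (convex hull F))"
proof -
  let ?f = "convex hull F"
  let ?S = "{(t, u). 0 \<le> t \<and> 0 \<le> u \<and> t + u \<le> (1::real)}"
  define p where "p = (SOME p. ?f = convex hull {fst p, fst (snd p), snd (snd p)})"
  obtain u v w where "F = {u, v, w}" using F(2) card_3_iff by metis
  then have "\<exists>p. ?f = convex hull {fst p, fst (snd p), snd (snd p)}" by (intro exI[of _ "(u, v, w)"]) simp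
  then have p: "?f = convex hull {fst p, fst (snd p), snd (snd p)}" unfolding p_def by (rule someI_ex)
  obtain a b c where abc: "p = (a, b, c)" using prod_cases3 by blast
  \<comment> \<open>The points of F are extreme in the hull, hence among the chosen a, b, c;
    counting gives equality, so the chosen triangle is nondegenerate.\<close>
  have "F \<subseteq> {a, b, c}"
  proof
    fix x assume "x \<in> F"
    then have "x extreme_point_of ?f" using extreme_point_of_convex_hull_affine_independent[OF F(1)] by blast
    then show "x \<in> {a, b, c}" using extreme_point_of_convex_hull p abc by (metis fst_conv snd_conv)
  qed
  moreover have "card {a, b, c} \<le> 3" by (simp add: card_insert_if)
  ultimately have F_eq: "F = {a, b, c}" using F(2) card_seteq[of "{a, b, c}" F] by simp
  then have ne: "a \<noteq> b" "b \<noteq> c" "a \<noteq> c" using F(2) by (auto simp: card_insert_if split: if_splits)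
  have hull: "?f = {a + t *\<^sub>R (b - a) + u *\<^sub>R (c - a) | t u. 0 \<le> t \<and> 0 \<le> u \<and> t + u \<le> 1}"
    unfolding F_eq by (rule convex_hull_3_alt)
  show ?thesis
  proof (rule integral_like_parametrized[OF unit_triangle, of "\<lambda>(t, u). a + t *\<^sub>R (b - a) + u *\<^sub>R (c - a)" _ "norm (cross3 (b - a) (c - a))"])
    show "continuous_on ?S (\<lambda>(t, u). a + t *\<^sub>R (b - a) + u *\<^sub>R (c - a))"
      unfolding case_prod_beta by (intro continuous_intros)
    show "(\<lambda>(t, u). a + t *\<^sub>R (b - a) + u *\<^sub>R (c - a)) ` ?S = ?f" unfolding hull by force
    show "norm (cross3 (b - a) (c - a)) \<noteq> 0"
      using affine_dependent_3_cross[of a b c] F(1) ne F_eq by simp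
    show "face_integral ?f h = norm (cross3 (b - a) (c - a)) *
        integral ?S (\<lambda>s. h (case s of (t, u) \<Rightarrow> a + t *\<^sub>R (b - a) + u *\<^sub>R (c - a)))" for h
      using abc by (simp add: face_integral_def p_def[symmetric] case_prod_beta')
  qed
qed

lemma is_basis_finite:
  assumes "is_basis B V" "finite_dim V"
  shows "finite B" "card B = dim V"
  using assms finite_dim_independent basis_card_eq_dim unfolding is_basis_def by blast+

text \<open>By \<open>bubble_factor\<close>, p is the bubble of the simplex times some q of degree
  j, and q is itself a test function. The moment of p against q integrates the bubble times the
  square of q, which is nonnegative on the simplex and therefore vanishes pointwise.\<close>

lemma simplex_moments_vanish:
  fixes S :: "(real^3) set"
  assumes S: "\<not> affine_dependent S" "2 \<le> card S" and J: "integral_like (convex hull S) J"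
    and B: "is_basis B (polys j (convex hull S) UNIV)"
    and p: "p \<in> pol (UNIV :: real set) (j + card S)"
    and 0: "\<And>c x. c \<in> S \<Longrightarrow> x \<in> convex hull (S - {c}) \<Longrightarrow> p x = 0"
    and mom: "\<And>b. b \<in> B \<Longrightarrow> J (\<lambda>x. p x * b x) = 0"
    and x: "x \<in> convex hull S"
  shows "p x = 0"
proof -
  let ?D = "convex hull S"
  have "\<exists>q\<in>pol UNIV j. \<forall>x\<in>affine hull S. p x = (\<Prod>c\<in>S. lam S c x) *\<^sub>R q x"
    by (rule bubble_factor[OF S order_refl subspace_UNIV p 0])
  then obtain q where q: "q \<in> pol UNIV j" "\<And>x. x \<in> affine hull S \<Longrightarrow> p x = (\<Prod>c\<in>S. lam S c x) *\<^sub>R q x"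
    by blast
  have pq: "p x = (\<Prod>c\<in>S. lam S c x) * q x" if "x \<in> ?D" for x
    using q(2) that convex_hull_subset_affine_hull[of S] by auto
  have cp: "continuous_on ?D p" using p by (rule pol_continuous_on)
  have cq: "continuous_on ?D q" using q(1) by (rule pol_continuous_on)
  have cont: "continuous_on ?D b" if "b \<in> zero_ext ?D ` pol UNIV j" for b :: "real^3 \<Rightarrow> real"
  proof -
    obtain r where r: "r \<in> pol UNIV j" "b = zero_ext ?D r" using \<open>b \<in> _\<close> by blast
    show ?thesis using pol_continuous_on[OF r(1), of ?D]
      by (rule continuous_on_eq) (simp add: r(2) zero_ext_in)
  qed
  let ?U = "{b \<in> zero_ext ?D ` pol UNIV j. J (\<lambda>x. p x * b x) = 0}"
  have "subspace ?U"
  proof (rule lin_on_kernel_subspace[OF subspace_zero_ext_pol[OF subspace_UNIV]])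
    show "lin_on (zero_ext ?D ` pol UNIV j) (\<lambda>b. J (\<lambda>x. p x * b x))"
      unfolding lin_on_def
    proof (intro conjI ballI allI)
      fix b c :: "real^3 \<Rightarrow> real" assume "b \<in> zero_ext ?D ` pol UNIV j" "c \<in> zero_ext ?D ` pol UNIV j"
      then have "continuous_on ?D (\<lambda>x. p x * b x)" "continuous_on ?D (\<lambda>x. p x * c x)"
        by (intro continuous_on_mult cp cont; simp)+
      from integral_like_add[OF J this]
      show "J (\<lambda>x. p x * (b + c) x) = J (\<lambda>x. p x * b x) + J (\<lambda>x. p x * c x)" by (simp add: distrib_left)
    next
      fix r and b :: "real^3 \<Rightarrow> real" assume "b \<in> zero_ext ?D ` pol UNIV j"
      then have "continuous_on ?D (\<lambda>x. p x * b x)" by (intro continuous_on_mult cp cont)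
      from integral_like_mult[OF J this, of r]
      show "J (\<lambda>x. p x * (r *\<^sub>R b) x) = r *\<^sub>R J (\<lambda>x. p x * b x)" by (simp add: mult.left_commute)
    qed
  qed
  moreover have "B \<subseteq> ?U" using B mom unfolding is_basis_def polys_UNIV by blast
  ultimately have "span B \<subseteq> ?U" by (rule span_minimal[rotated])
  then have "zero_ext ?D q \<in> ?U" using B q(1) unfolding is_basis_def polys_UNIV by blast
  then have "J (\<lambda>x. p x * zero_ext ?D q x) = 0" by blast
  then have 1: "J (\<lambda>x. p x * q x) = 0"
    using integral_like_cong[OF J, of "\<lambda>x. p x * zero_ext ?D q x" "\<lambda>x. p x * q x"] by (simp add: zero_ext_in)
  have "p x * q x = 0"
  proof (rule integral_like_zero[OF J _ _ 1 x])
    show "continuous_on ?D (\<lambda>x. p x * q x)" by (intro continuous_intros cp cq)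
    fix y assume y: "y \<in> ?D"
    then have "0 \<le> (\<Prod>c\<in>S. lam S c y)" using convex_hull_lam[OF S(1)] by (intro prod_nonneg) blast
    then show "0 \<le> p y * q y" unfolding pq[OF y] by (simp add: mult.assoc)
  qed
  then show ?thesis using pq[OF x] by auto
qed

lemma mem_span_of_orthogonal:
  fixes s a b m :: "real^3"
  assumes s: "s \<noteq> 0" and ab: "s \<bullet> a = 0" "s \<bullet> b = 0" "a \<noteq> b" "independent {a, b}" and m: "s \<bullet> m = 0"
  shows "m \<in> span {a, b}"
proof -
  have "dim {x. s \<bullet> x = 0} = 2" using dim_hyperplane[OF s] by simp
  moreover have "{a, b} \<subseteq> {x. s \<bullet> x = 0}" using ab by simp
  ultimately have "{x. s \<bullet> x = 0} \<subseteq> span {a, b}"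
    using card_ge_dim_independent[of "{a, b}" "{x. s \<bullet> x = 0}"] ab(3,4) by simp
  then show ?thesis using m by blast
qed

context tetrahedron
begin

section \<open>Edges and faces of a tetrahedron\<close>

lemma edges_eq: "edges K = (hull) convex ` {D. D \<subseteq> C \<and> card D = 2}"
proof -
  have "aff_dim (convex hull D) = 1 \<longleftrightarrow> card D = 2" if "D \<subseteq> C" for D
    using aff_dim_affine_independent[OF affine_independent_subset[OF indep that]] by (auto simp: aff_dim_convex_hull)
  then show ?thesis
    unfolding edges_def K_def face_of_convex_hull_affine_independent[OF indep] by blast
qed

lemma facets_eq: "{f. f facet_of K} = facet ` C"
  by (auto simp: facet_iff)

lemma face_subset_K: "D \<subseteq> C \<Longrightarrow> convex hull D \<subseteq> K"
  unfolding K_def by (rule hull_mono)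

lemma edge_integral_like_K:
  assumes "e \<in> edges K" shows "integral_like e (edge_integral e)"
proof -
  obtain D where D: "D \<subseteq> C" "card D = 2" "e = convex hull D" using assms edges_eq by blast
  obtain u v where "D = {u, v}" "u \<noteq> v" using D(2) card_2_iff by metis
  then show ?thesis using edge_integral_like D(3) by blast
qed

lemma face_integral_like_K:
  assumes "c \<in> C" shows "integral_like (facet c) (face_integral (facet c))"
  unfolding facet_def
  by (rule face_integral_like[OF affine_independent_Diff[OF indep]])
    (use assms card_vertices finite_vertices in simp)

text \<open>The moments control every component of T in the basis s, nm, np except s'Ts, and the
  vertex values remove two degrees on the edge. Since m is a combination of nm and np, the symmetry
  of T keeps the untested s'Ts out of Tm.\<close>

lemma edge_field_vanish:
  assumes D: "D \<subseteq> C" "card D = 2" and e: "e = convex hull D"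
    and P: "P \<in> pol Sym (k + 3)" and V: "\<And>c. c \<in> C \<Longrightarrow> P c = 0"
    and s: "norm s = 1" "tangent_to e s" and nm: "normal_to e nm" and np: "normal_to e np"
    and ind: "nm \<noteq> np" "independent {nm, np}"
    and B: "is_basis B (polys (k + 1) e UNIV)"
    and mom: "\<And>a b q. (a, b) \<in> {(s, nm), (s, np), (nm, nm), (np, np), (nm, np)} \<Longrightarrow> q \<in> B \<Longrightarrow>
       edge_integral e (\<lambda>x. (a \<bullet> (P x *v b)) * q x) = 0"
    and m: "normal_to e m" and x: "x \<in> e"
  shows "P x *v m = 0"
proof -
  have eE: "e \<in> edges K" using D e edges_eq by blast
  have zero: "a \<bullet> (P x *v b) = 0" if ab: "(a, b) \<in> {(s, nm), (s, np), (nm, nm), (np, np), (nm, np)}" for a b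
  proof (rule simplex_moments_vanish[where S = D and j = "k + 1" and B = B and J = "edge_integral e" and p = "\<lambda>x. a \<bullet> (P x *v b)"])
    show "\<not> affine_dependent D" by (rule affine_independent_subset[OF indep D(1)])
    show "integral_like (convex hull D) (edge_integral e)" using edge_integral_like_K[OF eE] e by simp
    have "linear (\<lambda>T :: real^3^3. a \<bullet> (T *v b))"
      by (rule linearI) (simp_all add: matrix_vector_mult_add_rdistrib inner_add_right scaleR_matrix_vector_assoc[symmetric])
    from pol_linear[OF P this subset_UNIV] show "(\<lambda>x. a \<bullet> (P x *v b)) \<in> pol UNIV (k + 1 + card D)"
      using D(2) by (simp add: numeral_3_eq_3)
    fix c y assume c: "c \<in> D" "y \<in> convex hull (D - {c})"
    have "card (D - {c}) = 1" using D(2) c(1) by (simp add: card_Diff_singleton)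
    then obtain d where d: "D - {c} = {d}" using card_1_singletonE by blast
    then have "y = d" "d \<in> C" using c D(1) by auto
    then show "a \<bullet> (P y *v b) = 0" using V by simp
  qed (use D e B x ab mom in auto)
  have s0: "s \<noteq> 0" using s(1) by auto
  have tang: "s \<bullet> w = 0" if "normal_to e w" for w
    using s(2) that unfolding tangent_to_def normal_to_def by (auto simp: inner_commute)
  have sym: "P x \<in> Sym" by (rule pol_value[OF subspace_Sym P])
  \<comment> \<open>The normals nm and np need not be orthonormal. A vector orthogonal to s lies in
    their span, and if it is orthogonal to both, it is orthogonal to itself.\<close>
  have kill: "P x *v w = 0" if w: "s \<bullet> (P x *v w) = 0" "nm \<bullet> (P x *v w) = 0" "np \<bullet> (P x *v w) = 0" for w
  proof -
    let ?y = "P x *v w"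
    have "?y \<in> span {nm, np}"
      by (rule mem_span_of_orthogonal[OF s0 tang[OF nm] tang[OF np] ind w(1)])
    then have "orthogonal ?y ?y"
      by (rule orthogonal_to_span) (use w in \<open>auto simp: orthogonal_def inner_commute\<close>)
    then show ?thesis by (simp add: orthogonal_def)
  qed
  have n: "P x *v nm = 0" "P x *v np = 0"
    using kill[of nm] kill[of np] zero symmetric_matrix_inner[OF sym, of np nm] by auto
  have "m \<in> span {nm, np}"
    by (rule mem_span_of_orthogonal[OF s0 tang[OF nm] tang[OF np] ind tang[OF m]])
  then obtain \<alpha> \<beta> where "m = \<alpha> *\<^sub>R nm + \<beta> *\<^sub>R np" by (auto simp: span_insert span_singleton algebra_simps)
  then show ?thesis using n by (simp add: matrix_vector_right_distrib matrix_vector_mult_scaleR)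
qed

text \<open>A normal of the face is normal to its three edges, so Tn vanishes on the boundary of the
  face and each component contains the cubic bubble; k + 3 less three is the tested degree
  k.\<close>

lemma face_field_vanish:
  assumes c: "c \<in> C" and P: "P \<in> pol Sym (k + 3)"
    and n: "n \<noteq> 0" "normal_to (facet c) n"
    and edge: "\<And>D x m. D \<subseteq> C \<Longrightarrow> card D = 2 \<Longrightarrow> x \<in> convex hull D \<Longrightarrow> normal_to (convex hull D) m \<Longrightarrow> P x *v m = 0"
    and B: "is_basis B (polys k (facet c) UNIV)"
    and mom: "\<And>i q. q \<in> B \<Longrightarrow> face_integral (facet c) (\<lambda>x. (P x *v n) $ i * q x) = 0"
    and x: "x \<in> facet c"
  shows "P x *v g c = 0"
proof -
  have card: "card (C - {c}) = 3" using c card_vertices finite_vertices by simp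
  have "(P x *v n) $ i = 0" for i
  proof (rule simplex_moments_vanish[where S = "C - {c}" and j = k and B = B and J = "face_integral (facet c)" and p = "\<lambda>x. (P x *v n) $ i"])
    show "\<not> affine_dependent (C - {c})" by (rule affine_independent_Diff[OF indep])
    show "integral_like (convex hull (C - {c})) (face_integral (facet c))"
      using face_integral_like_K[OF c] by (simp add: facet_def)
    have "linear (\<lambda>T :: real^3^3. (T *v n) $ i)"
      by (rule linearI) (simp_all add: matrix_vector_mult_add_rdistrib scaleR_matrix_vector_assoc[symmetric])
    from pol_linear[OF P this subset_UNIV] show "(\<lambda>x. (P x *v n) $ i) \<in> pol UNIV (k + card (C - {c}))"
      by (simp only: card)
    fix d y assume d: "d \<in> C - {c}" and y: "y \<in> convex hull (C - {c} - {d})"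
    have "convex hull (C - {c} - {d}) \<subseteq> facet c" unfolding facet_def by (rule hull_mono) auto
    then have "normal_to (convex hull (C - {c} - {d})) n" using n(2) unfolding normal_to_def by blast
    moreover have "card (C - {c} - {d}) = 2" using card d by (simp add: card_Diff_singleton)
    ultimately have "P y *v n = 0" using edge[of "C - {c} - {d}" y n] y by blast
    then show "(P y *v n) $ i = 0" by simp
  qed (use card B mom x in \<open>auto simp: facet_def\<close>)
  then have Pn: "P x *v n = 0" by (simp add: vec_eq_iff)
  obtain r where r: "n = r *\<^sub>R g c" by (rule normal_to_facet[OF c n(2)])
  then have "r *\<^sub>R (P x *v g c) = 0" using Pn by (simp add: matrix_vector_mult_scaleR)
  then show ?thesis using r n(1) by auto
qed

lemma interior_moments_span:
  assumes T: "T \<in> zero_ext K ` pol Sym i" and B: "is_basis B V"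
    and V: "V \<subseteq> zero_ext K ` pol Sym j"
    and mom: "\<And>U. U \<in> B \<Longrightarrow> integral K (\<lambda>x. T x \<bullet> U x) = 0" and U: "U \<in> V"
  shows "integral K (\<lambda>x. T x \<bullet> U x) = 0"
proof -
  let ?W = "zero_ext K ` pol Sym j :: (real^3 \<Rightarrow> real^3^3) set"
  have "subspace {U \<in> ?W. integral K (\<lambda>x. U x \<bullet> T x) = 0}"
    by (rule lin_on_kernel_subspace[OF subspace_zero_ext_pol[OF subspace_Sym] lin_on_integral_inner[OF compact_K T]])
  moreover have "B \<subseteq> {U \<in> ?W. integral K (\<lambda>x. U x \<bullet> T x) = 0}"
    using B V mom unfolding is_basis_def by (auto simp: inner_commute)
  ultimately have "span B \<subseteq> {U \<in> ?W. integral K (\<lambda>x. U x \<bullet> T x) = 0}" by (rule span_minimal[rotated])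
  then show ?thesis using U B unfolding is_basis_def by (auto simp: inner_commute)
qed

lemma integral_square_zero:
  fixes u :: "real^3 \<Rightarrow> 'v::euclidean_space"
  assumes u: "u \<in> zero_ext K ` pol X j" and 0: "integral K (\<lambda>x. u x \<bullet> u x) = 0"
  shows "u = 0"
proof -
  obtain p where p: "p \<in> pol X j" "u = zero_ext K p" using u by blast
  have "integral K (\<lambda>x. p x \<bullet> p x) = integral K (\<lambda>x. u x \<bullet> u x)"
    by (rule integral_cong) (simp add: p(2) zero_ext_in)
  then have 1: "integral K (\<lambda>x. p x \<bullet> p x) = 0" using 0 by simp
  have "continuous_on K (\<lambda>x. p x \<bullet> p x)" by (intro continuous_intros pol_continuous_on[OF p(1)])
  then have "p x \<bullet> p x = 0" if "x \<in> K" for x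
    by (rule integral_zero_convex[OF compact_K convex_K interior_K _ _ 1 that]) simp
  then show ?thesis by (simp add: p(2) zero_ext_eq_0_iff)
qed

lemma sym_grad_V_space: "sym_grad_on K ` V_space k K \<subseteq> zero_ext K ` pol Sym (k - 1)"
proof (unfold V_space_def polys_UNIV, safe)
  fix p :: "real^3 \<Rightarrow> real^3" assume p: "p \<in> pol UNIV k"
  obtain p' where p': "\<And>x. (p has_derivative p' x) (at x)"
    by (rule pol_has_derivative[OF p subspace_UNIV]) blast
  show "sym_grad_on K (zero_ext K p) \<in> zero_ext K ` pol Sym (k - 1)"
    by (rule sym_grad_on_pol[OF p p']) blast
qed

lemma M_space_pol: "M_space (k + 3) K \<subseteq> zero_ext K ` pol Sym (k + 3)"
  by (auto simp: M_space_eq M_tilde_def)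

text \<open>By the definition of \<open>Sigma_space\<close>, div T lies in V_K, so \<epsilon>(div T)
  is an admissible test field; integration by parts turns its moment into minus the squared norm of
  div T. Then T belongs to \<open>M_space\<close> and serves as its own test field.\<close>

lemma normal_free_field_vanish:
  assumes T: "T \<in> Sigma_space k K" and nf: "normal_free T"
    and Beps: "is_basis Beps (sym_grad_on K ` V_space k K)" and BM: "is_basis BM (M_space (k + 3) K)"
    and mom: "\<And>U. U \<in> Beps \<union> BM \<Longrightarrow> integral K (\<lambda>x. T x \<bullet> U x) = 0"
  shows "T = 0"
proof -
  have TP: "T \<in> zero_ext K ` pol Sym (k + 1 + 2)"
    using T by (simp add: Sigma_space_eq numeral_3_eq_3)
  have div: "div_on K T \<in> zero_ext K ` pol UNIV k" using T by (simp add: Sigma_space_eq)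
  note eps = interior_moments_span[OF TP Beps sym_grad_V_space]
  have "integral K (\<lambda>x. T x \<bullet> sym_grad_on K (div_on K T) x) = 0"
    by (rule eps) (use mom div in \<open>auto simp: V_space_def polys_UNIV\<close>)
  then have "integral K (\<lambda>x. div_on K T x \<bullet> div_on K T x) = 0"
    using integration_by_parts[OF TP nf div] by simp
  from integral_square_zero[OF div this] have "div_on K T = 0" .
  then have "T \<in> M_space (k + 3) K"
    using TP nf unfolding M_space_eq M_tilde_def by (simp add: numeral_3_eq_3)
  then have "integral K (\<lambda>x. T x \<bullet> T x) = 0"
    using interior_moments_span[OF TP BM M_space_pol] mom by blast
  then show ?thesis by (rule integral_square_zero[OF TP])
qed

end

section \<open>Unisolvence\<close>

lemma choose_2_mult: "2 * ((n + 2) choose 2) = (n + 1) * (n + 2)"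
  using Suc_times_binomial_eq[of "n + 1" 1] by (simp add: numeral_2_eq_2 mult.commute)

lemma choose_3_mult: "6 * ((n + 3) choose 3) = (n + 1) * (n + 2) * (n + 3)"
proof -
  have "3 * ((n + 3) choose 3) = (n + 3) * ((n + 2) choose 2)"
    using Suc_times_binomial_eq[of "n + 2" 2] by (simp add: numeral_3_eq_3 numeral_2_eq_2 mult.commute)
  then have "6 * ((n + 3) choose 3) = (n + 3) * (2 * ((n + 2) choose 2))" by simp
  then show ?thesis unfolding choose_2_mult by (simp add: mult_ac)
qed

text \<open>Degrees of freedom take the value \<open>undefined\<close> off X; linearity on X
  survives because sums and multiples of elements of X stay in X.\<close>

lemma lin_on_restrict:
  assumes "subspace X" "lin_on X F" shows "lin_on X (\<lambda>T\<in>X. F T)"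
  using assms by (auto simp: lin_on_def subspace_add subspace_scale)

context tetrahedron
begin

lemma lin_on_moment:
  assumes D: "D \<subseteq> K" and J: "integral_like D J" and q: "continuous_on D q" and L: "linear (L :: real^3^3 \<Rightarrow> real)"
  shows "lin_on (Sigma_space k K) (\<lambda>T\<in>Sigma_space k K. J (\<lambda>x. L (T x) * q x))"
proof (rule lin_on_restrict[OF subspace_Sigma_space])
  have cont: "continuous_on D (\<lambda>x. L (T x) * q x)" if "T \<in> Sigma_space k K" for T
  proof -
    obtain P where P: "P \<in> pol Sym (k + 3)" "T = zero_ext K P" using \<open>T \<in> Sigma_space k K\<close> unfolding Sigma_space_eq by blast
    have "continuous_on D (\<lambda>x. L (P x) * q x)"
      by (intro continuous_intros q pol_continuous_on[OF pol_linear[OF P(1) L subset_UNIV]])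
    then show ?thesis by (rule continuous_on_eq) (use D P(2) in \<open>auto simp: zero_ext_in\<close>)
  qed
  show "lin_on (Sigma_space k K) (\<lambda>T. J (\<lambda>x. L (T x) * q x))"
    unfolding lin_on_def
  proof (intro conjI ballI allI)
    fix S T assume "S \<in> Sigma_space k K" "T \<in> Sigma_space k K"
    from integral_like_add[OF J cont[OF this(1)] cont[OF this(2)]]
    show "J (\<lambda>x. L ((S + T) x) * q x) = J (\<lambda>x. L (S x) * q x) + J (\<lambda>x. L (T x) * q x)"
      by (simp add: linear_add[OF L] distrib_right)
  next
    fix c T assume "T \<in> Sigma_space k K"
    from integral_like_mult[OF J cont[OF this], of c]
    show "J (\<lambda>x. L ((c *\<^sub>R T) x) * q x) = c *\<^sub>R J (\<lambda>x. L (T x) * q x)"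
      by (simp add: linear_scale[OF L] mult.assoc)
  qed
qed

lemma polys_basis_continuous:
  assumes "is_basis B (polys j D UNIV)" "q \<in> B"
  shows "continuous_on D (q :: real^3 \<Rightarrow> real)"
proof -
  obtain p where p: "p \<in> pol UNIV j" "q = zero_ext D p"
    using assms unfolding is_basis_def polys_UNIV by blast
  show ?thesis using pol_continuous_on[OF p(1), of D] by (rule continuous_on_eq) (simp add: p(2) zero_ext_in)
qed

section \<open>Upper bounds for the numbers of functionals\<close>

lemma card_polys_basis:
  assumes B: "is_basis B (polys j (convex hull D) (UNIV :: real set))" and D: "D \<subseteq> C" "card D = Suc d"
  shows "finite B" "card B = (j + d) choose d"
  using is_basis_finite[OF B] dim_zero_ext_pol[OF affine_independent_subset[OF indep D(1)] D(2) subspace_UNIV, where 'v = real, of j]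
  by (simp_all add: polys_UNIV finite_dim_zero_ext_pol)

lemma Sigma_space_symmetric: "T \<in> Sigma_space k K \<Longrightarrow> T x \<in> Sym"
  using pol_value[OF subspace_Sym] subspace_0[OF subspace_Sym]
  by (auto simp: Sigma_space_eq zero_ext_def)

lemma extreme_points_K: "v extreme_point_of K \<longleftrightarrow> v \<in> C"
  unfolding K_def by (rule extreme_point_of_convex_hull_affine_independent[OF indep])

text \<open>For each boundary kind only an upper bound is proved, since functionals given by
  different data might agree on \<Sigma>_K; that the bounds are attained is left to the final count.
  By symmetry six index pairs suffice at each vertex.\<close>

lemma card_vertex_dofs:
  "finite (vertex_dofs (Sigma_space k K) K)" "card (vertex_dofs (Sigma_space k K) K) \<le> 24"
proof -
  let ?I = "{(1, 1), (2, 2), (3, 3), (1, 2), (1, 3), (2, 3)} :: (3 \<times> 3) set"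
  let ?F = "\<lambda>(v, i, j). (\<lambda>T\<in>Sigma_space k K. T v $ i $ j)"
  have "vertex_dofs (Sigma_space k K) K \<subseteq> ?F ` (C \<times> ?I)"
  proof
    fix l assume "l \<in> vertex_dofs (Sigma_space k K) K"
    then obtain v i j where l: "l = (\<lambda>T\<in>Sigma_space k K. T v $ i $ j)" "v \<in> C"
      unfolding vertex_dofs_def extreme_points_K by blast
    have "transpose (T v) = T v" if "T \<in> Sigma_space k K" for T
      using Sigma_space_symmetric[OF that] by (simp add: symmetric_matrices_def)
    then have "T v $ j $ i = T v $ i $ j" if "T \<in> Sigma_space k K" for T
      using that by (metis (no_types) transpose_def vec_lambda_beta)
    then have sw: "?F (v, j, i) = ?F (v, i, j)" by (auto simp: restrict_def)
    have "(i, j) \<in> ?I \<or> (j, i) \<in> ?I" using exhaust_3[of i] exhaust_3[of j] by auto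
    then show "l \<in> ?F ` (C \<times> ?I)"
    proof
      assume "(i, j) \<in> ?I"
      then show ?thesis using l by (intro image_eqI[of _ _ "(v, i, j)"]) auto
    next
      assume "(j, i) \<in> ?I"
      then show ?thesis using l sw by (intro image_eqI[of _ _ "(v, j, i)"]) auto
    qed
  qed
  moreover have "finite (C \<times> ?I)" using finite_vertices by simp
  moreover have "card (C \<times> ?I) \<le> 24"
  proof -
    have "card ?I \<le> 6" by (simp add: card_insert_if)
    then show ?thesis using card_vertices by (simp add: card_cartesian_product)
  qed
  ultimately show "finite (vertex_dofs (Sigma_space k K) K)" "card (vertex_dofs (Sigma_space k K) K) \<le> 24"
    by (auto intro: finite_subset) (meson card_image_le card_mono finite_imageI order_trans)
qed

lemma card_image_pairs_le:
  assumes "finite A" "card A \<le> m" "finite B" "card B \<le> n"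
  shows "card (F ` (A \<times> B)) \<le> m * n"
  using card_image_le[of "A \<times> B" F] mult_mono[OF assms(2,4)] assms(1,3)
  by (simp add: card_cartesian_product)

lemma card_edge_dofs:
  assumes B: "\<And>e. e \<in> edges K \<Longrightarrow> is_basis (B e) (polys (k + 1) e UNIV)"
  shows "finite (edge_dofs X K s nm np B)" "card (edge_dofs X K s nm np B) \<le> 30 * k + 60"
proof -
  let ?I = "\<lambda>e. {(s e, nm e), (s e, np e), (nm e, nm e), (np e, np e), (nm e, np e)}"
  let ?F = "\<lambda>e ((a, b), q). (\<lambda>T\<in>X. edge_integral e (\<lambda>x. (a \<bullet> (T x *v b)) * q x))"
  let ?U = "\<Union>e\<in>edges K. ?F e ` (?I e \<times> B e)"
  have sub: "edge_dofs X K s nm np B \<subseteq> ?U"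
  proof
    fix l assume "l \<in> edge_dofs X K s nm np B"
    then obtain e a b q where l: "l = ?F e ((a, b), q)" and e: "e \<in> edges K" and q: "q \<in> B e" and ab: "(a, b) \<in> ?I e"
      unfolding edge_dofs_def by fast
    have "((a, b), q) \<in> ?I e \<times> B e" using ab q by blast
    then show "l \<in> ?U" using l e by blast
  qed
  have e: "finite (edges K)" "card (edges K) \<le> 6"
    unfolding edges_eq using card_vertex_pairs card_image_le[OF card_vertex_pairs(1), of "(hull) convex"] by auto
  have b: "finite (B e)" "card (B e) = k + 2" if "e \<in> edges K" for e
  proof -
    obtain D where D: "D \<subseteq> C" "card D = Suc 1" "e = convex hull D"
      using \<open>e \<in> edges K\<close> unfolding edges_eq numeral_2_eq_2 One_nat_def by blast
    show "finite (B e)" "card (B e) = k + 2" using card_polys_basis[OF _ D(1,2), of "B e" "k + 1"] B[OF that] D(3) by auto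
  qed
  have I: "card (?I e) \<le> 5" for e by (simp add: card_insert_if)
  have fin: "finite ?U" using e(1) b(1) by blast
  then show "finite (edge_dofs X K s nm np B)" by (rule finite_subset[OF sub])
  have "card (edge_dofs X K s nm np B) \<le> card ?U" by (rule card_mono[OF fin sub])
  also have "\<dots> \<le> card (edges K) * (5 * (k + 2))"
    by (rule card_UN_le_mult[OF e(1)], rule card_image_pairs_le) (use I b in auto)
  also have "\<dots> \<le> 6 * (5 * (k + 2))" by (rule mult_right_mono[OF e(2)]) simp
  finally show "card (edge_dofs X K s nm np B) \<le> 30 * k + 60" by simp
qed

lemma card_face_dofs:
  assumes B: "\<And>f. f facet_of K \<Longrightarrow> is_basis (B f) (polys k f UNIV)"
  shows "finite (face_dofs X K n B)" "card (face_dofs X K n B) \<le> 6 * k^2 + 18 * k + 12"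
proof -
  let ?F = "\<lambda>f (i, q). (\<lambda>T\<in>X. face_integral f (\<lambda>x. (T x *v n f) $ i * q x))"
  have eq: "face_dofs X K n B = (\<Union>f\<in>{f. f facet_of K}. ?F f ` (UNIV \<times> B f))"
    unfolding face_dofs_def by (rule set_eqI) (force simp: image_iff)
  have e: "finite {f. f facet_of K}" "card {f. f facet_of K} \<le> 4"
    unfolding facets_eq using finite_vertices card_image_le[OF finite_vertices, of facet] card_vertices by auto
  have b: "finite (B f)" "card (B f) = (k + 2) choose 2" if "f facet_of K" for f
  proof -
    obtain c where c: "c \<in> C" "f = convex hull (C - {c})" using \<open>f facet_of K\<close> unfolding facet_iff facet_def by blast
    have card: "card (C - {c}) = Suc 2" using c(1) card_vertices finite_vertices by simp
    show "finite (B f)" "card (B f) = (k + 2) choose 2"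
      using card_polys_basis[OF _ Diff_subset card, of "B f" k] B[OF that] c(2) by auto
  qed
  show "finite (face_dofs X K n B)" unfolding eq
    by (intro finite_UN_I finite_imageI finite_cartesian_product e(1) finite) (simp add: b(1))
  have "card (face_dofs X K n B) \<le> card {f. f facet_of K} * (3 * ((k + 2) choose 2))"
    unfolding eq by (rule card_UN_le_mult[OF e(1)], rule card_image_pairs_le) (use b in auto)
  also have "\<dots> \<le> 4 * (3 * ((k + 2) choose 2))" by (rule mult_right_mono[OF e(2)]) simp
  also have "\<dots> = 6 * ((k + 1) * (k + 2))" unfolding choose_2_mult[symmetric] by simp
  finally show "card (face_dofs X K n B) \<le> 6 * k^2 + 18 * k + 12"
    by (simp add: algebra_simps power2_eq_square)
qed

lemma card_interior_dofs:
  assumes "is_basis B V" "V \<subseteq> zero_ext K ` pol Sym j"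
  shows "finite (interior_dofs X K B)" "card (interior_dofs X K B) \<le> dim V"
proof -
  have "finite_dim V" by (rule finite_dim_subset[OF finite_dim_zero_ext_pol[OF subspace_Sym] assms(2)])
  note B = is_basis_finite[OF assms(1) this]
  have eq: "interior_dofs X K B = (\<lambda>U. \<lambda>T\<in>X. integral K (\<lambda>x. T x \<bullet> U x)) ` B"
    unfolding interior_dofs_def by blast
  show "finite (interior_dofs X K B)" "card (interior_dofs X K B) \<le> dim V"
    unfolding eq using B card_image_le[OF B(1)] by auto
qed

theorem unisolvence:
  assumes k: "1 \<le> k"
    and s: "\<And>e. e \<in> edges K \<Longrightarrow> norm (s e) = 1 \<and> tangent_to e (s e)"
    and nmp: "\<And>e. e \<in> edges K \<Longrightarrow> normal_to e (nm e) \<and> normal_to e (np e)"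
    and ind: "\<And>e. e \<in> edges K \<Longrightarrow> nm e \<noteq> np e \<and> independent {nm e, np e}"
    and n: "\<And>f. f facet_of K \<Longrightarrow> n f \<noteq> 0 \<and> normal_to f (n f)"
    and Bedge: "\<And>e. e \<in> edges K \<Longrightarrow> is_basis (Bedge e) (polys (k + 1) e UNIV)"
    and Bface: "\<And>f. f facet_of K \<Longrightarrow> is_basis (Bface f) (polys k f UNIV)"
    and Beps: "is_basis Beps (sym_grad_on K ` V_space k K)"
    and BM: "is_basis BM (M_space (k + 3) K)"
  defines "X \<equiv> Sigma_space k K"
  defines "L1 \<equiv> vertex_dofs X K" and "L2 \<equiv> edge_dofs X K s nm np Bedge" and "L3 \<equiv> face_dofs X K n Bface"
    and "L4 \<equiv> interior_dofs X K Beps" and "L5 \<equiv> interior_dofs X K BM"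
  shows "dim X = k^3 + 12 * k^2 + 56 * k + 93 \<and> card L1 = 24 \<and> card L2 = 30 * k + 60 \<and>
    card L3 = 6 * k^2 + 18 * k + 12 \<and>
    real (card L4) = (real k + 3) * (real k + 2) * (real k + 1) / 2 - 6 \<and>
    real (card L5) = (real k + 5) * (real k + 1) * real k / 2 \<and>
    unisolvent X (L1 \<union> L2 \<union> L3 \<union> L4 \<union> L5)"
proof -
  let ?L = "L1 \<union> L2 \<union> L3 \<union> L4 \<union> L5"
  have X: "subspace X" "finite_dim X" unfolding X_def by (rule subspace_Sigma_space, rule finite_dim_Sigma_space)
  have XP: "X \<subseteq> zero_ext K ` pol Sym (k + 3)" by (auto simp: X_def Sigma_space_eq)
  note c1 = card_vertex_dofs[of k, folded X_def, folded L1_def]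
  note c2 = card_edge_dofs[OF Bedge, of X s nm np, folded L2_def]
  note c3 = card_face_dofs[OF Bface, of X n, folded L3_def]
  note c4 = card_interior_dofs[OF Beps sym_grad_V_space, of X, folded L4_def]
  note c5 = card_interior_dofs[OF BM M_space_pol, of X, folded L5_def]
  have fin: "finite ?L" using c1 c2 c3 c4 c5 by simp
  have lin: "lin_on X l" if l: "l \<in> ?L" for l
  proof -
    have int: "lin_on X (\<lambda>T\<in>X. integral K (\<lambda>x. T x \<bullet> U x))" if "U \<in> zero_ext K ` pol Sym j" for U j
      by (rule lin_on_restrict[OF X(1) lin_on_subset[OF lin_on_integral_inner[OF compact_K that] XP]])
    from l consider "l \<in> L1" | "l \<in> L2" | "l \<in> L3" | "l \<in> L4" | "l \<in> L5" by blast
    then show ?thesis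
    proof cases
      case 1
      then obtain v i j where "l = (\<lambda>T\<in>X. T v $ i $ j)" unfolding L1_def vertex_dofs_def by blast
      then show ?thesis using lin_on_restrict[OF X(1), of "\<lambda>T. T v $ i $ j"] by (simp add: lin_on_def)
    next
      case 2
      then obtain e a b q where l: "l = (\<lambda>T\<in>X. edge_integral e (\<lambda>x. (a \<bullet> (T x *v b)) * q x))"
        and e: "e \<in> edges K" "q \<in> Bedge e" unfolding L2_def edge_dofs_def by blast
      have "linear (\<lambda>T :: real^3^3. a \<bullet> (T *v b))"
        by (rule linearI) (simp_all add: matrix_vector_mult_add_rdistrib inner_add_right scaleR_matrix_vector_assoc[symmetric])
      moreover have "e \<subseteq> K" using e(1) edges_eq face_subset_K by blast
      ultimately show ?thesis unfolding l X_def
        using lin_on_moment[OF _ edge_integral_like_K[OF e(1)] polys_basis_continuous[OF Bedge[OF e(1)] e(2)]] by blast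
    next
      case 3
      then obtain f i q where l: "l = (\<lambda>T\<in>X. face_integral f (\<lambda>x. (T x *v n f) $ i * q x))"
        and f: "f facet_of K" "q \<in> Bface f" unfolding L3_def face_dofs_def by blast
      obtain c where c: "c \<in> C" "f = facet c" using f(1) facet_iff by blast
      have "linear (\<lambda>T :: real^3^3. (T *v n f) $ i)"
        by (rule linearI) (simp_all add: matrix_vector_mult_add_rdistrib scaleR_matrix_vector_assoc[symmetric])
      moreover have "integral_like f (face_integral f)" using face_integral_like_K c by simp
      moreover have "f \<subseteq> K" using c(2) facet_subset by simp
      ultimately show ?thesis unfolding l X_def
        using lin_on_moment[OF _ _ polys_basis_continuous[OF Bface[OF f(1)] f(2)]] by blast
    next
      case 4
      then obtain U where U: "l = (\<lambda>T\<in>X. integral K (\<lambda>x. T x \<bullet> U x))" "U \<in> Beps"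
        unfolding L4_def interior_dofs_def by blast
      show ?thesis unfolding U(1) by (rule int) (use U(2) Beps sym_grad_V_space in \<open>unfold is_basis_def, blast\<close>)
    next
      case 5
      then obtain U where U: "l = (\<lambda>T\<in>X. integral K (\<lambda>x. T x \<bullet> U x))" "U \<in> BM"
        unfolding L5_def interior_dofs_def by blast
      show ?thesis unfolding U(1) by (rule int) (use U(2) BM M_space_pol in \<open>unfold is_basis_def, blast\<close>)
    qed
  qed
  have zero: "T = 0" if T: "T \<in> X" and 0: "\<And>l. l \<in> ?L \<Longrightarrow> l T = 0" for T
  proof -
    obtain P where P: "P \<in> pol Sym (k + 3)" "T = zero_ext K P" using T XP by blast
    have TP: "T x = P x" if "x \<in> K" for x using that P(2) by (simp add: zero_ext_in)
    have V: "P c = 0" if c: "c \<in> C" for c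
    proof -
      have "T c $ i $ j = 0" for i j
      proof -
        have "(\<lambda>T\<in>X. T c $ i $ j) \<in> ?L" using c unfolding L1_def vertex_dofs_def extreme_points_K by blast
        from 0[OF this] show ?thesis using T by simp
      qed
      then show ?thesis using TP[OF vertex_in_K[OF c]] by (simp add: vec_eq_iff)
    qed
    have edge: "P x *v m = 0"
      if D: "D \<subseteq> C" "card D = 2" and x: "x \<in> convex hull D" and m: "normal_to (convex hull D) m" for D x m
    proof -
      let ?e = "convex hull D"
      have e: "?e \<in> edges K" using D edges_eq by blast
      show ?thesis
      proof (rule edge_field_vanish[OF D refl P(1) V _ _ _ _ _ _ Bedge[OF e] _ m x, where s = "s ?e" and nm = "nm ?e" and np = "np ?e"])
        fix a b q assume ab: "(a, b) \<in> {(s ?e, nm ?e), (s ?e, np ?e), (nm ?e, nm ?e), (np ?e, np ?e), (nm ?e, np ?e)}"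
          and q: "q \<in> Bedge ?e"
        have "(\<lambda>T\<in>X. edge_integral ?e (\<lambda>x. (a \<bullet> (T x *v b)) * q x)) \<in> ?L"
          using e ab q unfolding L2_def edge_dofs_def by blast
        from 0[OF this] have "edge_integral ?e (\<lambda>x. (a \<bullet> (T x *v b)) * q x) = 0" using T by simp
        moreover have "edge_integral ?e (\<lambda>x. (a \<bullet> (T x *v b)) * q x) = edge_integral ?e (\<lambda>x. (a \<bullet> (P x *v b)) * q x)"
          by (rule integral_like_cong[OF edge_integral_like_K[OF e]]) (use TP face_subset_K[OF D(1)] in auto)
        ultimately show "edge_integral ?e (\<lambda>x. (a \<bullet> (P x *v b)) * q x) = 0" by simp
      qed (use s[OF e] nmp[OF e] ind[OF e] in auto)
    qed
    have "P x *v g c = 0" if c: "c \<in> C" and x: "x \<in> facet c" for c x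
    proof -
      have f: "facet c facet_of K" using c facet_iff by blast
      show ?thesis
      proof (rule face_field_vanish[OF c P(1) _ _ edge Bface[OF f] _ x, where n = "n (facet c)"])
        fix i q assume q: "q \<in> Bface (facet c)"
        have "(\<lambda>T\<in>X. face_integral (facet c) (\<lambda>x. (T x *v n (facet c)) $ i * q x)) \<in> ?L"
          using f q unfolding L3_def face_dofs_def by blast
        from 0[OF this] have "face_integral (facet c) (\<lambda>x. (T x *v n (facet c)) $ i * q x) = 0" using T by simp
        moreover have "face_integral (facet c) (\<lambda>x. (T x *v n (facet c)) $ i * q x) =
            face_integral (facet c) (\<lambda>x. (P x *v n (facet c)) $ i * q x)"
          by (rule integral_like_cong[OF face_integral_like_K[OF c]]) (simp add: TP[OF subsetD[OF facet_subset]])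
        ultimately show "face_integral (facet c) (\<lambda>x. (P x *v n (facet c)) $ i * q x) = 0" by simp
      qed (use n[OF f] in auto)
    qed
    then have "normal_free T" unfolding P(2) normal_free_zero_ext unfolding normal_free_def by blast
    moreover have "integral K (\<lambda>x. T x \<bullet> U x) = 0" if U: "U \<in> Beps \<union> BM" for U
    proof -
      have "(\<lambda>T\<in>X. integral K (\<lambda>x. T x \<bullet> U x)) \<in> ?L"
        using U unfolding L4_def L5_def interior_dofs_def by blast
      from 0[OF this] show ?thesis using T by simp
    qed
    ultimately show ?thesis using normal_free_field_vanish[OF _ _ Beps BM] T unfolding X_def by blast
  qed
  have "dim X \<le> dim {T \<in> X. \<forall>l\<in>?L. l T = 0} + card ?L"
    by (rule dim_le_card_functionals[OF X fin lin])
  moreover have "dim {T \<in> X. \<forall>l\<in>?L. l T = 0} \<le> card ({} :: (real^3 \<Rightarrow> real^3^3) set)"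
    by (rule dim_le_card) (use zero in auto)
  ultimately have dim_le: "dim X \<le> card ?L" by simp
  \<comment> \<open>The five kinds are not known to be disjoint at this point; equality in this
    estimate is obtained only from the count.\<close>
  have card_le: "card ?L \<le> card L1 + card L2 + card L3 + card L4 + card L5"
    by (intro order_trans[OF card_Un_le] add_mono order_refl)
  have "real (6 * ((k + 3) choose 3)) = (real k + 1) * (real k + 2) * (real k + 3)"
    unfolding choose_3_mult by (simp add: algebra_simps)
  moreover have "real (6 * ((k + 1 + 3) choose 3)) = (real k + 2) * (real k + 3) * (real k + 4)"
    unfolding choose_3_mult by (simp add: algebra_simps)
  moreover have "real (6 * ((k + 2 + 3) choose 3)) = (real k + 3) * (real k + 4) * (real k + 5)"
    unfolding choose_3_mult by (simp add: algebra_simps)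
  moreover have "real (6 * ((k + 3 + 3) choose 3)) = (real k + 4) * (real k + 5) * (real k + 6)"
    unfolding choose_3_mult by (simp add: algebra_simps)
  moreover have "k + 1 + 3 = k + 4" "k + 2 + 3 = k + 5" "k + 3 + 3 = k + 6" by simp_all
  ultimately have choose:
    "6 * real ((k + 3) choose 3) = (real k + 1) * (real k + 2) * (real k + 3)"
    "6 * real ((k + 4) choose 3) = (real k + 2) * (real k + 3) * (real k + 4)"
    "6 * real ((k + 5) choose 3) = (real k + 3) * (real k + 4) * (real k + 5)"
    "6 * real ((k + 6) choose 3) = (real k + 4) * (real k + 5) * (real k + 6)"
    by (simp_all only: of_nat_mult of_nat_numeral)
  have X_ge: "real (dim X) \<ge> real k ^ 3 + 12 * real k ^ 2 + 56 * real k + 93"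
  proof -
    have "real (6 * ((k + 6) choose 3) + 3 * ((k + 3) choose 3)) \<le> real (dim X + 3 * ((k + 5) choose 3))"
      unfolding X_def using dim_Sigma_space_ge by (rule of_nat_mono)
    then show ?thesis using choose by (simp add: algebra_simps power2_eq_square power3_eq_cube)
  qed
  have L4_le: "real (card L4) \<le> (real k + 3) * (real k + 2) * (real k + 1) / 2 - 6"
  proof -
    have "card L4 + 6 \<le> 3 * ((k + 3) choose 3)" using c4(2) dim_sym_grad_image[OF k] by simp
    then have "real (card L4 + 6) \<le> real (3 * ((k + 3) choose 3))" by (rule of_nat_mono)
    then show ?thesis using choose(1) by (simp add: algebra_simps)
  qed
  have L5_le: "real (card L5) \<le> (real k + 5) * (real k + 1) * real k / 2"
  proof -
    have "card L5 + 3 * ((k + 5) choose 3) \<le> 6 * ((k + 4) choose 3) + 6" using c5(2) dim_M_space[of k] by simp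
    then have "real (card L5 + 3 * ((k + 5) choose 3)) \<le> real (6 * ((k + 4) choose 3) + 6)" by (rule of_nat_mono)
    then show ?thesis using choose(2,3) by (simp add: algebra_simps)
  qed
  have L_le: "real (card L1) \<le> 24" "real (card L2) \<le> 30 * real k + 60" "real (card L3) \<le> 6 * real k ^ 2 + 18 * real k + 12"
    using of_nat_mono[OF c1(2), where 'a = real] of_nat_mono[OF c2(2), where 'a = real] of_nat_mono[OF c3(2), where 'a = real]
    by simp_all
  \<comment> \<open>The three boundary kinds contribute 6 k^2 + 48 k + 96, the two interior kinds
    k^3 + 6 k^2 + 8 k - 3.\<close>
  have total: "24 + (30 * real k + 60) + (6 * real k ^ 2 + 18 * real k + 12) +
      ((real k + 3) * (real k + 2) * (real k + 1) / 2 - 6) + (real k + 5) * (real k + 1) * real k / 2 =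
      real k ^ 3 + 12 * real k ^ 2 + 56 * real k + 93"
    by (simp add: field_simps power2_eq_square power3_eq_cube)
  have "real (dim X) \<le> real (card ?L)"
    "real (card ?L) \<le> real (card L1) + real (card L2) + real (card L3) + real (card L4) + real (card L5)"
    using of_nat_mono[OF dim_le, where 'a = real] of_nat_mono[OF card_le, where 'a = real] by simp_all
  then have eqs: "real (card ?L) = real (dim X)" "real (dim X) = real k ^ 3 + 12 * real k ^ 2 + 56 * real k + 93"
    "real (card L1) = 24" "real (card L2) = 30 * real k + 60" "real (card L3) = 6 * real k ^ 2 + 18 * real k + 12"
    "real (card L4) = (real k + 3) * (real k + 2) * (real k + 1) / 2 - 6"
    "real (card L5) = (real k + 5) * (real k + 1) * real k / 2"
    using X_ge L_le L4_le L5_le total by linarith+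
  have "real (dim X) = real (k^3 + 12 * k^2 + 56 * k + 93)" "real (card L1) = real 24"
    "real (card L2) = real (30 * k + 60)" "real (card L3) = real (6 * k^2 + 18 * k + 12)"
    using eqs by simp_all
  then have "dim X = k^3 + 12 * k^2 + 56 * k + 93" "card L1 = 24" "card L2 = 30 * k + 60" "card L3 = 6 * k^2 + 18 * k + 12"
    by (simp_all only: of_nat_eq_iff)
  moreover have "unisolvent X ?L"
    unfolding unisolvent_def
  proof (intro conjI ballI impI)
    show "finite ?L" by (rule fin)
    show "card ?L = dim X" using eqs(1) by (simp only: of_nat_eq_iff)
    fix T T' assume TT: "T \<in> X" "T' \<in> X" and eq: "\<forall>l\<in>?L. l T = l T'"
    have "T - T' = 0"
    proof (rule zero)
      show "T - T' \<in> X" by (rule subspace_diff[OF X(1) TT])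
      fix l assume l: "l \<in> ?L"
      have "l (T - T') = l T - l T'" by (rule lin_on_diff[OF X(1) lin[OF l] TT])
      then show "l (T - T') = 0" using eq l by simp
    qed
    then show "T = T'" by simp
  qed
  ultimately show ?thesis using eqs(6,7) by blast
qed

end

theorem mainTheorem2:
  fixes k :: nat and K :: "(real^3) set"
    and s nm np n :: "(real^3) set \<Rightarrow> real^3"
    and Bedge Bface :: "(real^3) set \<Rightarrow> (real^3 \<Rightarrow> real) set"
    and Beps BM :: "(real^3 \<Rightarrow> real^3^3) set"
  assumes "k \<ge> 1" and "3 simplex K"
    and "\<And>e. e \<in> edges K \<Longrightarrow> norm (s e) = 1 \<and> tangent_to e (s e)"
    and "\<And>e. e \<in> edges K \<Longrightarrow> normal_to e (nm e) \<and> normal_to e (np e)"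
    and "\<And>e. e \<in> edges K \<Longrightarrow> nm e \<noteq> np e \<and> independent {nm e, np e}"
    and "\<And>f. f facet_of K \<Longrightarrow> n f \<noteq> 0 \<and> normal_to f (n f)"
    and "\<And>e. e \<in> edges K \<Longrightarrow> is_basis (Bedge e) (polys (k + 1) e UNIV)"
    and "\<And>f. f facet_of K \<Longrightarrow> is_basis (Bface f) (polys k f UNIV)"
    and "is_basis Beps (sym_grad_on K ` V_space k K)"
    and "is_basis BM (M_space (k + 3) K)"
  shows "dim (Sigma_space k K) = k^3 + 12 * k^2 + 56 * k + 93 \<and>
    card (vertex_dofs (Sigma_space k K) K) = 24 \<and>
    card (edge_dofs (Sigma_space k K) K s nm np Bedge) = 30 * k + 60 \<and>
    card (face_dofs (Sigma_space k K) K n Bface) = 6 * k^2 + 18 * k + 12 \<and>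
    real (card (interior_dofs (Sigma_space k K) K Beps)) =
      (real k + 3) * (real k + 2) * (real k + 1) / 2 - 6 \<and>
    real (card (interior_dofs (Sigma_space k K) K BM)) =
      (real k + 5) * (real k + 1) * real k / 2 \<and>
    unisolvent (Sigma_space k K)
      (vertex_dofs (Sigma_space k K) K \<union>
       edge_dofs (Sigma_space k K) K s nm np Bedge \<union>
       face_dofs (Sigma_space k K) K n Bface \<union>
       interior_dofs (Sigma_space k K) K Beps \<union>
       interior_dofs (Sigma_space k K) K BM)"
proof -
  obtain C where C: "\<not> affine_dependent C" "int (card C) = 3 + 1" "K = convex hull C"
    using assms(2) unfolding simplex_def by blast
  interpret tetrahedron C by unfold_locales (use C in auto)
  have K: "K = tetrahedron.K C" using C(3) K_def by simp
  show ?thesis using assms(1,3-) unfolding K by (rule unisolvence)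
qed

end
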